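(* Let $1\le p<\infty$, let $p'$ be the conjugate exponent ($\frac1p+\frac1{p'}=1$), and let $M\in L^{p}(\mathbb{T}^{2})$. Define functions $u,v$ on $\mathbb{T}$ by $$\frac{1}{u(x)}=\left(\int_{\mathbb{T}}|M(x,y)|^{-p'}\,dy\right)^{1/p'},\qquad \frac{1}{v(y)}=\left(\int_{\mathbb{T}}|M(x,y)|^{-p'}\,dx\right)^{1/p'}.$$ Then the system $\{M(x,y)e^{ikx}e^{imy}:(k,m)\in\mathbb{Z}^2\setminus\{(0,0)\}\}$ is complete and minimal in $L^{p}(\mathbb{T}^{2})$ if and only if both systems $\{u(t)e^{int}:n\in\mathbb{Z}\setminus\{0\}\}$ and $\{v(t)e^{int}:n\in\mathbb{Z}\setminus\{0\}\}$ are complete and minimal in $L^{p}(\mathbb{T})$.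
   Context: $\mathbb{T}=\mathbb{R}/2\pi\mathbb{Z}$ with Lebesgue measure; functions are complex valued. A system in a Banach space is complete if its closed linear span is the whole space, and minimal if no element lies in the closed linear span of the others. Conventions: $1/0=+\infty$ and $1/(+\infty)=0$, so $u$ and $v$ take values in $[0,\infty)$ almost everywhere. When $p=1$ (so $p'=\infty$), the expression $\left(\int_{\mathbb{T}}|M(x,y)|^{-p'}\,dy\right)^{1/p'}$ is read as the essential supremum over $y$ of $|M(x,y)|^{-1}$, and similarly for the integral in $x$. *)

theory Defs
  imports "HOL-Analysis.Analysis" "HOL-Probability.Essential_Supremum"
begin

text \<open>
  The circle \<open>\<real>/2\<pi>\<int>\<close> and its square are realised as measure spaces on the fundamental
  domains \<open>[0, 2\<pi>)\<close> and \<open>[0, 2\<pi>)\<^sup>2\<close>, with (unnormalised, complete) Lebesgue measure.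
\<close>

definition circle :: "real measure"
  where "circle = lebesgue_on {0..<2*pi}"

definition torus :: "(real \<times> real) measure"
  where "torus = lebesgue_on ({0..<2*pi} \<times> {0..<2*pi})"

text \<open>
  Elements of \<open>L\<^sup>p\<close> are represented by functions, not by classes modulo almost-everywhere equality;
  \<^term>\<open>Lp_norm\<close> below is thus a seminorm, and the closed span is closed under a.e. equality.
\<close>

definition Lp_space :: "'a measure \<Rightarrow> real \<Rightarrow> ('a \<Rightarrow> complex) set"
  where "Lp_space \<mu> p = {f \<in> borel_measurable \<mu>. integrable \<mu> (\<lambda>z. cmod (f z) powr p)}"

definition Lp_norm :: "'a measure \<Rightarrow> real \<Rightarrow> ('a \<Rightarrow> complex) \<Rightarrow> real"
  where "Lp_norm \<mu> p f = (\<integral>z. cmod (f z) powr p \<partial>\<mu>) powr (1 / p)"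

definition closed_span ::
    "'a measure \<Rightarrow> real \<Rightarrow> ('i \<Rightarrow> 'a \<Rightarrow> complex) \<Rightarrow> 'i set \<Rightarrow> ('a \<Rightarrow> complex) set"
  where "closed_span \<mu> p \<phi> J = {f \<in> Lp_space \<mu> p. \<forall>\<epsilon>>0. \<exists>F c. finite F \<and> F \<subseteq> J \<and>
           Lp_norm \<mu> p (\<lambda>z. f z - (\<Sum>j\<in>F. c j * \<phi> j z)) < \<epsilon>}"

definition complete_in_Lp ::
    "'a measure \<Rightarrow> real \<Rightarrow> ('i \<Rightarrow> 'a \<Rightarrow> complex) \<Rightarrow> 'i set \<Rightarrow> bool"
  where "complete_in_Lp \<mu> p \<phi> I \<longleftrightarrow>
           (\<forall>i\<in>I. \<phi> i \<in> Lp_space \<mu> p) \<and> closed_span \<mu> p \<phi> I = Lp_space \<mu> p"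

definition minimal_in_Lp ::
    "'a measure \<Rightarrow> real \<Rightarrow> ('i \<Rightarrow> 'a \<Rightarrow> complex) \<Rightarrow> 'i set \<Rightarrow> bool"
  where "minimal_in_Lp \<mu> p \<phi> I \<longleftrightarrow>
           (\<forall>i\<in>I. \<phi> i \<in> Lp_space \<mu> p) \<and> (\<forall>i\<in>I. \<phi> i \<notin> closed_span \<mu> p \<phi> (I - {i}))"

text \<open>Real powers on \<open>[0, \<infinity>]\<close>; only meant for exponents \<open>r > 0\<close>.\<close>

definition ennreal_powr :: "ennreal \<Rightarrow> real \<Rightarrow> ennreal"
  where "ennreal_powr a r = (if a = \<infinity> then \<infinity> else ennreal (enn2real a powr r))"

text \<open>
  \<open>(\<integral> |f|\<^sup>-\<^sup>q d\<mu>)\<^bsup>1/q\<^esup>\<close> for \<open>0 < q \<le> \<infinity>\<close>, with values in \<open>[0, \<infinity>]\<close>. Since inversion on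
  \<^typ>\<open>ennreal\<close> satisfies \<open>1/0 = \<infinity>\<close>, zeros of \<open>f\<close> contribute the value \<open>\<infinity>\<close> to the integrand.
\<close>

definition recip_norm :: "ennreal \<Rightarrow> 'a measure \<Rightarrow> ('a \<Rightarrow> complex) \<Rightarrow> ennreal"
  where "recip_norm q \<mu> f =
    (if q = \<infinity> then esssup \<mu> (\<lambda>z. 1 / ennreal (cmod (f z)))
     else ennreal_powr
            (\<integral>\<^sup>+ z. ennreal_powr (1 / ennreal (cmod (f z))) (enn2real q) \<partial>\<mu>) (1 / enn2real q))"

text \<open>
  The weight \<open>w\<close> below is \<open>[0, \<infinity>]\<close>-valued; \<^const>\<open>enn2real\<close> changes it only where it is \<open>\<infinity>\<close>,
  which for the weights of interest happens at most on a null set.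
\<close>

definition weighted_exp :: "(real \<Rightarrow> ennreal) \<Rightarrow> int \<Rightarrow> real \<Rightarrow> complex"
  where "weighted_exp w n t = complex_of_real (enn2real (w t)) * exp (\<i> * of_int n * of_real t)"

definition weighted_exp2 :: "(real \<times> real \<Rightarrow> complex) \<Rightarrow> int \<times> int \<Rightarrow> real \<times> real \<Rightarrow> complex"
  where "weighted_exp2 M = (\<lambda>(k, m) (x, y).
           M (x, y) * exp (\<i> * of_int k * of_real x) * exp (\<i> * of_int m * of_real y))"

end

theory Submission
  imports Defs
begin

text \<open>
  Write \<open>e\<^sub>i\<close> for the characters of the circle or of the torus, and consider, for a weight \<open>W\<close> in \<open>L\<^sup>p\<close>, the
  system of all \<open>W e\<^sub>i\<close> with \<open>i \<noteq> 0\<close>. A functional \<open>h \<mapsto> \<integral> h g\<close> on the bounded functions is called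
  bounded if it is dominated by a multiple of the \<open>L\<^sup>p\<close> norm of \<open>W h\<close>. The proof rests on three facts.

  \<^item> The system is complete and minimal if and only if the mean \<open>h \<mapsto> \<integral> h\<close> is unbounded while, for each
  \<open>i \<noteq> 0\<close>, some functional \<open>h \<mapsto> \<integral> h (e\<^sub>i - c)\<close> is bounded (\<open>complete_minimal_iff\<close>). If the mean is
  unbounded, there are functions of mean one and arbitrarily small weighted norm. Subtracting multiples
  of them removes the constant term of a trigonometric polynomial at no cost, so the system spans as
  much as all the \<open>W e\<^sub>i\<close> together, and these span a dense subspace unless \<open>W\<close> vanishes on a set of
  positive measure, which a bounded functional given by some \<open>e\<^sub>i - c\<close> excludes. Minimality says that the \<open>i\<close>-th Fourier coefficient is bounded on
  functions of mean zero; on general functions one has to subtract \<open>c\<close> times the mean, where \<open>c\<close> is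
  the limit of the \<open>i\<close>-th coefficients of functions of mean one whose weighted norms tend to zero. All
  of this is explicit, so neither the Hahn-Banach theorem nor the dual space of \<open>L\<^sup>p\<close> appears.

  \<^item> If \<open>g\<close> vanishes only on a null set, the functional given by \<open>g\<close> is bounded if and only if \<open>g / W\<close> has
  finite norm in \<open>L\<^sup>p\<^sup>'\<close>. One implication is an inequality of Hoelder type, the other inserts an extremal
  function (\<open>ext_norm_finite_imp_bounded_functional\<close>, \<open>bounded_functional_imp_ext_norm_finite\<close>).

  \<^item> If \<open>g\<close> depends on \<open>x\<close> only, then by Tonelli's theorem \<open>g / M\<close> has the same norm on the torus as \<open>g / u\<close>
  on the circle, because \<open>1 / u(x)\<close> is the norm of \<open>1 / M(x, \<cdot>)\<close> (\<open>weight_transfer\<close>); likewise for \<open>v\<close>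
  and functions of \<open>y\<close>. Hoelder's inequality also shows that \<open>u(x)\<close> is at most the norm of \<open>M(x, \<cdot>)\<close>, so
  \<open>u\<close> and \<open>v\<close> are weights in \<open>L\<^sup>p\<close>.

  For \<open>W = M\<close>, the conditions for the characters indexed by \<open>(n, 0)\<close> and \<open>(0, n)\<close> are therefore precisely
  the conditions for \<open>u\<close> and for \<open>v\<close>, and the conditions on the mean agree for all three weights. The
  remaining characters of the torus impose nothing new, because
  \<open>e\<^sub>k(x) e\<^sub>m(y) - a b = e\<^sub>m(y) (e\<^sub>k(x) - a) + a (e\<^sub>m(y) - b)\<close> and bounded functionals are stable under
  multiplication of \<open>g\<close> by a bounded function.
\<close>

section \<open>The \<open>L\<^sup>p\<close> seminorm and bounded multipliers\<close>

lemma Lp_norm_nonneg: "0 \<le> Lp_norm \<mu> p f"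
  by (simp add: Lp_norm_def)

lemma Lp_norm_powr:
  assumes "0 < p"
  shows "Lp_norm \<mu> p f powr p = (\<integral>z. cmod (f z) powr p \<partial>\<mu>)"
  using assms by (simp add: Lp_norm_def powr_powr integral_nonneg_AE)

lemma Lp_norm_cong_cmod:
  assumes "\<And>z. cmod (f z) = cmod (g z)"
  shows "Lp_norm \<mu> p f = Lp_norm \<mu> p g"
  using assms by (simp add: Lp_norm_def)

lemma Lp_norm_scale:
  assumes "0 < p"
  shows "Lp_norm \<mu> p (\<lambda>z. c * f z) = cmod c * Lp_norm \<mu> p f"
  using assms
  by (simp add: Lp_norm_def norm_mult powr_mult integral_nonneg_AE powr_powr)

lemma Lp_spaceD:
  assumes "f \<in> Lp_space \<mu> p"
  shows "f \<in> borel_measurable \<mu>" "integrable \<mu> (\<lambda>z. cmod (f z) powr p)"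
  using assms by (auto simp: Lp_space_def)

lemma powr_add_le:
  fixes a b p :: real
  assumes "0 \<le> a" "0 \<le> b" "0 < p"
  shows "(a + b) powr p \<le> 2 powr p * (a powr p + b powr p)"
proof -
  have "(a + b) powr p \<le> (2 * max a b) powr p"
    using assms by (intro powr_mono2) auto
  also have "\<dots> = 2 powr p * max a b powr p"
    using assms by (simp add: powr_mult)
  also have "\<dots> \<le> 2 powr p * (a powr p + b powr p)"
    by (intro mult_left_mono) (auto simp: max_def)
  finally show ?thesis .
qed

lemma powr_superadditive:
  fixes a b p :: real
  assumes "0 \<le> a" "0 \<le> b" "1 \<le> p"
  shows "a powr p + b powr p \<le> (a + b) powr p"
proof (cases "a + b = 0")
  case True
  then show ?thesis using assms by (auto simp: add_nonneg_eq_0_iff)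
next
  case False
  then have s: "0 < a + b" using assms by auto
  have *: "x powr p \<le> x * (a + b) powr (p - 1)" if "0 \<le> x" "x \<le> a + b" for x
  proof (cases "x = 0")
    case False
    then have "x powr p = x * x powr (p - 1)"
      using that by (simp add: powr_diff)
    also have "\<dots> \<le> x * (a + b) powr (p - 1)"
      using that assms by (intro mult_left_mono powr_mono2) auto
    finally show ?thesis .
  qed auto
  have "a powr p + b powr p \<le> (a + b) * (a + b) powr (p - 1)"
    using *[of a] *[of b] assms by (simp add: distrib_right)
  also have "\<dots> = (a + b) powr p"
    using s by (simp add: powr_diff)
  finally show ?thesis .
qed

lemma Lp_space_dominated:
  assumes "g \<in> Lp_space \<mu> p" "f \<in> borel_measurable \<mu>" "0 < p" "0 \<le> B"
    and "\<And>z. cmod (f z) \<le> B * cmod (g z)"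
  shows "f \<in> Lp_space \<mu> p"
proof -
  note [measurable] = assms(2)
  have "integrable \<mu> (\<lambda>z. cmod (f z) powr p)"
  proof (rule Bochner_Integration.integrable_bound)
    show "integrable \<mu> (\<lambda>z. B powr p * cmod (g z) powr p)"
      using Lp_spaceD[OF assms(1)] by simp
    show "AE z in \<mu>. norm (cmod (f z) powr p) \<le> norm (B powr p * cmod (g z) powr p)"
      using assms by (intro AE_I2) (auto simp flip: powr_mult intro!: powr_mono2)
  qed measurable
  then show ?thesis using assms(2) by (simp add: Lp_space_def)
qed

lemma Lp_space_scale:
  assumes "f \<in> Lp_space \<mu> p" "0 < p"
  shows "(\<lambda>z. c * f z) \<in> Lp_space \<mu> p"
  using assms Lp_spaceD(1)[OF assms(1)]
  by (intro Lp_space_dominated[OF assms(1), of _ "cmod c"]) (auto simp: norm_mult)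

lemma Lp_space_add:
  assumes "f \<in> Lp_space \<mu> p" "g \<in> Lp_space \<mu> p" "0 < p"
  shows "(\<lambda>z. f z + g z) \<in> Lp_space \<mu> p"
proof -
  note [measurable] = Lp_spaceD(1)[OF assms(1)] Lp_spaceD(1)[OF assms(2)]
  have "integrable \<mu> (\<lambda>z. cmod (f z + g z) powr p)"
  proof (rule Bochner_Integration.integrable_bound)
    show "integrable \<mu> (\<lambda>z. 2 powr p * (cmod (f z) powr p + cmod (g z) powr p))"
      using Lp_spaceD(2)[OF assms(1)] Lp_spaceD(2)[OF assms(2)] by auto
    have "cmod (f z + g z) powr p \<le> 2 powr p * (cmod (f z) powr p + cmod (g z) powr p)" for z
      by (rule order_trans[OF _ powr_add_le])
         (use assms norm_triangle_ineq in \<open>auto intro!: powr_mono2\<close>)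
    then show "AE z in \<mu>. norm (cmod (f z + g z) powr p)
        \<le> norm (2 powr p * (cmod (f z) powr p + cmod (g z) powr p))"
      by (intro AE_I2) simp
  qed measurable
  then show ?thesis by (simp add: Lp_space_def)
qed

lemma Lp_space_diff:
  assumes "f \<in> Lp_space \<mu> p" "g \<in> Lp_space \<mu> p" "0 < p"
  shows "(\<lambda>z. f z - g z) \<in> Lp_space \<mu> p"
  using Lp_space_add[OF assms(1) Lp_space_scale[OF assms(2,3), of "-1"] assms(3)] by simp

lemma Lp_norm_le:
  assumes "0 < p" "0 \<le> B" "(\<integral>z. cmod (f z) powr p \<partial>\<mu>) \<le> B powr p"
  shows "Lp_norm \<mu> p f \<le> B"
proof -
  have "Lp_norm \<mu> p f \<le> (B powr p) powr (1 / p)"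
    unfolding Lp_norm_def using assms by (intro powr_mono2) (auto intro: integral_nonneg_AE)
  then show ?thesis using assms by (simp add: powr_powr)
qed

lemma Lp_norm_mono:
  assumes "g \<in> Lp_space \<mu> p" "f \<in> borel_measurable \<mu>" "0 < p"
    and "\<And>z. cmod (f z) \<le> cmod (g z)"
  shows "Lp_norm \<mu> p f \<le> Lp_norm \<mu> p g"
proof (rule Lp_norm_le[OF assms(3) Lp_norm_nonneg])
  have "f \<in> Lp_space \<mu> p"
    using assms by (intro Lp_space_dominated[OF assms(1), of _ 1]) auto
  then show "(\<integral>z. cmod (f z) powr p \<partial>\<mu>) \<le> Lp_norm \<mu> p g powr p"
    unfolding Lp_norm_powr[OF assms(3)]
    using assms by (intro integral_mono powr_mono2 Lp_spaceD) auto
qed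

text \<open>
  The factor \<open>2\<close> costs nothing in the arguments below, which only compare sizes, and it reduces
  the triangle inequality to the pointwise bound \<open>(a + b)\<^sup>p \<le> (2 max a b)\<^sup>p\<close>.
\<close>

lemma Lp_norm_quasi_triangle:
  assumes "f \<in> Lp_space \<mu> p" "g \<in> Lp_space \<mu> p" "1 \<le> p"
  shows "Lp_norm \<mu> p (\<lambda>z. f z + g z) \<le> 2 * (Lp_norm \<mu> p f + Lp_norm \<mu> p g)"
proof (rule Lp_norm_le)
  show "0 < p" using assms by simp
  note f = Lp_spaceD[OF assms(1)] and g = Lp_spaceD[OF assms(2)]
  have "(\<integral>z. cmod (f z + g z) powr p \<partial>\<mu>)
      \<le> (\<integral>z. 2 powr p * (cmod (f z) powr p + cmod (g z) powr p) \<partial>\<mu>)"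
  proof (rule integral_mono)
    show "integrable \<mu> (\<lambda>z. cmod (f z + g z) powr p)"
      using Lp_space_add[OF assms(1,2)] \<open>0 < p\<close> by (simp add: Lp_spaceD)
    show "cmod (f z + g z) powr p \<le> 2 powr p * (cmod (f z) powr p + cmod (g z) powr p)" for z
      by (rule order_trans[OF _ powr_add_le])
         (use \<open>0 < p\<close> norm_triangle_ineq in \<open>auto intro!: powr_mono2\<close>)
  qed (use f g in auto)
  also have "\<dots> = 2 powr p * (Lp_norm \<mu> p f powr p + Lp_norm \<mu> p g powr p)"
    using f g \<open>0 < p\<close> by (simp add: Lp_norm_powr)
  also have "\<dots> \<le> 2 powr p * (Lp_norm \<mu> p f + Lp_norm \<mu> p g) powr p"
    using assms by (intro mult_left_mono powr_superadditive) (auto simp: Lp_norm_nonneg)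
  also have "\<dots> = (2 * (Lp_norm \<mu> p f + Lp_norm \<mu> p g)) powr p"
    by (subst powr_mult) (auto simp: Lp_norm_nonneg)
  finally show "(\<integral>z. cmod (f z + g z) powr p \<partial>\<mu>) \<le> \<dots>" .
qed (simp add: Lp_norm_nonneg)

lemma Lp_norm_quasi_triangle_diff:
  assumes "f \<in> Lp_space \<mu> p" "g \<in> Lp_space \<mu> p" "1 \<le> p"
  shows "Lp_norm \<mu> p (\<lambda>z. f z - g z) \<le> 2 * (Lp_norm \<mu> p f + Lp_norm \<mu> p g)"
proof -
  have p: "0 < p" using assms by simp
  show ?thesis
    using Lp_norm_quasi_triangle[OF assms(1) Lp_space_scale[OF assms(2) p, of "-1"] assms(3)]
    by (simp add: Lp_norm_cong_cmod[of "\<lambda>z. - g z" g])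
qed

lemma Lp_norm_tendsto:
  assumes "0 < p" "integrable \<mu> (\<lambda>z. w z powr p)"
    and "\<And>n. f n \<in> borel_measurable \<mu>" "g \<in> borel_measurable \<mu>"
    and "\<And>n z. cmod (f n z) \<le> w z"
    and "AE z in \<mu>. (\<lambda>n. f n z) \<longlonglongrightarrow> g z"
  shows "(\<lambda>n. Lp_norm \<mu> p (f n)) \<longlonglongrightarrow> Lp_norm \<mu> p g"
proof -
  note [measurable] = assms(3,4)
  have w: "0 \<le> w z" for z using assms(5)[of undefined z] norm_ge_zero order_trans by blast
  have "(\<lambda>n. \<integral>z. cmod (f n z) powr p \<partial>\<mu>) \<longlonglongrightarrow> (\<integral>z. cmod (g z) powr p \<partial>\<mu>)"
  proof (rule integral_dominated_convergence[where w="\<lambda>z. w z powr p"])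
    show "AE z in \<mu>. (\<lambda>n. cmod (f n z) powr p) \<longlonglongrightarrow> cmod (g z) powr p"
      using assms(6)
    proof eventually_elim
      case (elim z)
      then show ?case
        using assms(1) by (intro tendsto_powr' tendsto_norm tendsto_const) auto
    qed
    show "AE z in \<mu>. norm (cmod (f n z) powr p) \<le> w z powr p" for n
      using assms by (auto intro!: powr_mono2)
  qed (use assms in auto)
  then show ?thesis
    unfolding Lp_norm_def using assms(1) by (intro tendsto_powr' tendsto_const) (auto intro: integral_nonneg_AE)
qed

text \<open>
  The bound holds at every point, not just almost everywhere, so that it can be combined with
  pointwise estimates without exceptional sets.
\<close>

definition bdd_meas :: "'a measure \<Rightarrow> ('a \<Rightarrow> complex) \<Rightarrow> bool"
  where "bdd_meas \<mu> h \<longleftrightarrow> h \<in> borel_measurable \<mu> \<and> (\<exists>B. \<forall>z. cmod (h z) \<le> B)"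

lemma bdd_measI: "h \<in> borel_measurable \<mu> \<Longrightarrow> (\<And>z. cmod (h z) \<le> B) \<Longrightarrow> bdd_meas \<mu> h"
  by (auto simp: bdd_meas_def)

lemma bdd_meas_measurable: "bdd_meas \<mu> h \<Longrightarrow> h \<in> borel_measurable \<mu>"
  by (simp add: bdd_meas_def)

lemma bdd_measE:
  assumes "bdd_meas \<mu> h"
  obtains B where "0 \<le> B" "\<And>z. cmod (h z) \<le> B"
proof -
  obtain B where B: "\<And>z. cmod (h z) \<le> B" using assms by (auto simp: bdd_meas_def)
  moreover have "0 \<le> B" using B[of undefined] norm_ge_zero order_trans by blast
  ultimately show thesis using that by blast
qed

lemma bdd_meas_const: "bdd_meas \<mu> (\<lambda>z. c)"
  by (auto simp: bdd_meas_def)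

lemma bdd_meas_mult:
  assumes "bdd_meas \<mu> f" "bdd_meas \<mu> g"
  shows "bdd_meas \<mu> (\<lambda>z. f z * g z)"
proof -
  obtain B where "0 \<le> B" "\<And>z. cmod (f z) \<le> B" using bdd_measE[OF assms(1)] by blast
  moreover obtain C where "0 \<le> C" "\<And>z. cmod (g z) \<le> C" using bdd_measE[OF assms(2)] by blast
  ultimately show ?thesis
    using assms by (intro bdd_measI[of _ _ "B * C"]) (auto simp: bdd_meas_def norm_mult intro!: mult_mono)
qed

lemma bdd_meas_add:
  assumes "bdd_meas \<mu> f" "bdd_meas \<mu> g"
  shows "bdd_meas \<mu> (\<lambda>z. f z + g z)"
proof -
  obtain B where "0 \<le> B" "\<And>z. cmod (f z) \<le> B" using bdd_measE[OF assms(1)] by blast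
  moreover obtain C where "0 \<le> C" "\<And>z. cmod (g z) \<le> C" using bdd_measE[OF assms(2)] by blast
  ultimately show ?thesis
    using assms by (intro bdd_measI[of _ _ "B + C"]) (auto simp: bdd_meas_def intro!: order_trans[OF norm_triangle_ineq] add_mono)
qed

lemma bdd_meas_diff:
  assumes "bdd_meas \<mu> f" "bdd_meas \<mu> g"
  shows "bdd_meas \<mu> (\<lambda>z. f z - g z)"
  using bdd_meas_add[OF assms(1) bdd_meas_mult[OF bdd_meas_const[of _ "-1"] assms(2)]] by simp

lemma bdd_meas_sum:
  "finite F \<Longrightarrow> (\<And>i. i \<in> F \<Longrightarrow> bdd_meas \<mu> (f i)) \<Longrightarrow> bdd_meas \<mu> (\<lambda>z. \<Sum>i\<in>F. f i z)"
  by (induction F rule: finite_induct) (auto intro: bdd_meas_add bdd_meas_const)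

lemma Lp_space_mult_bdd:
  assumes "W \<in> Lp_space \<mu> p" "bdd_meas \<mu> h" "0 < p"
  shows "(\<lambda>z. W z * h z) \<in> Lp_space \<mu> p"
proof -
  obtain B where "0 \<le> B" "\<And>z. cmod (h z) \<le> B" using bdd_measE[OF assms(2)] by blast
  then show ?thesis
    using assms Lp_spaceD(1)[OF assms(1)] by (intro Lp_space_dominated[OF assms(1), of _ B])
      (auto simp: norm_mult bdd_meas_def mult.commute[of B] intro!: mult_left_mono)
qed

lemma (in finite_measure) bdd_meas_integrable: "bdd_meas M h \<Longrightarrow> integrable M h"
  by (auto simp: bdd_meas_def intro: integrable_const_bound)

lemma Lp_norm_tendsto_mult:
  assumes "W \<in> Lp_space \<mu> p" "0 < p" "\<And>n. h n \<in> borel_measurable \<mu>" "g \<in> borel_measurable \<mu>"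
    and "\<And>n z. cmod (h n z) \<le> B" "AE z in \<mu>. (\<lambda>n. h n z) \<longlonglongrightarrow> g z"
  shows "(\<lambda>n. Lp_norm \<mu> p (\<lambda>z. W z * h n z)) \<longlonglongrightarrow> Lp_norm \<mu> p (\<lambda>z. W z * g z)"
proof (rule Lp_norm_tendsto[where w="\<lambda>z. B * cmod (W z)"])
  have "0 \<le> B" using assms(5)[of undefined undefined] norm_ge_zero order_trans by blast
  then show "integrable \<mu> (\<lambda>z. (B * cmod (W z)) powr p)"
    using Lp_spaceD[OF assms(1)] by (simp add: powr_mult)
  show "AE z in \<mu>. (\<lambda>n. W z * h n z) \<longlonglongrightarrow> W z * g z"
    using assms(6) by eventually_elim (intro tendsto_intros)
qed (use assms Lp_spaceD(1)[OF assms(1)] in \<open>auto simp: norm_mult mult.commute[of B] intro!: mult_left_mono\<close>)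

section \<open>Functionals bounded in a weighted norm\<close>

text \<open>
  The functional \<open>h \<mapsto> \<integral> h g\<close> on the bounded functions, measured in the norm of \<open>W h\<close>. Where \<open>W\<close>
  has no zeros it reads \<open>f \<mapsto> \<integral> f (g / W)\<close> in terms of \<open>f = W h\<close>; boundedness thus encodes that
  \<open>g / W\<close> belongs to the dual space, without any reference to that space.
\<close>

definition bounded_functional ::
    "'a measure \<Rightarrow> real \<Rightarrow> ('a \<Rightarrow> complex) \<Rightarrow> ('a \<Rightarrow> complex) \<Rightarrow> bool"
  where "bounded_functional \<mu> p W g \<longleftrightarrow> (\<exists>C\<ge>0. \<forall>h. bdd_meas \<mu> h \<longrightarrow>
           cmod (\<integral>z. h z * g z \<partial>\<mu>) \<le> C * Lp_norm \<mu> p (\<lambda>z. W z * h z))"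

lemma bounded_functional_mult:
  assumes "bounded_functional \<mu> p W g" "W \<in> Lp_space \<mu> p" "bdd_meas \<mu> \<phi>" "0 < p"
  shows "bounded_functional \<mu> p W (\<lambda>z. \<phi> z * g z)"
proof -
  obtain C where C: "0 \<le> C" "\<And>h. bdd_meas \<mu> h \<Longrightarrow>
      cmod (\<integral>z. h z * g z \<partial>\<mu>) \<le> C * Lp_norm \<mu> p (\<lambda>z. W z * h z)"
    using assms(1) by (auto simp: bounded_functional_def)
  obtain B where B: "0 \<le> B" "\<And>z. cmod (\<phi> z) \<le> B"
    using bdd_measE[OF assms(3)] by blast
  have "cmod (\<integral>z. h z * (\<phi> z * g z) \<partial>\<mu>) \<le> (C * B) * Lp_norm \<mu> p (\<lambda>z. W z * h z)"
    if h: "bdd_meas \<mu> h" for h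
  proof -
    have "cmod (\<integral>z. (h z * \<phi> z) * g z \<partial>\<mu>) \<le> C * Lp_norm \<mu> p (\<lambda>z. W z * (h z * \<phi> z))"
      by (rule C(2)[OF bdd_meas_mult[OF h assms(3)]])
    also have "Lp_norm \<mu> p (\<lambda>z. W z * (h z * \<phi> z)) \<le> Lp_norm \<mu> p (\<lambda>z. B * (W z * h z))"
    proof (rule Lp_norm_mono)
      show "(\<lambda>z. B * (W z * h z)) \<in> Lp_space \<mu> p"
        using assms h by (intro Lp_space_scale Lp_space_mult_bdd)
      show "(\<lambda>z. W z * (h z * \<phi> z)) \<in> borel_measurable \<mu>"
        using assms h by (intro Lp_spaceD Lp_space_mult_bdd bdd_meas_mult)
      show "cmod (W z * (h z * \<phi> z)) \<le> cmod (B * (W z * h z))" for z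
        using B(1) mult_right_mono[OF B(2)[of z], of "cmod (W z) * cmod (h z)"]
        by (simp add: norm_mult mult_ac)
    qed fact
    also have "Lp_norm \<mu> p (\<lambda>z. B * (W z * h z)) = B * Lp_norm \<mu> p (\<lambda>z. W z * h z)"
      by (subst Lp_norm_scale[OF assms(4)]) (use B in simp)
    finally show ?thesis using C(1) by (simp add: mult_left_mono mult.assoc)
  qed
  then show ?thesis unfolding bounded_functional_def using C B by (intro exI[of _ "C * B"]) auto
qed

lemma (in finite_measure) bounded_functional_add:
  assumes "bounded_functional M p W f" "bounded_functional M p W g"
    and "bdd_meas M f" "bdd_meas M g"
  shows "bounded_functional M p W (\<lambda>z. f z + g z)"
proof -
  obtain C where C: "0 \<le> C" "\<And>h. bdd_meas M h \<Longrightarrow>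
      cmod (\<integral>z. h z * f z \<partial>M) \<le> C * Lp_norm M p (\<lambda>z. W z * h z)"
    using assms(1) by (auto simp: bounded_functional_def)
  obtain D where D: "0 \<le> D" "\<And>h. bdd_meas M h \<Longrightarrow>
      cmod (\<integral>z. h z * g z \<partial>M) \<le> D * Lp_norm M p (\<lambda>z. W z * h z)"
    using assms(2) by (auto simp: bounded_functional_def)
  have "cmod (\<integral>z. h z * (f z + g z) \<partial>M) \<le> (C + D) * Lp_norm M p (\<lambda>z. W z * h z)"
    if h: "bdd_meas M h" for h
  proof -
    have "(\<integral>z. h z * (f z + g z) \<partial>M) = (\<integral>z. h z * f z \<partial>M) + (\<integral>z. h z * g z \<partial>M)"
      using h assms by (simp add: distrib_left bdd_meas_integrable bdd_meas_mult)
    then show ?thesis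
      using C(2)[OF h] D(2)[OF h] norm_triangle_ineq[of "\<integral>z. h z * f z \<partial>M" "\<integral>z. h z * g z \<partial>M"]
      by (simp add: distrib_right)
  qed
  then show ?thesis unfolding bounded_functional_def using C D by (intro exI[of _ "C + D"]) auto
qed

text \<open>
  On the zero set of \<open>W\<close> the functional can be tested with \<open>h = cnj g\<close>: the norm of \<open>W h\<close> vanishes,
  while the functional returns the integral of \<open>|g|\<^sup>2\<close> over that set.
\<close>

lemma (in finite_measure) bounded_functional_imp_nonzero:
  assumes "bounded_functional M p W g" "bdd_meas M g" "AE z in M. g z \<noteq> 0" "W \<in> Lp_space M p"
  shows "AE z in M. W z \<noteq> 0"
proof -
  note [measurable] = bdd_meas_measurable[OF assms(2)] Lp_spaceD(1)[OF assms(4)]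
  obtain C where C: "\<And>h. bdd_meas M h \<Longrightarrow>
      cmod (\<integral>z. h z * g z \<partial>M) \<le> C * Lp_norm M p (\<lambda>z. W z * h z)"
    using assms(1) by (auto simp: bounded_functional_def)
  define h where "h z = (if W z = 0 then cnj (g z) else 0)" for z
  obtain B where B: "0 \<le> B" "\<And>z. cmod (g z) \<le> B" using bdd_measE[OF assms(2)] by blast
  have [measurable]: "{z \<in> space M. W z = 0} \<in> sets M" "(\<lambda>z. cnj (g z)) \<in> borel_measurable M"
    by (auto intro!: borel_measurable_eq measurable_compose[OF bdd_meas_measurable[OF assms(2)]]
        borel_measurable_continuous_onI continuous_intros)
  have [measurable]: "h \<in> borel_measurable M" unfolding h_def by measurable
  have h: "bdd_meas M h" by (rule bdd_measI[of _ _ B]) (use B in \<open>auto simp: h_def\<close>)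
  have "Lp_norm M p (\<lambda>z. W z * h z) = 0"
  proof -
    have "(\<lambda>z. W z * h z) = (\<lambda>z. 0)" by (auto simp: h_def)
    then show ?thesis by (simp add: Lp_norm_def)
  qed
  then have "(\<integral>z. h z * g z \<partial>M) = 0" using C[OF h] by simp
  moreover have "h z * g z = complex_of_real (if W z = 0 then (cmod (g z))\<^sup>2 else 0)" for z
    by (simp add: h_def complex_norm_square mult.commute del: of_real_power)
  ultimately have "(\<integral>z. (if W z = 0 then (cmod (g z))\<^sup>2 else 0) \<partial>M) = 0"
    by (simp del: of_real_power add: integral_complex_of_real)
  then have "AE z in M. (if W z = 0 then (cmod (g z))\<^sup>2 else 0) = 0"
  proof (subst (asm) integral_nonneg_eq_0_iff_AE)
    show "integrable M (\<lambda>z. if W z = 0 then (cmod (g z))\<^sup>2 else 0)"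
      using B by (intro integrable_const_bound[of _ "B\<^sup>2"] AE_I2) (auto intro!: power_mono)
  qed auto
  then show ?thesis using assms(3) by eventually_elim (auto split: if_splits)
qed

section \<open>Systems of characters\<close>

definition trig_poly :: "('i \<Rightarrow> 'a \<Rightarrow> complex) \<Rightarrow> 'i set \<Rightarrow> ('a \<Rightarrow> complex) \<Rightarrow> bool"
  where "trig_poly e J T \<longleftrightarrow> (\<exists>F c. finite F \<and> F \<subseteq> J \<and> T = (\<lambda>z. \<Sum>j\<in>F. c j * e j z))"

lemma trig_poly_basis: "i \<in> J \<Longrightarrow> trig_poly e J (\<lambda>z. c * e i z)"
  unfolding trig_poly_def by (intro exI[of _ "{i}"] exI[of _ "\<lambda>_. c"]) auto

lemma trig_poly_add:
  assumes "trig_poly e J S" "trig_poly e J T"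
  shows "trig_poly e J (\<lambda>z. S z + T z)"
proof -
  obtain F c where F: "finite F" "F \<subseteq> J" "S = (\<lambda>z. \<Sum>j\<in>F. c j * e j z)"
    using assms(1) by (auto simp: trig_poly_def)
  obtain G d where G: "finite G" "G \<subseteq> J" "T = (\<lambda>z. \<Sum>j\<in>G. d j * e j z)"
    using assms(2) by (auto simp: trig_poly_def)
  let ?c = "\<lambda>j. if j \<in> F then c j else 0" and ?d = "\<lambda>j. if j \<in> G then d j else 0"
  have "S z = (\<Sum>j\<in>F \<union> G. ?c j * e j z)" "T z = (\<Sum>j\<in>F \<union> G. ?d j * e j z)" for z
    unfolding F(3) G(3) using F(1) G(1) by (auto intro!: sum.mono_neutral_cong_left)
  then have "(\<lambda>z. S z + T z) = (\<lambda>z. \<Sum>j\<in>F \<union> G. (?c j + ?d j) * e j z)"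
    by (simp only: sum.distrib distrib_right)
  then show ?thesis unfolding trig_poly_def using F G
    by (intro exI[of _ "F \<union> G"] exI[of _ "\<lambda>j. ?c j + ?d j"]) auto
qed

lemma trig_poly_sum:
  assumes "finite F" "\<And>i. i \<in> F \<Longrightarrow> trig_poly e J (T i)"
  shows "trig_poly e J (\<lambda>z. \<Sum>i\<in>F. T i z)"
  using assms
proof (induction F rule: finite_induct)
  case empty
  then show ?case unfolding trig_poly_def by (intro exI[of _ "{}"]) auto
next
  case (insert x F)
  then show ?case by (simp add: trig_poly_add)
qed

lemma trig_poly_scale:
  assumes "trig_poly e J T"
  shows "trig_poly e J (\<lambda>z. a * T z)"
proof -
  obtain F c where "finite F" "F \<subseteq> J" "T = (\<lambda>z. \<Sum>j\<in>F. c j * e j z)"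
    using assms by (auto simp: trig_poly_def)
  then show ?thesis unfolding trig_poly_def
    by (intro exI[of _ F] exI[of _ "\<lambda>j. a * c j"]) (auto simp: sum_distrib_left mult.assoc)
qed

lemma trig_poly_mono: "trig_poly e J T \<Longrightarrow> J \<subseteq> K \<Longrightarrow> trig_poly e K T"
  unfolding trig_poly_def by blast

lemma closed_span_weighted:
  "closed_span \<mu> p (\<lambda>i z. W z * e i z) J = {f \<in> Lp_space \<mu> p. \<forall>\<epsilon>>0. \<exists>T. trig_poly e J T \<and>
     Lp_norm \<mu> p (\<lambda>z. f z - W z * T z) < \<epsilon>}"
proof -
  have "(\<Sum>j\<in>F. c j * (W z * e j z)) = W z * (\<Sum>j\<in>F. c j * e j z)" for F c z
    by (simp add: sum_distrib_left mult_ac)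
  then have "(\<exists>F c. finite F \<and> F \<subseteq> J \<and> Lp_norm \<mu> p (\<lambda>z. f z - (\<Sum>j\<in>F. c j * (W z * e j z))) < \<epsilon>) \<longleftrightarrow>
      (\<exists>T. trig_poly e J T \<and> Lp_norm \<mu> p (\<lambda>z. f z - W z * T z) < \<epsilon>)" for f and \<epsilon> :: real
    unfolding trig_poly_def by auto
  then show ?thesis unfolding closed_span_def by simp
qed

text \<open>
  The features common to the circle and the torus. Density of the trigonometric polynomials is
  required in the form of bounded pointwise approximation: this implies, by dominated convergence,
  approximation in \<open>L\<^sup>p\<close> with any weight from \<open>L\<^sup>p\<close>, and convergence of the Fourier coefficients.
  The last axiom makes the functions \<open>e\<^sub>i - c\<close> nonzero almost everywhere for some \<open>i\<close>. A bounded
  functional given by such a function forces the weight to be nonzero almost everywhere.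
\<close>

locale character_system = finite_measure \<mu>
  for \<mu> :: "'a measure" +
  fixes e :: "'i::ab_group_add \<Rightarrow> 'a \<Rightarrow> complex"
  assumes space_pos: "0 < measure \<mu> (space \<mu>)"
    and e_measurable [measurable]: "e i \<in> borel_measurable \<mu>"
    and cmod_e [simp]: "cmod (e i z) = 1"
    and e_add: "e (i + j) z = e i z * e j z"
    and integral_e: "i \<noteq> 0 \<Longrightarrow> (\<integral>z. e i z \<partial>\<mu>) = 0"
    and bounded_approx: "bdd_meas \<mu> h \<Longrightarrow> \<exists>T B. (\<forall>n. trig_poly e UNIV (T n)) \<and>
      (\<forall>n z. cmod (T n z) \<le> B) \<and> (AE z in \<mu>. (\<lambda>n. T n z) \<longlonglongrightarrow> h z)"
    and nonconstant: "\<exists>i. i \<noteq> 0 \<and> (\<forall>c. AE z in \<mu>. e i z \<noteq> c)"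
begin

lemma e_zero [simp]: "e 0 z = 1"
proof -
  have "e 0 z * e 0 z = e 0 z" using e_add[of 0 0 z] by simp
  moreover have "e 0 z \<noteq> 0" using cmod_e[of 0 z] by force
  ultimately show ?thesis by simp
qed

lemma bdd_meas_e: "bdd_meas \<mu> (e i)"
  by (rule bdd_measI[of _ _ 1]) auto

lemma bdd_meas_trig: "trig_poly e J T \<Longrightarrow> bdd_meas \<mu> T"
  unfolding trig_poly_def
  by (auto intro!: bdd_meas_sum bdd_meas_mult bdd_meas_const bdd_meas_e)

definition coef :: "'i \<Rightarrow> ('a \<Rightarrow> complex) \<Rightarrow> complex"
  where "coef i h = (\<integral>z. h z * e (- i) z \<partial>\<mu>) / measure \<mu> (space \<mu>)"

lemma coef_add:
  "bdd_meas \<mu> f \<Longrightarrow> bdd_meas \<mu> g \<Longrightarrow> coef i (\<lambda>z. f z + g z) = coef i f + coef i g"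
  by (simp add: coef_def distrib_right bdd_meas_integrable bdd_meas_mult bdd_meas_e add_divide_distrib)

lemma coef_scale: "coef i (\<lambda>z. c * f z) = c * coef i f"
  by (simp add: coef_def mult.assoc)

lemma coef_diff:
  "bdd_meas \<mu> f \<Longrightarrow> bdd_meas \<mu> g \<Longrightarrow> coef i (\<lambda>z. f z - g z) = coef i f - coef i g"
  using coef_add[of f "\<lambda>z. -1 * g z" i] coef_scale[of i "-1" g]
  by (simp add: bdd_meas_mult[OF bdd_meas_const[of \<mu> "-1"], simplified])

lemma coef_sum:
  "finite F \<Longrightarrow> (\<And>j. j \<in> F \<Longrightarrow> bdd_meas \<mu> (f j)) \<Longrightarrow>
     coef i (\<lambda>z. \<Sum>j\<in>F. f j z) = (\<Sum>j\<in>F. coef i (f j))"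
proof (induction F rule: finite_induct)
  case empty
  then show ?case by (simp add: coef_def)
next
  case (insert x F)
  then show ?case by (simp add: coef_add bdd_meas_sum)
qed

lemma coef_e: "coef i (e j) = (if i = j then 1 else 0)"
  using integral_e[of "j - i"] space_pos
  by (auto simp: coef_def scaleR_conv_of_real simp flip: e_add)

lemma coef_trig_sum:
  "finite F \<Longrightarrow> coef i (\<lambda>z. \<Sum>j\<in>F. c j * e j z) = (if i \<in> F then c i else 0)"
  by (subst coef_sum)
     (auto simp: coef_scale coef_e bdd_meas_mult bdd_meas_const bdd_meas_e if_distrib sum.delta cong: if_cong)

lemma coef_trig_eq_0: "trig_poly e J T \<Longrightarrow> i \<notin> J \<Longrightarrow> coef i T = 0"
  by (auto simp: trig_poly_def coef_trig_sum)

lemma trig_poly_Diff: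
  assumes "trig_poly e UNIV T" "\<And>j. j \<in> J \<Longrightarrow> coef j T = 0"
  shows "trig_poly e (UNIV - J) T"
proof -
  obtain F c where F: "finite F" "T = (\<lambda>z. \<Sum>j\<in>F. c j * e j z)"
    using assms(1) by (auto simp: trig_poly_def)
  have "c j = 0" if "j \<in> F" "j \<in> J" for j
    using assms(2)[OF that(2)] that F by (simp add: coef_trig_sum)
  then have "T = (\<lambda>z. \<Sum>j\<in>F - J. c j * e j z)"
    unfolding F(2) using F(1) by (intro ext sum.mono_neutral_right) auto
  then show ?thesis unfolding trig_poly_def using F(1) by (intro exI[of _ "F - J"] exI[of _ c]) auto
qed

text \<open>
  The coefficients of the approximants converge to those of \<open>h\<close>. Finitely many of them can therefore
  be corrected by adding a small combination of the corresponding characters.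
\<close>

lemma approx_same_coefs:
  assumes h: "bdd_meas \<mu> h" and J: "finite J"
  obtains T B where "\<And>n. trig_poly e UNIV (T n)" "\<And>n z. cmod (T n z) \<le> B"
    "AE z in \<mu>. (\<lambda>n. T n z) \<longlonglongrightarrow> h z" "\<And>n j. j \<in> J \<Longrightarrow> coef j (T n) = coef j h"
proof -
  obtain T B where T: "\<And>n. trig_poly e UNIV (T n)" "\<And>n z. cmod (T n z) \<le> B"
      "AE z in \<mu>. (\<lambda>n. T n z) \<longlonglongrightarrow> h z"
    using bounded_approx[OF h] by blast
  define d where "d n j = coef j h - coef j (T n)" for n j
  have [measurable]: "T n \<in> borel_measurable \<mu>" "h \<in> borel_measurable \<mu>" for n
    using bdd_meas_trig[OF T(1)] h by (auto simp: bdd_meas_def)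
  have "(\<lambda>n. coef j (T n)) \<longlonglongrightarrow> coef j h" for j
    unfolding coef_def
  proof (intro tendsto_divide tendsto_const integral_dominated_convergence[where w="\<lambda>_. B"])
    show "AE z in \<mu>. (\<lambda>n. T n z * e (- j) z) \<longlonglongrightarrow> h z * e (- j) z"
      using T(3) by eventually_elim (intro tendsto_intros)
  qed (use T(2) space_pos in \<open>auto simp: norm_mult\<close>)
  then have d: "(\<lambda>n. d n j) \<longlonglongrightarrow> 0" for j
    unfolding d_def using tendsto_diff[OF tendsto_const, of _ "coef j h" sequentially "coef j h"] by simp
  have "\<exists>D. \<forall>n. cmod (d n j) \<le> D" for j
    using convergent_imp_Bseq[of "\<lambda>n. d n j"] d[of j] unfolding convergent_def Bseq_def by blast
  then obtain D where D: "\<And>j n. cmod (d n j) \<le> D j" by metis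
  define S where "S n z = T n z + (\<Sum>j\<in>J. d n j * e j z)" for n z
  have S: "trig_poly e UNIV (S n)" for n
    unfolding S_def [abs_def] by (intro trig_poly_add T trig_poly_sum J trig_poly_basis) auto
  show thesis
  proof (rule that)
    show "cmod (S n z) \<le> B + (\<Sum>j\<in>J. D j)" for n z
      unfolding S_def using D
      by (intro order_trans[OF norm_triangle_ineq] add_mono T sum_norm_le) (auto simp: norm_mult)
    show "AE z in \<mu>. (\<lambda>n. S n z) \<longlonglongrightarrow> h z"
      using T(3)
    proof eventually_elim
      case (elim z)
      have "(\<lambda>n. S n z) \<longlonglongrightarrow> h z + (\<Sum>j\<in>J. 0 * e j z)"
        unfolding S_def by (intro tendsto_intros elim d)
      then show ?case by simp
    qed
    show "coef j (S n) = coef j h" if "j \<in> J" for n j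
      unfolding S_def using that J
      by (subst coef_add) (auto simp: coef_trig_sum d_def
          intro!: bdd_meas_trig[OF T(1)] bdd_meas_sum bdd_meas_mult bdd_meas_const bdd_meas_e)
  qed (rule S)
qed

lemma approx_weighted:
  assumes W: "W \<in> Lp_space \<mu> p" and p: "0 < p" and h: "bdd_meas \<mu> h" and J: "finite J"
    and \<epsilon>: "0 < \<epsilon>"
  obtains T where "trig_poly e UNIV T" "\<And>j. j \<in> J \<Longrightarrow> coef j T = coef j h"
    "Lp_norm \<mu> p (\<lambda>z. W z * (h z - T z)) < \<epsilon>"
    "\<bar>Lp_norm \<mu> p (\<lambda>z. W z * T z) - Lp_norm \<mu> p (\<lambda>z. W z * h z)\<bar> < \<epsilon>"
proof -
  obtain T B where T: "\<And>n. trig_poly e UNIV (T n)" "\<And>n z. cmod (T n z) \<le> B"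
      "AE z in \<mu>. (\<lambda>n. T n z) \<longlonglongrightarrow> h z" "\<And>n j. j \<in> J \<Longrightarrow> coef j (T n) = coef j h"
    using approx_same_coefs[OF h J] by blast
  obtain A where A: "\<And>z. cmod (h z) \<le> A" using bdd_measE[OF h] by blast
  have [measurable]: "T n \<in> borel_measurable \<mu>" "h \<in> borel_measurable \<mu>" for n
    using bdd_meas_trig[OF T(1)] h by (auto simp: bdd_meas_def)
  have "(\<lambda>n. Lp_norm \<mu> p (\<lambda>z. W z * (h z - T n z))) \<longlonglongrightarrow> Lp_norm \<mu> p (\<lambda>z. W z * 0)"
  proof (rule Lp_norm_tendsto_mult[OF W p])
    show "cmod (h z - T n z) \<le> A + B" for n z
      by (rule order_trans[OF norm_triangle_ineq4 add_mono[OF A T(2)]])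
    show "AE z in \<mu>. (\<lambda>n. h z - T n z) \<longlonglongrightarrow> 0"
      using T(3) by eventually_elim (rule tendsto_eq_intros | simp)+
  qed measurable
  then have "(\<lambda>n. Lp_norm \<mu> p (\<lambda>z. W z * (h z - T n z))) \<longlonglongrightarrow> 0"
    by (simp add: Lp_norm_def)
  then have 1: "\<forall>\<^sub>F n in sequentially. Lp_norm \<mu> p (\<lambda>z. W z * (h z - T n z)) < \<epsilon>"
    using \<epsilon> by (auto dest!: order_tendstoD(2))
  have "(\<lambda>n. Lp_norm \<mu> p (\<lambda>z. W z * T n z)) \<longlonglongrightarrow> Lp_norm \<mu> p (\<lambda>z. W z * h z)"
    by (rule Lp_norm_tendsto_mult[OF W p _ _ T(2,3)]) measurable
  then have 2: "\<forall>\<^sub>F n in sequentially.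
      \<bar>Lp_norm \<mu> p (\<lambda>z. W z * T n z) - Lp_norm \<mu> p (\<lambda>z. W z * h z)\<bar> < \<epsilon>"
    using \<epsilon> unfolding tendsto_iff dist_real_def by blast
  obtain n where "Lp_norm \<mu> p (\<lambda>z. W z * (h z - T n z)) < \<epsilon>"
      "\<bar>Lp_norm \<mu> p (\<lambda>z. W z * T n z) - Lp_norm \<mu> p (\<lambda>z. W z * h z)\<bar> < \<epsilon>"
    using eventually_happens'[OF sequentially_bot eventually_conj[OF 1 2]] by blast
  then show thesis
    by (intro that[of "T n"] T(1) T(4))
qed

section \<open>Completeness and minimality of a weighted system\<close>

lemma integral_eq_coef_0: "(\<integral>z. h z \<partial>\<mu>) = measure \<mu> (space \<mu>) * coef 0 h"
  using space_pos by (simp add: coef_def)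

text \<open>
  Since the functional is homogeneous, unboundedness can be tested on functions of mean one.
\<close>

lemma unbounded_mean_iff:
  assumes W: "W \<in> Lp_space \<mu> p" and p: "1 \<le> p"
  shows "\<not> bounded_functional \<mu> p W (\<lambda>z. 1) \<longleftrightarrow>
    (\<forall>\<epsilon>>0. \<exists>h. bdd_meas \<mu> h \<and> coef 0 h = 1 \<and> Lp_norm \<mu> p (\<lambda>z. W z * h z) < \<epsilon>)"
proof safe
  fix \<epsilon> :: real assume nb: "\<not> bounded_functional \<mu> p W (\<lambda>z. 1)" and \<epsilon>: "0 < \<epsilon>"
  let ?m = "measure \<mu> (space \<mu>)"
  obtain h where h: "bdd_meas \<mu> h"
      and *: "?m / \<epsilon> * Lp_norm \<mu> p (\<lambda>z. W z * h z) < cmod (\<integral>z. h z \<partial>\<mu>)"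
    using nb divide_pos_pos[OF space_pos \<epsilon>]
    by (auto simp: bounded_functional_def not_le dest!: spec[of _ "?m / \<epsilon>"])
  define s where "s = coef 0 h"
  have "cmod (\<integral>z. h z \<partial>\<mu>) = ?m * cmod s"
    using space_pos by (simp add: integral_eq_coef_0 norm_mult s_def)
  with * have *: "Lp_norm \<mu> p (\<lambda>z. W z * h z) < \<epsilon> * cmod s"
    using \<epsilon> space_pos by (simp add: field_simps)
  then have s: "s \<noteq> 0" using Lp_norm_nonneg[of \<mu> p "\<lambda>z. W z * h z"] by auto
  have "Lp_norm \<mu> p (\<lambda>z. W z * ((1/s) * h z)) = Lp_norm \<mu> p (\<lambda>z. (1/s) * (W z * h z))"
    by (simp add: mult_ac)
  also have "\<dots> = cmod (1/s) * Lp_norm \<mu> p (\<lambda>z. W z * h z)"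
    using p by (intro Lp_norm_scale) auto
  also have "\<dots> < \<epsilon>"
    using * s by (simp add: norm_divide field_simps)
  finally have "Lp_norm \<mu> p (\<lambda>z. W z * ((1/s) * h z)) < \<epsilon>" .
  moreover have "coef 0 (\<lambda>z. (1/s) * h z) = 1"
    unfolding coef_scale using s by (simp add: s_def)
  moreover have "bdd_meas \<mu> (\<lambda>z. (1/s) * h z)"
    by (intro bdd_meas_mult bdd_meas_const h)
  ultimately show "\<exists>h. bdd_meas \<mu> h \<and> coef 0 h = 1 \<and> Lp_norm \<mu> p (\<lambda>z. W z * h z) < \<epsilon>"
    by blast
next
  assume small: "\<forall>\<epsilon>>0. \<exists>h. bdd_meas \<mu> h \<and> coef 0 h = 1 \<and> Lp_norm \<mu> p (\<lambda>z. W z * h z) < \<epsilon>"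
    and "bounded_functional \<mu> p W (\<lambda>z. 1)"
  then obtain C where C: "0 \<le> C" "\<And>h. bdd_meas \<mu> h \<Longrightarrow>
      cmod (\<integral>z. h z \<partial>\<mu>) \<le> C * Lp_norm \<mu> p (\<lambda>z. W z * h z)"
    by (auto simp: bounded_functional_def)
  let ?m = "measure \<mu> (space \<mu>)"
  have "0 < ?m / (C + 1)" using C space_pos by simp
  then obtain h where h: "bdd_meas \<mu> h" "coef 0 h = 1" "Lp_norm \<mu> p (\<lambda>z. W z * h z) < ?m / (C + 1)"
    using small by blast
  have "?m = cmod (\<integral>z. h z \<partial>\<mu>)" using h space_pos by (simp add: integral_eq_coef_0)
  also have "\<dots> \<le> C * (?m / (C + 1))"
    using C(2)[OF h(1)] mult_left_mono[OF less_imp_le[OF h(3)] C(1)] by linarith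
  also have "\<dots> < ?m" using C space_pos by (simp add: field_simps)
  finally show False by simp
qed

text \<open>
  Truncating \<open>f / W\<close> where \<open>f\<close> is large or \<open>W\<close> is small.
\<close>

lemma weighted_bounded_dense:
  assumes W: "W \<in> Lp_space \<mu> p" and p: "1 \<le> p" and nz: "AE z in \<mu>. W z \<noteq> 0"
    and f: "f \<in> Lp_space \<mu> p" and \<epsilon>: "0 < \<epsilon>"
  obtains h where "bdd_meas \<mu> h" "Lp_norm \<mu> p (\<lambda>z. f z - W z * h z) < \<epsilon>"
proof -
  note [measurable] = Lp_spaceD(1)[OF f] Lp_spaceD(1)[OF W]
  define h where "h n z = (if cmod (f z) \<le> real n \<and> 1 / real (Suc n) \<le> cmod (W z) then f z / W z else 0)"
    for n z
  have [measurable]: "h n \<in> borel_measurable \<mu>" for n unfolding h_def by measurable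
  have h: "bdd_meas \<mu> (h n)" for n
  proof (rule bdd_measI[of _ _ "real n * real (Suc n)"])
    show "cmod (h n z) \<le> real n * real (Suc n)" for z
    proof (cases "cmod (f z) \<le> real n \<and> 1 / real (Suc n) \<le> cmod (W z)")
      case True
      have "cmod (f z) / cmod (W z) \<le> real n / (1 / real (Suc n))"
        using True by (intro frac_le) auto
      then show ?thesis using True by (simp add: h_def norm_divide)
    qed (auto simp: h_def)
  qed measurable
  have "(\<lambda>n. Lp_norm \<mu> p (\<lambda>z. f z - W z * h n z)) \<longlonglongrightarrow> Lp_norm \<mu> p (\<lambda>z. 0)"
  proof (rule Lp_norm_tendsto[where w="\<lambda>z. cmod (f z)"])
    show "cmod (f z - W z * h n z) \<le> cmod (f z)" for n z
      by (cases "W z = 0") (auto simp: h_def)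
    show "AE z in \<mu>. (\<lambda>n. f z - W z * h n z) \<longlonglongrightarrow> 0"
      using nz
    proof eventually_elim
      case (elim z)
      have "\<forall>\<^sub>F n in sequentially. cmod (f z) \<le> real n"
        using filterlim_real_sequentially by (auto simp: filterlim_at_top)
      moreover have "\<forall>\<^sub>F n in sequentially. 1 / real (Suc n) < cmod (W z)"
        using elim by (intro order_tendstoD(2)[OF LIMSEQ_inverse_real_of_nat[unfolded inverse_eq_divide]]) auto
      ultimately have "\<forall>\<^sub>F n in sequentially. f z - W z * h n z = 0"
        by eventually_elim (use elim in \<open>auto simp: h_def\<close>)
      then show ?case by (rule tendsto_eventually)
    qed
  qed (use p Lp_spaceD[OF f] in auto)
  then have "(\<lambda>n. Lp_norm \<mu> p (\<lambda>z. f z - W z * h n z)) \<longlonglongrightarrow> 0"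
    by (simp add: Lp_norm_def)
  then have "\<forall>\<^sub>F n in sequentially. Lp_norm \<mu> p (\<lambda>z. f z - W z * h n z) < \<epsilon>"
    using \<epsilon> by (rule order_tendstoD)
  then obtain n where "Lp_norm \<mu> p (\<lambda>z. f z - W z * h n z) < \<epsilon>"
    using eventually_happens'[OF sequentially_bot] by blast
  then show thesis using that h by blast
qed

abbreviation system :: "('a \<Rightarrow> complex) \<Rightarrow> 'i \<Rightarrow> 'a \<Rightarrow> complex"
  where "system W \<equiv> (\<lambda>i z. W z * e i z)"

lemma system_in_Lp: "W \<in> Lp_space \<mu> p \<Longrightarrow> 0 < p \<Longrightarrow> system W i \<in> Lp_space \<mu> p"
  by (rule Lp_space_mult_bdd[OF _ bdd_meas_e])

text \<open>
  Dropping the constant character from the system loses nothing: a bounded function \<open>h\<close> is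
  replaced by \<open>h - s k\<close>, where \<open>s\<close> is its mean and \<open>k\<close> has mean one and small weighted norm. The
  result has mean zero and is approximated by trigonometric polynomials without constant term.
\<close>

lemma unbounded_mean_imp_complete:
  assumes W: "W \<in> Lp_space \<mu> p" and p: "1 \<le> p" and nz: "AE z in \<mu>. W z \<noteq> 0"
    and unb: "\<not> bounded_functional \<mu> p W (\<lambda>z. 1)"
  shows "complete_in_Lp \<mu> p (system W) (UNIV - {0})"
proof -
  have p0: "0 < p" using p by simp
  have "\<exists>T. trig_poly e (UNIV - {0}) T \<and> Lp_norm \<mu> p (\<lambda>z. f z - W z * T z) < \<epsilon>"
    if f: "f \<in> Lp_space \<mu> p" and \<epsilon>: "0 < \<epsilon>" for f \<epsilon>
  proof -
    obtain h where h: "bdd_meas \<mu> h" "Lp_norm \<mu> p (\<lambda>z. f z - W z * h z) < \<epsilon> / 8"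
      using weighted_bounded_dense[OF W p nz f, of "\<epsilon> / 8"] \<epsilon> by auto
    define s where "s = coef 0 h"
    define D where "D = cmod s + 1"
    have D: "0 < D" unfolding D_def by (simp add: add_nonneg_pos)
    then have "0 < \<epsilon> / (8 * D)" using \<epsilon> by simp
    then obtain k where k: "bdd_meas \<mu> k" "coef 0 k = 1"
        "Lp_norm \<mu> p (\<lambda>z. W z * k z) < \<epsilon> / (8 * D)"
      using unb unfolding unbounded_mean_iff[OF W p] by blast
    have sk: "Lp_norm \<mu> p (\<lambda>z. s * (W z * k z)) < \<epsilon> / 8"
    proof -
      have "Lp_norm \<mu> p (\<lambda>z. s * (W z * k z)) \<le> D * Lp_norm \<mu> p (\<lambda>z. W z * k z)"
        by (subst Lp_norm_scale[OF p0]) (auto simp: D_def intro!: mult_right_mono Lp_norm_nonneg)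
      also have "\<dots> < D * (\<epsilon> / (8 * D))"
        using k(3) by (intro mult_strict_left_mono) (auto simp: D)
      also have "\<dots> = \<epsilon> / 8" using D by simp
      finally show ?thesis .
    qed
    define g where "g z = h z - s * k z" for z
    have g: "bdd_meas \<mu> g" unfolding g_def
      by (intro bdd_meas_diff h bdd_meas_mult bdd_meas_const k)
    have g0: "coef 0 g = 0" unfolding g_def
      using h k by (subst coef_diff) (auto simp: coef_scale s_def bdd_meas_mult bdd_meas_const)
    note L = Lp_space_mult_bdd[OF W _ p0]
    have "Lp_norm \<mu> p (\<lambda>z. f z - W z * g z)
        = Lp_norm \<mu> p (\<lambda>z. (f z - W z * h z) + s * (W z * k z))"
      by (simp add: g_def algebra_simps)
    also have "\<dots> \<le> 2 * (Lp_norm \<mu> p (\<lambda>z. f z - W z * h z) + Lp_norm \<mu> p (\<lambda>z. s * (W z * k z)))"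
      by (intro Lp_norm_quasi_triangle Lp_space_diff f L h Lp_space_scale k p p0)
    also have "\<dots> < \<epsilon> / 2" using h sk by simp
    finally have fg: "Lp_norm \<mu> p (\<lambda>z. f z - W z * g z) < \<epsilon> / 2" .
    have "\<exists>T. trig_poly e UNIV T \<and> coef 0 T = 0 \<and> Lp_norm \<mu> p (\<lambda>z. f z - W z * T z) < \<epsilon>"
    proof -
      obtain \<delta> where \<delta>: "0 < \<delta>" "2 * (Lp_norm \<mu> p (\<lambda>z. f z - W z * g z) + \<delta>) < \<epsilon>"
      proof -
        define N where "N = Lp_norm \<mu> p (\<lambda>z. f z - W z * g z)"
        have "0 < (\<epsilon> / 2 - N) / 2" "2 * (N + (\<epsilon> / 2 - N) / 2) < \<epsilon>"
          using fg by (simp_all add: N_def [symmetric] field_simps)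
        then show thesis using that unfolding N_def by blast
      qed
      obtain T where T: "trig_poly e UNIV T" "coef 0 T = coef 0 g"
          "Lp_norm \<mu> p (\<lambda>z. W z * (g z - T z)) < \<delta>"
        using approx_weighted[OF W p0 g, of "{0}" "\<delta>"] \<delta> by auto
      have "Lp_norm \<mu> p (\<lambda>z. f z - W z * T z)
          = Lp_norm \<mu> p (\<lambda>z. (f z - W z * g z) + W z * (g z - T z))"
        by (simp add: algebra_simps)
      also have "\<dots> \<le> 2 * (Lp_norm \<mu> p (\<lambda>z. f z - W z * g z) + Lp_norm \<mu> p (\<lambda>z. W z * (g z - T z)))"
        by (intro Lp_norm_quasi_triangle Lp_space_diff f L g bdd_meas_diff bdd_meas_trig[OF T(1)] p p0)
      also have "\<dots> < \<epsilon>" 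
        by (rule order.strict_trans[OF _ \<delta>(2)]) (use T(3) in simp)
      finally show ?thesis using T g0 by auto
    qed
    then show ?thesis using trig_poly_Diff[of _ "{0}"] by auto
  qed
  then show ?thesis
    unfolding complete_in_Lp_def closed_span_weighted using system_in_Lp[OF W p0] by auto
qed

text \<open>
  Approximating \<open>W\<close> itself by \<open>W T\<close>, with \<open>T\<close> free of a constant term, makes \<open>1 - T\<close> a function of
  mean one and small weighted norm.
\<close>

lemma complete_imp_unbounded_mean:
  assumes W: "W \<in> Lp_space \<mu> p" and p: "1 \<le> p"
    and "complete_in_Lp \<mu> p (system W) (UNIV - {0})"
  shows "\<not> bounded_functional \<mu> p W (\<lambda>z. 1)"
  unfolding unbounded_mean_iff[OF W p]
proof safe
  fix \<epsilon> :: real assume "0 < \<epsilon>"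
  moreover have "W \<in> closed_span \<mu> p (system W) (UNIV - {0})"
    using assms by (simp add: complete_in_Lp_def)
  ultimately obtain T where T: "trig_poly e (UNIV - {0}) T" "Lp_norm \<mu> p (\<lambda>z. W z - W z * T z) < \<epsilon>"
    unfolding closed_span_weighted by blast
  have "coef 0 (\<lambda>z. 1 - T z) = 1"
    using coef_diff[OF bdd_meas_e bdd_meas_trig[OF T(1)], of 0 0] coef_e[of 0 0]
      coef_trig_eq_0[OF T(1), of 0] by simp
  then show "\<exists>h. bdd_meas \<mu> h \<and> coef 0 h = 1 \<and> Lp_norm \<mu> p (\<lambda>z. W z * h z) < \<epsilon>"
    using T by (intro exI[of _ "\<lambda>z. 1 - T z"])
      (auto simp: right_diff_distrib intro!: bdd_meas_diff bdd_meas_const bdd_meas_trig[OF T(1)])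
qed

lemma integral_against_biorthogonal:
  assumes "bdd_meas \<mu> h"
  shows "(\<integral>z. h z * (e (- i) z - c) \<partial>\<mu>) = measure \<mu> (space \<mu>) * (coef i h - c * coef 0 h)"
proof -
  have "(\<integral>z. h z * (e (- i) z - c) \<partial>\<mu>) = (\<integral>z. h z * e (- i) z \<partial>\<mu>) - (\<integral>z. h z * c \<partial>\<mu>)"
    unfolding right_diff_distrib
    by (intro Bochner_Integration.integral_diff bdd_meas_integrable bdd_meas_mult assms bdd_meas_e bdd_meas_const)
  also have "\<dots> = measure \<mu> (space \<mu>) * (coef i h - c * coef 0 h)"
    using space_pos by (simp add: coef_def field_simps)
  finally show ?thesis .
qed

text \<open>
  The functional given by \<open>e\<^sub>-\<^sub>i - c\<close> annihilates every \<open>W e\<^sub>j\<close> with \<open>j \<noteq> 0, i\<close>, because \<open>c\<close> only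
  affects the coefficient at \<open>0\<close>, but not \<open>W e\<^sub>i\<close>.
\<close>

lemma bounded_functional_imp_minimal:
  assumes W: "W \<in> Lp_space \<mu> p" and i: "i \<noteq> 0"
    and b: "bounded_functional \<mu> p W (\<lambda>z. e (- i) z - c)"
  shows "system W i \<notin> closed_span \<mu> p (system W) (UNIV - {0} - {i})"
proof
  assume "system W i \<in> closed_span \<mu> p (system W) (UNIV - {0} - {i})"
  then have *: "\<exists>T. trig_poly e (UNIV - {0} - {i}) T \<and> Lp_norm \<mu> p (\<lambda>z. W z * e i z - W z * T z) < \<epsilon>"
    if "0 < \<epsilon>" for \<epsilon> using that unfolding closed_span_weighted by blast
  obtain C where C: "0 \<le> C" "\<And>h. bdd_meas \<mu> h \<Longrightarrow>
      cmod (\<integral>z. h z * (e (- i) z - c) \<partial>\<mu>) \<le> C * Lp_norm \<mu> p (\<lambda>z. W z * h z)"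
    using b by (auto simp: bounded_functional_def)
  let ?m = "measure \<mu> (space \<mu>)"
  have "0 < ?m / (C + 1)" using C space_pos by simp
  then obtain T where T: "trig_poly e (UNIV - {0} - {i}) T"
      "Lp_norm \<mu> p (\<lambda>z. W z * e i z - W z * T z) < ?m / (C + 1)"
    using * by blast
  define h where "h z = e i z - T z" for z
  have h: "bdd_meas \<mu> h" unfolding h_def by (intro bdd_meas_diff bdd_meas_e bdd_meas_trig[OF T(1)])
  have "coef i h = 1" "coef 0 h = 0"
    unfolding h_def using i T(1)
    by (simp_all add: coef_diff[OF bdd_meas_e bdd_meas_trig[OF T(1)]] coef_e coef_trig_eq_0)
  then have "?m = cmod (\<integral>z. h z * (e (- i) z - c) \<partial>\<mu>)"
    using space_pos by (simp add: integral_against_biorthogonal[OF h])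
  also have "\<dots> \<le> C * Lp_norm \<mu> p (\<lambda>z. W z * h z)" by (rule C(2)[OF h])
  also have "\<dots> \<le> C * (?m / (C + 1))"
    using T(2) C(1) by (intro mult_left_mono) (auto simp: h_def right_diff_distrib)
  also have "\<dots> < ?m" using C space_pos by (simp add: field_simps)
  finally show False by simp
qed

text \<open>
  For a trigonometric polynomial \<open>T\<close> of mean zero with coefficient \<open>s \<noteq> 0\<close> at \<open>i\<close>, the polynomial
  \<open>e\<^sub>i - T / s\<close> involves neither \<open>e\<^sub>0\<close> nor \<open>e\<^sub>i\<close>. Its distance from \<open>e\<^sub>i\<close> is the weighted norm of
  \<open>T / s\<close>, and it is bounded below by minimality.
\<close>

lemma minimal_imp_bounded_coef:
  assumes W: "W \<in> Lp_space \<mu> p" and p: "1 \<le> p" and i: "i \<noteq> 0"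
    and "minimal_in_Lp \<mu> p (system W) (UNIV - {0})"
  obtains C where "0 \<le> C" "\<And>h. bdd_meas \<mu> h \<Longrightarrow> coef 0 h = 0 \<Longrightarrow>
    cmod (coef i h) \<le> C * Lp_norm \<mu> p (\<lambda>z. W z * h z)"
proof -
  have p0: "0 < p" using p by simp
  have "system W i \<notin> closed_span \<mu> p (system W) (UNIV - {0} - {i})"
    using assms by (simp add: minimal_in_Lp_def)
  then obtain d where d: "0 < d" "\<And>T. trig_poly e (UNIV - {0} - {i}) T \<Longrightarrow>
      d \<le> Lp_norm \<mu> p (\<lambda>z. W z * e i z - W z * T z)"
    using system_in_Lp[OF W p0] unfolding closed_span_weighted by (fastforce simp: not_less)
  have trig: "cmod (coef i T) \<le> (1 / d) * Lp_norm \<mu> p (\<lambda>z. W z * T z)"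
    if T: "trig_poly e UNIV T" "coef 0 T = 0" for T
  proof (cases "coef i T = 0")
    case True
    then show ?thesis using d by (simp add: Lp_norm_nonneg)
  next
    case False
    define s where "s = coef i T"
    define S where "S z = e i z - (1/s) * T z" for z
    have bT: "bdd_meas \<mu> (\<lambda>z. (1/s) * T z)"
      by (intro bdd_meas_mult bdd_meas_const bdd_meas_trig[OF T(1)])
    have cS: "coef j S = coef j (e i) - (1/s) * coef j T" for j
      unfolding S_def by (subst coef_diff[OF bdd_meas_e bT]) (simp only: coef_scale)
    have "trig_poly e UNIV (\<lambda>z. 1 * e i z + (- 1 / s) * T z)"
      by (intro trig_poly_add trig_poly_basis trig_poly_scale T) auto
    then have "trig_poly e UNIV S" by (simp add: S_def [abs_def])
    then have "trig_poly e (UNIV - {0, i}) S"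
      using T(2) False i by (intro trig_poly_Diff) (auto simp: cS coef_e s_def)
    then have "d \<le> Lp_norm \<mu> p (\<lambda>z. W z * e i z - W z * S z)"
      by (intro d(2)) (auto simp: Diff_insert[symmetric] insert_commute elim: trig_poly_mono)
    also have "\<dots> = Lp_norm \<mu> p (\<lambda>z. (1/s) * (W z * T z))"
      by (simp add: S_def algebra_simps)
    also have "\<dots> = Lp_norm \<mu> p (\<lambda>z. W z * T z) / cmod s"
      by (subst Lp_norm_scale[OF p0]) (simp add: norm_divide)
    finally show ?thesis using False d(1) by (simp add: s_def field_simps)
  qed
  have "cmod (coef i h) \<le> (1 / d) * Lp_norm \<mu> p (\<lambda>z. W z * h z)"
    if h: "bdd_meas \<mu> h" "coef 0 h = 0" for h
  proof (rule field_le_epsilon)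
    fix \<epsilon> :: real assume "0 < \<epsilon>"
    then have \<epsilon>: "0 < d * \<epsilon>" using d by simp
    obtain T where T: "trig_poly e UNIV T" "\<And>j. j \<in> {0, i} \<Longrightarrow> coef j T = coef j h"
        "\<bar>Lp_norm \<mu> p (\<lambda>z. W z * T z) - Lp_norm \<mu> p (\<lambda>z. W z * h z)\<bar> < d * \<epsilon>"
      by (rule approx_weighted[OF W p0 h(1) _ \<epsilon>, of "{0, i}"]) auto
    have "cmod (coef i h) \<le> (1 / d) * Lp_norm \<mu> p (\<lambda>z. W z * T z)"
      using trig[OF T(1)] T(2)[of 0] T(2)[of i] h(2) by simp
    also have "\<dots> \<le> (1 / d) * (Lp_norm \<mu> p (\<lambda>z. W z * h z) + d * \<epsilon>)"
      using T(3) d(1) by (intro mult_left_mono) auto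
    also have "\<dots> = (1 / d) * Lp_norm \<mu> p (\<lambda>z. W z * h z) + \<epsilon>"
      using d by (simp add: field_simps)
    finally show "cmod (coef i h) \<le> (1 / d) * Lp_norm \<mu> p (\<lambda>z. W z * h z) + \<epsilon>" .
  qed
  then show thesis using that[of "1 / d"] d by simp
qed

text \<open>
  An unbounded mean yields functions \<open>k\<^sub>n\<close> of mean one whose weighted norms tend to zero. As the
  coefficient at \<open>i\<close> is bounded on functions of mean zero, its values at the \<open>k\<^sub>n\<close> form a Cauchy
  sequence. With its limit \<open>c\<close>, the bound for \<open>h - s k\<^sub>n\<close>, where \<open>s\<close> is the mean of \<open>h\<close>, passes to the
  coefficient at \<open>i\<close> minus \<open>c\<close> times the mean.
\<close>

lemma minimal_imp_bounded_functional:
  assumes W: "W \<in> Lp_space \<mu> p" and p: "1 \<le> p" and i: "i \<noteq> 0"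
    and unb: "\<not> bounded_functional \<mu> p W (\<lambda>z. 1)"
    and min: "minimal_in_Lp \<mu> p (system W) (UNIV - {0})"
  shows "\<exists>c. bounded_functional \<mu> p W (\<lambda>z. e (- i) z - c)"
proof -
  have p0: "0 < p" using p by simp
  obtain C where C: "0 \<le> C" "\<And>h. bdd_meas \<mu> h \<Longrightarrow> coef 0 h = 0 \<Longrightarrow>
      cmod (coef i h) \<le> C * Lp_norm \<mu> p (\<lambda>z. W z * h z)"
    using minimal_imp_bounded_coef[OF W p i min] by blast
  let ?N = "\<lambda>h. Lp_norm \<mu> p (\<lambda>z. W z * h z)"
  have N_diff: "?N (\<lambda>z. f z - s * g z) \<le> 2 * (?N f + cmod s * ?N g)"
    if "bdd_meas \<mu> f" "bdd_meas \<mu> g" for f g s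
  proof -
    have "?N (\<lambda>z. f z - s * g z) = Lp_norm \<mu> p (\<lambda>z. W z * f z - s * (W z * g z))"
      by (simp add: algebra_simps)
    also have "\<dots> \<le> 2 * (?N f + Lp_norm \<mu> p (\<lambda>z. s * (W z * g z)))"
      by (intro Lp_norm_quasi_triangle_diff Lp_space_scale Lp_space_mult_bdd W that p p0)
    finally show ?thesis by (simp add: Lp_norm_scale[OF p0])
  qed
  have "\<exists>h. \<forall>n. bdd_meas \<mu> (h n) \<and> coef 0 (h n) = 1 \<and> ?N (h n) < 1 / real (Suc n)"
    using unb unfolding unbounded_mean_iff[OF W p] by (intro choice allI) simp
  then obtain k where k: "\<And>n. bdd_meas \<mu> (k n)" "\<And>n. coef 0 (k n) = 1" "\<And>n. ?N (k n) < 1 / real (Suc n)"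
    by blast
  have lim0: "(\<lambda>n. ?N (k n)) \<longlonglongrightarrow> 0"
    by (rule tendsto_sandwich[OF _ _ tendsto_const LIMSEQ_inverse_real_of_nat[unfolded inverse_eq_divide]])
       (auto intro!: always_eventually less_imp_le[OF k(3)] simp: Lp_norm_nonneg simp del: of_nat_Suc)
  define a where "a n = coef i (k n)" for n
  \<comment> \<open>\<open>h - s k\<^sub>n\<close>, with \<open>s\<close> the mean of \<open>h\<close>, has mean zero\<close>
  have key: "cmod (coef i h - coef 0 h * a n) \<le> C * (2 * (?N h + cmod (coef 0 h) * ?N (k n)))"
    if h: "bdd_meas \<mu> h" for h n
  proof -
    let ?f = "\<lambda>z. h z - coef 0 h * k n z"
    have b: "bdd_meas \<mu> (\<lambda>z. coef 0 h * k n z)" by (intro bdd_meas_mult bdd_meas_const k)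
    have "coef 0 ?f = 0" "coef i ?f = coef i h - coef 0 h * a n"
      by (simp_all add: coef_diff[OF h b] coef_scale k a_def)
    then have "cmod (coef i h - coef 0 h * a n) \<le> C * ?N ?f"
      using C(2)[of ?f] bdd_meas_diff[OF h b] by simp
    also have "\<dots> \<le> C * (2 * (?N h + cmod (coef 0 h) * ?N (k n)))"
      by (intro mult_left_mono N_diff h k C)
    finally show ?thesis .
  qed
  have "Cauchy a"
  proof (rule metric_CauchyI)
    fix \<epsilon> :: real assume \<epsilon>: "0 < \<epsilon>"
    have "0 < \<epsilon> / (4 * C + 1)" using \<epsilon> C by simp
    then obtain n0 where n0: "\<And>n. n \<ge> n0 \<Longrightarrow> ?N (k n) < \<epsilon> / (4 * C + 1)"
      using order_tendstoD(2)[OF lim0] unfolding eventually_sequentially by blast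
    have "dist (a m) (a n) < \<epsilon>" if "m \<ge> n0" "n \<ge> n0" for m n
    proof -
      have "dist (a m) (a n) \<le> C * (2 * (?N (k m) + ?N (k n)))"
        using key[OF k(1), of m n] by (simp add: k dist_norm a_def)
      also have "\<dots> \<le> C * (2 * (\<epsilon> / (4 * C + 1) + \<epsilon> / (4 * C + 1)))"
        using n0[OF that(1)] n0[OF that(2)] C by (intro mult_left_mono add_mono) auto
      also have "\<dots> = 4 * C / (4 * C + 1) * \<epsilon>" by (simp add: add_divide_distrib)
      also have "\<dots> < 1 * \<epsilon>" using C(1) \<epsilon> by (intro mult_strict_right_mono) auto
      finally show ?thesis by simp
    qed
    then show "\<exists>M. \<forall>m\<ge>M. \<forall>n\<ge>M. dist (a m) (a n) < \<epsilon>" by blast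
  qed
  then obtain c where c: "a \<longlonglongrightarrow> c" by (auto simp: Cauchy_convergent_iff convergent_def)
  let ?m = "measure \<mu> (space \<mu>)"
  have "cmod (\<integral>z. h z * (e (- i) z - c) \<partial>\<mu>) \<le> (?m * (2 * C)) * ?N h" if h: "bdd_meas \<mu> h" for h
  proof -
    have "(\<lambda>n. cmod (coef i h - coef 0 h * a n)) \<longlonglongrightarrow> cmod (coef i h - coef 0 h * c)"
      by (intro tendsto_intros c)
    moreover have "(\<lambda>n. C * (2 * (?N h + cmod (coef 0 h) * ?N (k n))))
        \<longlonglongrightarrow> C * (2 * (?N h + cmod (coef 0 h) * 0))"
      by (intro tendsto_intros lim0)
    ultimately have "cmod (coef i h - coef 0 h * c) \<le> C * (2 * (?N h + cmod (coef 0 h) * 0))"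
      by (rule LIMSEQ_le) (use key[OF h] in auto)
    then have "?m * cmod (coef i h - c * coef 0 h) \<le> ?m * (C * (2 * ?N h))"
      using space_pos by (intro mult_left_mono) (auto simp: mult.commute)
    then show ?thesis
      by (simp add: integral_against_biorthogonal[OF h] norm_mult mult_ac)
  qed
  then have "bounded_functional \<mu> p W (\<lambda>z. e (- i) z - c)"
    unfolding bounded_functional_def using C space_pos by (intro exI[of _ "?m * (2 * C)"]) auto
  then show ?thesis by blast
qed

text \<open>
  Completeness amounts to an unbounded mean once \<open>W\<close> is known to be nonzero almost everywhere, and this
  follows from the bounded functional that belongs to a nonconstant character.
\<close>

theorem complete_minimal_iff:
  assumes W: "W \<in> Lp_space \<mu> p" and p: "1 \<le> p"
  shows "complete_in_Lp \<mu> p (system W) (UNIV - {0}) \<and> minimal_in_Lp \<mu> p (system W) (UNIV - {0})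
    \<longleftrightarrow> \<not> bounded_functional \<mu> p W (\<lambda>z. 1) \<and>
        (\<forall>i. i \<noteq> 0 \<longrightarrow> (\<exists>c. bounded_functional \<mu> p W (\<lambda>z. e i z - c)))"
    (is "?L \<longleftrightarrow> ?U \<and> ?F")
proof
  assume L: ?L
  then have U: ?U using complete_imp_unbounded_mean[OF W p] by blast
  have ?F
  proof (intro allI impI)
    fix i :: 'i assume "i \<noteq> 0"
    then have "- i \<noteq> 0" by simp
    from minimal_imp_bounded_functional[OF W p this U] L
    show "\<exists>c. bounded_functional \<mu> p W (\<lambda>z. e i z - c)" by simp
  qed
  with U show "?U \<and> ?F" ..
next
  assume R: "?U \<and> ?F"
  have p0: "0 < p" using p by simp
  obtain i where i: "i \<noteq> 0" "\<And>c. AE z in \<mu>. e i z \<noteq> c" using nonconstant by blast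
  obtain c where "bounded_functional \<mu> p W (\<lambda>z. e i z - c)" using R i(1) by blast
  moreover have "bdd_meas \<mu> (\<lambda>z. e i z - c)"
    by (intro bdd_meas_diff bdd_meas_e bdd_meas_const)
  moreover have "AE z in \<mu>. e i z - c \<noteq> 0" using i(2)[of c] by simp
  ultimately have "AE z in \<mu>. W z \<noteq> 0" using W by (rule bounded_functional_imp_nonzero)
  then have "complete_in_Lp \<mu> p (system W) (UNIV - {0})"
    using R by (intro unbounded_mean_imp_complete W p) auto
  moreover have "system W i \<notin> closed_span \<mu> p (system W) (UNIV - {0} - {i})" if i: "i \<noteq> 0" for i
  proof -
    have "- i \<noteq> 0" using i by simp
    then obtain c where "bounded_functional \<mu> p W (\<lambda>z. e (- i) z - c)" using R by blast
    then show ?thesis by (rule bounded_functional_imp_minimal[OF W i])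
  qed
  ultimately show ?L
    unfolding minimal_in_Lp_def using system_in_Lp[OF W p0] by auto
qed

end

section \<open>Norms of extended nonnegative functions\<close>

lemma conjugate_exponent_cases:
  assumes "1 \<le> p" "1 / ennreal p + 1 / q = (1::ennreal)"
  obtains "p = 1" "q = \<infinity>" | r where "1 < p" "1 < r" "q = ennreal r" "r = p / (p - 1)"
proof (cases "p = 1")
  case True
  then have "1 + 1 / q = 1 + (0::ennreal)" using assms by simp
  then have "1 / q = 0" by (simp add: ennreal_add_left_cancel)
  then have "q = \<infinity>" by (cases q) (auto simp: divide_ennreal_def ennreal_mult_eq_top_iff)
  then show ?thesis using True that by blast
next
  case False
  then have p: "1 < p" using assms by simp
  then have 1: "1 / ennreal p = ennreal (1 / p)"
    using divide_ennreal[of 1 p] by simp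
  show ?thesis
  proof (cases q)
    case (real r)
    show ?thesis
    proof (cases "r = 0")
      case True
      then show ?thesis using assms(2) real by (auto simp: divide_ennreal_def)
    next
      case False
      then have r: "0 < r" using real by simp
      then have "1 / q = ennreal (1 / r)" using real divide_ennreal[of 1 r] by simp
      then have "ennreal (1 / p + 1 / r) = ennreal 1"
        using assms(2) 1 p r by (simp add: ennreal_plus)
      then have *: "1 / p + 1 / r = 1" using p r by (subst (asm) ennreal_inj) auto
      have "0 < 1 / p" using p by simp
      with * have "1 / r < 1" by linarith
      then have "r = p / (p - 1)" "1 < r" using * p r by (auto simp: field_simps)
      then show ?thesis using that(2)[of r] p real by auto
    qed
  next
    case top
    then have "ennreal (1 / p) = ennreal 1" using assms(2) 1 by simp
    then show ?thesis using p by (subst (asm) ennreal_inj) auto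
  qed
qed

lemma ennreal_powr_ennreal: "0 \<le> c \<Longrightarrow> ennreal_powr (ennreal c) r = ennreal (c powr r)"
  by (simp add: ennreal_powr_def)

lemma ennreal_powr_top [simp]: "ennreal_powr \<infinity> r = \<infinity>" "ennreal_powr top r = top"
  by (simp_all add: ennreal_powr_def)

lemma ennreal_powr_eq_top_iff [simp]: "ennreal_powr a r = top \<longleftrightarrow> a = top"
  by (simp add: ennreal_powr_def)

lemma ennreal_powr_less_top_iff: "ennreal_powr a r < top \<longleftrightarrow> a < top"
  by (simp add: less_top[symmetric])

lemma ennreal_powr_powr: "ennreal_powr (ennreal_powr a r) s = ennreal_powr a (r * s)"
  by (cases a) (auto simp: ennreal_powr_ennreal powr_powr)

lemma ennreal_powr_one [simp]: "ennreal_powr a 1 = a"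
  by (cases a) (auto simp: ennreal_powr_ennreal)

lemma ennreal_powr_cmult:
  assumes "0 \<le> c"
  shows "ennreal_powr (ennreal c * a) r = ennreal (c powr r) * ennreal_powr a r"
proof (cases a)
  case (real b)
  then show ?thesis using assms
    by (simp add: ennreal_powr_ennreal powr_mult flip: ennreal_mult)
next
  case top
  then show ?thesis using assms
    by (cases "c = 0") (auto simp: ennreal_mult_top ennreal_powr_def)
qed

lemma borel_measurable_ennreal_powr [measurable (raw)]:
  assumes [measurable]: "F \<in> borel_measurable M"
  shows "(\<lambda>z. ennreal_powr (F z) r) \<in> borel_measurable M"
  unfolding ennreal_powr_def by measurable

text \<open>
  The \<open>L\<^sup>q\<close> norm of a \<open>[0, \<infinity>]\<close>-valued function. Values in \<open>[0, \<infinity>]\<close> allow the norm of a slice to be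
  integrated again, and \<^const>\<open>recip_norm\<close> is the special case of a reciprocal.
\<close>

definition ext_norm :: "ennreal \<Rightarrow> 'a measure \<Rightarrow> ('a \<Rightarrow> ennreal) \<Rightarrow> ennreal"
  where "ext_norm q \<mu> F = (if q = \<infinity> then esssup \<mu> F else
     ennreal_powr (\<integral>\<^sup>+ z. ennreal_powr (F z) (enn2real q) \<partial>\<mu>) (1 / enn2real q))"

lemma recip_norm_eq_ext_norm: "recip_norm q \<mu> f = ext_norm q \<mu> (\<lambda>z. 1 / ennreal (cmod (f z)))"
  by (simp add: recip_norm_def ext_norm_def)

lemma esssup_le_iff:
  fixes F :: "'a \<Rightarrow> ennreal"
  assumes "F \<in> borel_measurable \<mu>"
  shows "esssup \<mu> F \<le> c \<longleftrightarrow> (AE z in \<mu>. F z \<le> c)"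
  using esssup_AE[of F \<mu>] esssup_I[OF assms] by (auto elim: AE_mp intro: order_trans)

lemma ext_norm_top: "ext_norm \<infinity> \<mu> F = esssup \<mu> F"
  by (simp add: ext_norm_def)

lemma ext_norm_real:
  "0 < r \<Longrightarrow> ext_norm (ennreal r) \<mu> F = ennreal_powr (\<integral>\<^sup>+ z. ennreal_powr (F z) r \<partial>\<mu>) (1 / r)"
  by (simp add: ext_norm_def)

lemma ext_norm_cong_AE:
  assumes "F \<in> borel_measurable \<mu>" "G \<in> borel_measurable \<mu>" "AE z in \<mu>. F z = G z"
  shows "ext_norm q \<mu> F = ext_norm q \<mu> G"
proof -
  have "esssup \<mu> F = esssup \<mu> G" by (rule esssup_AE_cong[OF assms])
  moreover have "(\<integral>\<^sup>+ z. ennreal_powr (F z) r \<partial>\<mu>) = (\<integral>\<^sup>+ z. ennreal_powr (G z) r \<partial>\<mu>)" for r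
    using assms(3) by (intro nn_integral_cong_AE) auto
  ultimately show ?thesis by (simp add: ext_norm_def)
qed

lemma esssup_ennreal_cmult:
  fixes F :: "'a \<Rightarrow> ennreal"
  assumes F [measurable]: "F \<in> borel_measurable \<mu>" and c: "0 \<le> c"
  shows "esssup \<mu> (\<lambda>z. ennreal c * F z) = ennreal c * esssup \<mu> F"
proof (rule antisym)
  have "AE z in \<mu>. ennreal c * F z \<le> ennreal c * esssup \<mu> F"
    using esssup_AE[of F \<mu>] by eventually_elim (rule mult_left_mono, auto)
  then show "esssup \<mu> (\<lambda>z. ennreal c * F z) \<le> ennreal c * esssup \<mu> F"
    by (subst esssup_le_iff) auto
  show "ennreal c * esssup \<mu> F \<le> esssup \<mu> (\<lambda>z. ennreal c * F z)"
  proof (cases "c = 0")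
    case False
    then have c: "0 < c" using c by simp
    have inv: "ennreal (1 / c) * (ennreal c * x) = x" "ennreal c * (ennreal (1 / c) * x) = x" for x
      using c by (simp_all add: mult.assoc[symmetric] flip: ennreal_mult)
    have "AE z in \<mu>. F z \<le> ennreal (1 / c) * esssup \<mu> (\<lambda>z. ennreal c * F z)"
      using esssup_AE[of "\<lambda>z. ennreal c * F z" \<mu>]
    proof eventually_elim
      case (elim z)
      then have "ennreal (1 / c) * (ennreal c * F z) \<le> ennreal (1 / c) * esssup \<mu> (\<lambda>z. ennreal c * F z)"
        by (rule mult_left_mono) auto
      then show ?case by (simp only: inv)
    qed
    then have "esssup \<mu> F \<le> ennreal (1 / c) * esssup \<mu> (\<lambda>z. ennreal c * F z)"
      by (subst esssup_le_iff) auto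
    then have "ennreal c * esssup \<mu> F \<le> ennreal c * (ennreal (1 / c) * esssup \<mu> (\<lambda>z. ennreal c * F z))"
      by (rule mult_left_mono) auto
    then show ?thesis by (simp only: inv)
  qed auto
qed

lemma ext_norm_cmult:
  assumes "F \<in> borel_measurable \<mu>" "0 \<le> c" "q \<noteq> 0"
  shows "ext_norm q \<mu> (\<lambda>z. ennreal c * F z) = ennreal c * ext_norm q \<mu> F"
proof (cases q)
  case (real r)
  then have r: "0 < r" using assms(3) by (cases "r = 0") auto
  note [measurable] = assms(1)
  have "(c powr r) powr (1 / r) = c" using r assms(2) by (simp add: powr_powr)
  then show ?thesis using assms(2) r
    by (simp add: real ext_norm_real ennreal_powr_cmult nn_integral_cmult)
next
  case top
  then show ?thesis using esssup_ennreal_cmult[OF assms(1,2)] by (simp add: ext_norm_def)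
qed

section \<open>Duality of \<open>L\<^sup>p\<close> and \<open>L\<^sup>q\<close>\<close>

text \<open>
  Comparing \<open>a\<close> with \<open>b\<^sup>p\<^sup>-\<^sup>1\<close>, either \<open>a b \<le> b\<^sup>p\<close> or \<open>a b \<le> a\<^sup>r\<close>. The missing optimal constants are
  irrelevant for boundedness.
\<close>

lemma Young_crude:
  fixes a b p r :: real
  assumes "0 \<le> a" "0 \<le> b" "1 < p" "r = p / (p - 1)"
  shows "a * b \<le> a powr r + b powr p"
proof -
  have r: "1 < r" "(r - 1) * (p - 1) = 1" "r - 1 = 1 / (p - 1)"
    unfolding assms(4) using assms(3) by (auto simp: field_simps)
  have sq: "x * x powr (s - 1) = x powr s" if "0 \<le> x" for x s :: real
    using that by (cases "x = 0") (auto simp: powr_diff)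
  show ?thesis
  proof (cases "a \<le> b powr (p - 1)")
    case True
    then have "a * b \<le> b powr (p - 1) * b" using assms by (intro mult_right_mono) auto
    also have "\<dots> = b powr p" using sq[OF assms(2), of p] by (simp add: mult.commute)
    finally show ?thesis by (simp add: add_increasing)
  next
    case False
    then have "(b powr (p - 1)) powr (r - 1) \<le> a powr (r - 1)"
      using r(1) assms by (intro powr_mono2) auto
    then have "b \<le> a powr (r - 1)" using assms r by (simp add: powr_powr mult.commute)
    then have "a * b \<le> a * a powr (r - 1)" using assms by (intro mult_left_mono) auto
    also have "\<dots> = a powr r" by (rule sq[OF assms(1)])
    finally show ?thesis by (simp add: add_increasing2)
  qed
qed

text \<open>
  The function \<open>|g / W|\<close>, equal to \<open>\<infinity>\<close> at zeros of \<open>W\<close> at which \<open>g\<close> does not vanish.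
\<close>

definition abs_ratio :: "('a \<Rightarrow> complex) \<Rightarrow> ('a \<Rightarrow> complex) \<Rightarrow> 'a \<Rightarrow> ennreal"
  where "abs_ratio g W z = ennreal (cmod (g z)) * (1 / ennreal (cmod (W z)))"

lemma borel_measurable_abs_ratio [measurable (raw)]:
  assumes [measurable]: "g \<in> borel_measurable M" "W \<in> borel_measurable M"
  shows "abs_ratio g W \<in> borel_measurable M"
  unfolding abs_ratio_def [abs_def] by measurable

lemma abs_ratio_eq: "W z \<noteq> 0 \<Longrightarrow> abs_ratio g W z = ennreal (cmod (g z) / cmod (W z))"
  using divide_ennreal[of 1 "cmod (W z)"] by (simp add: abs_ratio_def flip: ennreal_mult)

lemma abs_ratio_eq_top: "W z = 0 \<Longrightarrow> g z \<noteq> 0 \<Longrightarrow> abs_ratio g W z = top"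
  by (simp add: abs_ratio_def divide_ennreal_def ennreal_mult_top)


text \<open>
  This is the Hoelder direction of the duality between \<open>L\<^sup>p\<close> and \<open>L\<^sup>q\<close>, applied to
  \<open>h g = (W h) (g / W)\<close>.
\<close>

lemma (in finite_measure) ext_norm_finite_imp_bounded_functional:
  assumes W: "W \<in> Lp_space M p" and g: "bdd_meas M g" "AE z in M. g z \<noteq> 0"
    and p: "1 \<le> p" and q: "1 / ennreal p + 1 / q = 1"
    and fin: "ext_norm q M (abs_ratio g W) < top"
  shows "bounded_functional M p W g"
proof -
  have p0: "0 < p" using p by simp
  note [measurable] = Lp_spaceD(1)[OF W] bdd_meas_measurable[OF g(1)]
  have "\<exists>C\<ge>0. \<forall>h. bdd_meas M h \<longrightarrow> (\<integral>z. cmod (h z * g z) \<partial>M) \<le> C * Lp_norm M p (\<lambda>z. W z * h z)"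
    using p q
  proof (cases rule: conjugate_exponent_cases)
    case 1
    obtain C where C: "0 \<le> C" "ext_norm q M (abs_ratio g W) = ennreal C"
      using fin by (cases "ext_norm q M (abs_ratio g W)") auto
    have "esssup M (abs_ratio g W) = ennreal C" using C(2) unfolding 1 ext_norm_top .
    then have "AE z in M. abs_ratio g W z \<le> ennreal C"
      using esssup_AE[of "abs_ratio g W" M] by simp
    then have ae: "AE z in M. cmod (g z) \<le> C * cmod (W z)"
      using g(2)
    proof eventually_elim
      case (elim z)
      then have "W z \<noteq> 0" using abs_ratio_eq_top[of W z g] by (auto simp: top_unique)
      with elim C show ?case by (auto simp: abs_ratio_eq field_simps)
    qed
    have "(\<integral>z. cmod (h z * g z) \<partial>M) \<le> C * Lp_norm M p (\<lambda>z. W z * h z)" if h: "bdd_meas M h" for h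
    proof -
      have "(\<integral>z. cmod (h z * g z) \<partial>M) \<le> (\<integral>z. C * cmod (W z * h z) powr p \<partial>M)"
      proof (rule integral_mono_AE)
        show "integrable M (\<lambda>z. cmod (h z * g z))"
          by (intro integrable_norm bdd_meas_integrable bdd_meas_mult h g)
        show "integrable M (\<lambda>z. C * cmod (W z * h z) powr p)"
          using Lp_spaceD(2)[OF Lp_space_mult_bdd[OF W h p0]] by simp
        show "AE z in M. cmod (h z * g z) \<le> C * cmod (W z * h z) powr p"
          using ae
        proof eventually_elim
          case (elim z)
          from mult_left_mono[OF this, of "cmod (h z)"] show ?case
            by (simp add: 1 norm_mult mult_ac)
        qed
      qed
      then show ?thesis by (simp add: Lp_norm_def 1 integral_nonneg_AE)
    qed
    then show ?thesis using C by blast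
  next
    case (2 r)
    have "ennreal_powr (\<integral>\<^sup>+ z. ennreal_powr (abs_ratio g W z) r \<partial>M) (1 / r) < top"
      using fin 2 by (simp add: ext_norm_real)
    then have fin': "(\<integral>\<^sup>+ z. ennreal_powr (abs_ratio g W z) r \<partial>M) < top"
      by (simp only: ennreal_powr_less_top_iff)
    define G where "G z = cmod (g z) / cmod (W z)" for z
    have "AE z in M. ennreal_powr (abs_ratio g W z) r \<noteq> \<infinity>"
      using fin' by (intro nn_integral_PInf_AE) auto
    then have nz: "AE z in M. W z \<noteq> 0"
      using g(2) by eventually_elim (auto dest: abs_ratio_eq_top)
    have "(\<integral>\<^sup>+ z. ennreal (G z powr r) \<partial>M) = (\<integral>\<^sup>+ z. ennreal_powr (abs_ratio g W z) r \<partial>M)"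
      using nz by (intro nn_integral_cong_AE, eventually_elim)
        (simp add: abs_ratio_eq G_def ennreal_powr_ennreal)
    then have int: "integrable M (\<lambda>z. G z powr r)"
      using fin' unfolding G_def by (intro integrableI_nonneg) auto
    define K where "K = (\<integral>z. G z powr r \<partial>M)"
    have K: "0 \<le> K" unfolding K_def by (simp add: integral_nonneg_AE)
    have "(\<integral>z. cmod (h z * g z) \<partial>M) \<le> (K + 1) * Lp_norm M p (\<lambda>z. W z * h z)"
      if h: "bdd_meas M h" for h
    proof -
      note Wh = Lp_spaceD[OF Lp_space_mult_bdd[OF W h p0]]
      define N where "N = Lp_norm M p (\<lambda>z. W z * h z)"
      have N_powr: "N powr p = (\<integral>z. cmod (W z * h z) powr p \<partial>M)"
        unfolding N_def by (rule Lp_norm_powr[OF p0])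
      show ?thesis
      proof (cases "N = 0")
        case True
        then have "(\<integral>z. cmod (W z * h z) powr p \<partial>M) = 0" using N_powr by simp
        then have "AE z in M. cmod (W z * h z) powr p = 0"
          using Wh by (subst (asm) integral_nonneg_eq_0_iff_AE) auto
        then have "AE z in M. cmod (h z * g z) = 0"
          using nz by eventually_elim auto
        then have "(\<integral>z. cmod (h z * g z) \<partial>M) = 0" by (rule integral_eq_zero_AE)
        then show ?thesis using K by (simp add: Lp_norm_nonneg)
      next
        case False
        then have N: "0 < N" unfolding N_def using Lp_norm_nonneg[of M p] by (simp add: order_less_le)
        \<comment> \<open>normalising \<open>W h\<close> by its norm \<open>N\<close> makes the bound linear in \<open>N\<close>\<close>
        have "(\<integral>z. cmod (h z * g z) \<partial>M)
            \<le> (\<integral>z. N * (G z powr r + cmod (W z * h z) powr p / N powr p) \<partial>M)"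
        proof (rule integral_mono_AE)
          show "integrable M (\<lambda>z. cmod (h z * g z))"
            by (intro integrable_norm bdd_meas_integrable bdd_meas_mult h g)
          show "integrable M (\<lambda>z. N * (G z powr r + cmod (W z * h z) powr p / N powr p))"
            using int Wh by auto
          show "AE z in M. cmod (h z * g z) \<le> N * (G z powr r + cmod (W z * h z) powr p / N powr p)"
            using nz
          proof eventually_elim
            case (elim z)
            have "cmod (h z * g z) = N * (G z * (cmod (W z * h z) / N))"
              using elim N by (simp add: G_def norm_mult)
            also have "\<dots> \<le> N * (G z powr r + (cmod (W z * h z) / N) powr p)"
              using N 2 by (intro mult_left_mono Young_crude) (auto simp: G_def)
            also have "(cmod (W z * h z) / N) powr p = cmod (W z * h z) powr p / N powr p"
              using N by (simp add: powr_divide)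
            finally show ?case .
          qed
        qed
        also have "\<dots> = N * (K + (\<integral>z. cmod (W z * h z) powr p \<partial>M) / N powr p)"
          using int Wh by (simp add: K_def)
        also have "\<dots> = (K + 1) * N" using N by (simp add: N_powr[symmetric])
        finally show ?thesis by (simp add: N_def)
      qed
    qed
    then show ?thesis using K by (intro exI[of _ "K + 1"]) auto
  qed
  then obtain C where "0 \<le> C"
      "\<And>h. bdd_meas M h \<Longrightarrow> (\<integral>z. cmod (h z * g z) \<partial>M) \<le> C * Lp_norm M p (\<lambda>z. W z * h z)"
    by blast
  then show ?thesis
    unfolding bounded_functional_def
    by (intro exI[of _ C] conjI allI impI order_trans[OF integral_norm_bound]) auto
qed

text \<open>
  Inserting \<open>h = cnj (sgn g) \<phi> / |W|\<close> gives \<open>h g = |g / W| \<phi>\<close> and \<open>|W h| \<le> \<phi>\<close>. The cut-off at \<open>\<delta>\<close>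
  keeps this \<open>h\<close> bounded.
\<close>

lemma (in finite_measure) bounded_functional_test:
  assumes W: "W \<in> Lp_space M p" and g: "bdd_meas M g" and p: "0 < p"
    and C: "\<And>h. bdd_meas M h \<Longrightarrow> cmod (\<integral>z. h z * g z \<partial>M) \<le> C * Lp_norm M p (\<lambda>z. W z * h z)"
    and C0: "0 \<le> C" and \<delta>: "0 < \<delta>"
    and \<phi>: "\<phi> \<in> borel_measurable M" "\<And>z. 0 \<le> \<phi> z" "\<And>z. \<phi> z \<le> B" "\<And>z. cmod (W z) < \<delta> \<Longrightarrow> \<phi> z = 0"
  shows "(\<integral>z. cmod (g z) / cmod (W z) * \<phi> z \<partial>M) \<le> C * (\<integral>z. \<phi> z powr p \<partial>M) powr (1 / p)"
proof -
  note [measurable] = Lp_spaceD(1)[OF W] bdd_meas_measurable[OF g] \<phi>(1)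
  define h where "h z = cnj (sgn (g z)) * of_real (\<phi> z / cmod (W z))" for z
  have B: "0 \<le> B" using \<phi>(2,3) order_trans by blast
  have [measurable]: "(\<lambda>z. cnj (sgn (g z))) \<in> borel_measurable M"
    unfolding sgn_eq by (rule measurable_compose[of "\<lambda>z. g z / cmod (g z)" _ borel])
      (auto intro!: borel_measurable_continuous_onI continuous_intros)
  have sgn1: "cmod (sgn x) \<le> 1" for x :: complex by (simp add: norm_sgn)
  have h: "bdd_meas M h"
  proof (rule bdd_measI)
    show "h \<in> borel_measurable M" unfolding h_def by measurable
    show "cmod (h z) \<le> 1 * (B / \<delta>)" for z
    proof -
      have "\<phi> z / cmod (W z) \<le> B / \<delta>"
      proof (cases "cmod (W z) < \<delta>")
        case False
        then show ?thesis using \<phi> \<delta> B by (intro frac_le) auto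
      qed (use \<phi> \<delta> B in auto)
      then show ?thesis unfolding h_def norm_mult
        using sgn1 \<phi>(2) by (intro mult_mono) (auto simp del: of_real_divide)
    qed
  qed
  have "h z * g z = of_real (cmod (g z) / cmod (W z) * \<phi> z)" for z
  proof (cases "g z = 0")
    case False
    then have "cnj (sgn (g z)) * g z = of_real (cmod (g z))"
      by (simp add: sgn_eq complex_norm_square[symmetric] mult.commute power2_eq_square divide_simps)
    then show ?thesis by (simp add: h_def mult_ac)
  qed (simp add: h_def)
  then have "(\<integral>z. h z * g z \<partial>M) = of_real (\<integral>z. cmod (g z) / cmod (W z) * \<phi> z \<partial>M)"
    by (simp only: integral_complex_of_real)
  then have "(\<integral>z. cmod (g z) / cmod (W z) * \<phi> z \<partial>M) \<le> C * Lp_norm M p (\<lambda>z. W z * h z)"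
    using C[OF h] by simp
  also have "\<dots> \<le> C * Lp_norm M p (\<lambda>z. of_real (\<phi> z))"
  proof (intro mult_left_mono C0 Lp_norm_mono p)
    show "(\<lambda>z. complex_of_real (\<phi> z)) \<in> Lp_space M p"
      unfolding Lp_space_def using \<phi> p
      by (auto intro!: integrable_const_bound[of _ "B powr p"] powr_mono2 AE_I2)
    show "(\<lambda>z. W z * h z) \<in> borel_measurable M"
      by (rule Lp_spaceD(1)[OF Lp_space_mult_bdd[OF W h p]])
    show "cmod (W z * h z) \<le> cmod (of_real (\<phi> z))" for z
      using sgn1[of "g z"] \<phi>(2)[of z] mult_right_mono[OF sgn1 \<phi>(2), of "g z" z]
      by (cases "W z = 0") (auto simp: h_def norm_mult norm_divide)
  qed
  finally show ?thesis using \<phi>(2) by (simp add: Lp_norm_def)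
qed

text \<open>
  For \<open>p > 1\<close>, testing with the function that is extremal in Hoelder's inequality, cut off where \<open>W\<close> is
  small, bounds the norm of the truncated \<open>g / W\<close>, and monotone convergence removes the cut-off. For
  \<open>p = 1\<close>, indicators of sets on which \<open>g / W\<close> is large play the part of the extremal function.
\<close>

lemma (in finite_measure) bounded_functional_imp_ext_norm_finite:
  assumes W: "W \<in> Lp_space M p" and g: "bdd_meas M g" "AE z in M. g z \<noteq> 0"
    and p: "1 \<le> p" and q: "1 / ennreal p + 1 / q = 1"
    and b: "bounded_functional M p W g"
  shows "ext_norm q M (abs_ratio g W) < top"
proof -
  have p0: "0 < p" using p by simp
  note [measurable] = Lp_spaceD(1)[OF W] bdd_meas_measurable[OF g(1)]
  have nz: "AE z in M. W z \<noteq> 0"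
    by (rule bounded_functional_imp_nonzero[OF b g W])
  obtain C where C: "0 \<le> C"
      "\<And>h. bdd_meas M h \<Longrightarrow> cmod (\<integral>z. h z * g z \<partial>M) \<le> C * Lp_norm M p (\<lambda>z. W z * h z)"
    using b by (auto simp: bounded_functional_def)
  obtain B where B: "0 \<le> B" "\<And>z. cmod (g z) \<le> B" using bdd_measE[OF g(1)] by blast
  define G where "G z = cmod (g z) / cmod (W z)" for z
  have G0: "0 \<le> G z" for z by (simp add: G_def)
  have [measurable]: "G \<in> borel_measurable M" unfolding G_def [abs_def] by measurable
  define \<delta> where "\<delta> n = 1 / real (Suc n)" for n
  have \<delta>: "0 < \<delta> n" for n by (simp add: \<delta>_def)
  have \<delta>_ev: "\<exists>n. \<delta> n \<le> cmod (W z)" if "W z \<noteq> 0" for z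
    using reals_Archimedean[of "cmod (W z)"] that by (auto simp: \<delta>_def inverse_eq_divide intro: less_imp_le)
  have G_le: "G z \<le> B / \<delta> n" if "\<delta> n \<le> cmod (W z)" for n z
    unfolding G_def using that \<delta> B by (intro frac_le) auto
  have test: "(\<integral>z. G z * \<phi> z \<partial>M) \<le> C * (\<integral>z. \<phi> z powr p \<partial>M) powr (1 / p)"
    if "\<phi> \<in> borel_measurable M" "\<And>z. 0 \<le> \<phi> z" "\<And>z. \<phi> z \<le> K" "\<And>z. cmod (W z) < \<delta> n \<Longrightarrow> \<phi> z = 0"
    for \<phi> K n
    unfolding G_def by (rule bounded_functional_test[OF W g(1) p0 C(2) C(1) \<delta>[of n] that])
  from p q show ?thesis
  proof (cases rule: conjugate_exponent_cases)
    case 1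
    \<comment> \<open>testing with the indicator of the set \<open>{G \<ge> C + 1}\<close>, of measure \<open>m\<close>, gives \<open>(C + 1) m \<le> C m\<close>\<close>
    have "AE z in M. \<not> (\<delta> n \<le> cmod (W z) \<and> C + 1 \<le> G z)" for n
    proof -
      define E where "E = {z \<in> space M. \<delta> n \<le> cmod (W z) \<and> C + 1 \<le> G z}"
      have [measurable]: "E \<in> sets M" unfolding E_def by measurable
      have "(\<integral>z. G z * indicator E z \<partial>M) \<le> C * (\<integral>z. indicator E z powr p \<partial>M) powr (1 / p)"
        by (rule test[where K=1 and n=n]) (auto simp: E_def split: split_indicator)
      also have "\<dots> = C * measure M E" by (simp add: 1)
      finally have "(\<integral>z. G z * indicator E z \<partial>M) \<le> C * measure M E" .
      moreover have "(\<integral>z. (C + 1) * indicator E z \<partial>M) \<le> (\<integral>z. G z * indicator E z \<partial>M)"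
      proof (rule integral_mono)
        show "integrable M (\<lambda>z. G z * indicator E z)"
          using G_le[of n] G0 divide_nonneg_pos[OF B(1) \<delta>[of n]]
          by (intro integrable_const_bound[of _ "B / \<delta> n"] AE_I2)
             (auto simp: E_def split: split_indicator)
        show "integrable M (\<lambda>z. (C + 1) * indicator E z)"
          by (intro integrable_mult_right integrable_real_indicator) (auto simp: emeasure_eq_measure)
      qed (auto simp: E_def split: split_indicator)
      moreover have "(\<integral>z. (C + 1) * indicator E z \<partial>M) = (C + 1) * measure M E"
        by (subst integral_mult_right_zero) simp
      ultimately have "(C + 1) * measure M E \<le> C * measure M E" by linarith
      then have "measure M E = 0" using measure_nonneg[of M E] by (simp add: distrib_right)
      then have "AE z in M. z \<notin> E" by (intro AE_not_in null_setsI) (auto simp: emeasure_eq_measure)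
      then show ?thesis using AE_space by eventually_elim (auto simp: E_def)
    qed
    then have "AE z in M. \<forall>n. \<not> (\<delta> n \<le> cmod (W z) \<and> C + 1 \<le> G z)"
      unfolding AE_all_countable by blast
    then have "AE z in M. abs_ratio g W z \<le> ennreal (C + 1)"
      using nz
    proof eventually_elim
      case (elim z)
      then have "G z \<le> C + 1" using \<delta>_ev[of z] by force
      then show ?case using elim C(1) by (simp add: abs_ratio_eq G_def ennreal_leI del: ennreal_plus)
    qed
    then have "esssup M (abs_ratio g W) \<le> ennreal (C + 1)" by (subst esssup_le_iff) auto
    then show ?thesis unfolding 1 ext_norm_top by (rule order.strict_trans1) simp
  next
    case (2 r)
    have r: "(r - 1) * p = r" "1 / r = 1 - 1 / p" unfolding 2(4) using 2(1) by (auto simp: field_simps)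
    define A where "A n z = (if \<delta> n \<le> cmod (W z) then 1 else 0 :: real)" for n z
    have [measurable]: "A n \<in> borel_measurable M" for n unfolding A_def [abs_def] by measurable
    have GA: "A n z * G z powr r \<le> (B / \<delta> n) powr r" "0 \<le> A n z * G z powr r" for n z
      using G_le[of n z] G0[of z] 2 by (auto simp: A_def intro!: powr_mono2)
    \<comment> \<open>testing with \<open>G\<^sup>r\<^sup>-\<^sup>1\<close> bounds this integral by \<open>C\<close> times its own power \<open>1/p\<close>\<close>
    have bound: "(\<integral>z. A n z * G z powr r \<partial>M) \<le> C powr r" for n
    proof -
      define I where "I = (\<integral>z. A n z * G z powr r \<partial>M)"
      have I0: "0 \<le> I" unfolding I_def using GA(2) by (simp add: integral_nonneg_AE)
      have "(\<integral>z. G z * (A n z * G z powr (r - 1)) \<partial>M)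
          \<le> C * (\<integral>z. (A n z * G z powr (r - 1)) powr p \<partial>M) powr (1 / p)"
      proof (rule test[where n=n])
        show "A n z * G z powr (r - 1) \<le> (B / \<delta> n) powr (r - 1)" for z
          using G_le[of n z] G0[of z] 2 by (auto simp: A_def intro!: powr_mono2)
      qed (auto simp: A_def)
      moreover have "G z * (A n z * G z powr (r - 1)) = A n z * G z powr r" for z
        using G0[of z] by (cases "G z = 0") (auto simp: powr_diff)
      moreover have "(A n z * G z powr (r - 1)) powr p = A n z * G z powr r" for z
        using r(1) by (simp add: A_def powr_powr)
      ultimately have "I \<le> C * I powr (1 / p)" by (simp add: I_def)
      have "I powr (1 / r) \<le> C"
      proof (cases "I = 0")
        case False
        then have pos: "0 < I powr (1 / p)" by simp
        have "I powr (1 / r) * I powr (1 / p) = I"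
          using False I0 by (simp add: r(2) powr_diff)
        then have "I powr (1 / r) * I powr (1 / p) \<le> C * I powr (1 / p)"
          using \<open>I \<le> C * I powr (1 / p)\<close> by simp
        then show ?thesis using pos by (rule mult_right_le_imp_le)
      qed (use C in simp)
      then have "(I powr (1 / r)) powr r \<le> C powr r" using 2 by (intro powr_mono2) auto
      then show ?thesis using 2 I0 by (simp add: powr_powr I_def)
    qed
    have "(\<integral>\<^sup>+ z. ennreal_powr (abs_ratio g W z) r \<partial>M) = (\<integral>\<^sup>+ z. (SUP n. ennreal (A n z * G z powr r)) \<partial>M)"
    proof (rule nn_integral_cong_AE, use nz in eventually_elim)
      case (elim z)
      obtain m where m: "\<delta> m \<le> cmod (W z)" using \<delta>_ev[OF elim] by blast
      have "(SUP n. ennreal (A n z * G z powr r)) = ennreal (G z powr r)"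
      proof (rule antisym)
        show "(SUP n. ennreal (A n z * G z powr r)) \<le> ennreal (G z powr r)"
          by (intro SUP_least ennreal_leI) (auto simp: A_def)
        show "ennreal (G z powr r) \<le> (SUP n. ennreal (A n z * G z powr r))"
          by (rule SUP_upper2[of m]) (use m in \<open>auto simp: A_def\<close>)
      qed
      then show ?case using elim by (simp add: abs_ratio_eq G_def ennreal_powr_ennreal)
    qed
    also have "\<dots> = (SUP n. (\<integral>\<^sup>+ z. ennreal (A n z * G z powr r) \<partial>M))"
    proof (rule nn_integral_monotone_convergence_SUP)
      have "\<delta> (Suc n) \<le> \<delta> n" for n by (simp add: \<delta>_def field_simps)
      then show "incseq (\<lambda>n z. ennreal (A n z * G z powr r))"
        by (intro incseq_SucI le_funI ennreal_leI) (auto simp: A_def intro: order_trans)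
    qed measurable
    also have "\<dots> \<le> ennreal (C powr r)"
    proof (rule SUP_least)
      fix n
      have "(\<integral>\<^sup>+ z. ennreal (A n z * G z powr r) \<partial>M) = ennreal (\<integral>z. A n z * G z powr r \<partial>M)"
        using GA by (intro nn_integral_eq_integral integrable_const_bound[of _ "(B / \<delta> n) powr r"]) auto
      then show "(\<integral>\<^sup>+ z. ennreal (A n z * G z powr r) \<partial>M) \<le> ennreal (C powr r)"
        using bound by (simp add: ennreal_leI)
    qed
    finally have "(\<integral>\<^sup>+ z. ennreal_powr (abs_ratio g W z) r \<partial>M) < top"
      by (rule order.strict_trans1) simp
    then show ?thesis using 2 by (simp add: ext_norm_real ennreal_powr_less_top_iff)
  qed
qed

section \<open>Approximation by trigonometric polynomials\<close>

lemma trig_poly_mult: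
  fixes e :: "'i::ab_group_add \<Rightarrow> 'a \<Rightarrow> complex"
  assumes add: "\<And>i j z. e (i + j) z = e i z * e j z"
    and "trig_poly e UNIV S" "trig_poly e UNIV T"
  shows "trig_poly e UNIV (\<lambda>z. S z * T z)"
proof -
  obtain F c where F: "finite F" "S = (\<lambda>z. \<Sum>j\<in>F. c j * e j z)"
    using assms(2) by (auto simp: trig_poly_def)
  obtain G d where G: "finite G" "T = (\<lambda>z. \<Sum>j\<in>G. d j * e j z)"
    using assms(3) by (auto simp: trig_poly_def)
  have "S z * T z = (\<Sum>i\<in>F. \<Sum>j\<in>G. (c i * d j) * e (i + j) z)" for z
    unfolding F(2) G(2) sum_product by (simp add: add mult_ac)
  moreover have "trig_poly e UNIV (\<lambda>z. \<Sum>i\<in>F. \<Sum>j\<in>G. (c i * d j) * e (i + j) z)"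
    by (intro trig_poly_sum F(1) G(1) trig_poly_basis UNIV_I)
  ultimately show ?thesis by simp
qed

text \<open>
  Polynomials in the real coordinates of a point of the circle, or of a pair of such points, are
  trigonometric polynomials, since the coordinates are and since characters multiply to characters.
\<close>

lemma polynomial_imp_trig_poly:
  fixes e :: "'i::ab_group_add \<Rightarrow> 'a \<Rightarrow> complex" and E :: "'a \<Rightarrow> 'b::euclidean_space"
  assumes add: "\<And>i j z. e (i + j) z = e i z * e j z" and zero: "\<And>z. e 0 z = 1"
    and comp: "\<And>b. b \<in> Basis \<Longrightarrow> trig_poly e UNIV (\<lambda>z. complex_of_real (E z \<bullet> b))"
    and q: "polynomial_function (q :: 'b \<Rightarrow> complex)"
  shows "trig_poly e UNIV (\<lambda>z. q (E z))"
proof -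
  have const: "trig_poly e UNIV (\<lambda>z. c)" for c
    using trig_poly_basis[of 0 UNIV e c] by (simp add: zero)
  have real: "trig_poly e UNIV (\<lambda>z. complex_of_real (r (E z)))" if "real_polynomial_function r" for r
    using that
  proof induction
    case (linear f)
    have "f (E z) = (\<Sum>b\<in>Basis. f b * (E z \<bullet> b))" for z
    proof -
      interpret bounded_linear f by fact
      have "f (E z) = f (\<Sum>b\<in>Basis. (E z \<bullet> b) *\<^sub>R b)" by (simp only: euclidean_representation)
      then show ?thesis by (simp add: sum scaleR mult.commute)
    qed
    then have "complex_of_real (f (E z)) = (\<Sum>b\<in>Basis. of_real (f b) * of_real (E z \<bullet> b))" for z
      by simp
    then show ?case by (simp only:) (intro trig_poly_sum finite_Basis trig_poly_scale comp)
  qed (simp_all add: const trig_poly_add trig_poly_mult[OF add])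
  have "real_polynomial_function (\<lambda>x. Re (q x))" "real_polynomial_function (\<lambda>x. Im (q x))"
    using q bounded_linear_Re bounded_linear_Im by (auto simp: polynomial_function_def o_def)
  then have "trig_poly e UNIV (\<lambda>z. of_real (Re (q (E z))) + \<i> * of_real (Im (q (E z))))"
    by (intro trig_poly_add trig_poly_scale real)
  then show ?thesis by (simp add: complex_eq[symmetric])
qed

text \<open>
  A measurable function is an almost everywhere limit of continuous functions on the fundamental
  domain. These need not be periodic, that is, they need not factor through \<open>E\<close>. On a compact set
  \<open>K n\<close> where \<open>E\<close> is injective they do; Tietze's theorem extends the factor to the whole range
  without increasing its bound, and the Stone-Weierstrass theorem replaces it by a polynomial.
\<close>

lemma bounded_trig_approximation:
  fixes E :: "'a::euclidean_space \<Rightarrow> 'b::euclidean_space"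
    and e :: "'i::ab_group_add \<Rightarrow> 'a \<Rightarrow> complex"
  assumes S: "S \<in> sets lebesgue"
    and E: "continuous_on UNIV E" "bounded (range E)"
    and K: "\<And>n. compact (K n)" "\<And>n. inj_on E (K n)"
      "AE z in lebesgue_on S. \<forall>\<^sub>F n in sequentially. z \<in> K n"
    and add: "\<And>i j z. e (i + j) z = e i z * e j z" and zero: "\<And>z. e 0 z = 1"
    and comp: "\<And>b. b \<in> Basis \<Longrightarrow> trig_poly e UNIV (\<lambda>z. complex_of_real (E z \<bullet> b))"
    and h: "bdd_meas (lebesgue_on S) h"
  shows "\<exists>T B. (\<forall>n. trig_poly e UNIV (T n)) \<and> (\<forall>n z. cmod (T n z) \<le> B) \<and>
    (AE z in lebesgue_on S. (\<lambda>n. T n z) \<longlonglongrightarrow> h z)"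
proof -
  obtain B where B: "0 \<le> B" "\<And>z. cmod (h z) \<le> B" using bdd_measE[OF h] by blast
  have "h measurable_on S"
    unfolding measurable_on_UNIV[of S h, symmetric]
    by (intro lebesgue_measurable_imp_measurable_on borel_measurable_if_I bdd_meas_measurable[OF h] S) auto
  then obtain N g where N: "negligible N" and g: "\<And>n. continuous_on UNIV (g n)"
      and lim: "\<And>x. x \<notin> N \<Longrightarrow> (\<lambda>n. g n x) \<longlonglongrightarrow> (if x \<in> S then h x else 0)"
    unfolding measurable_on_def by blast
  \<comment> \<open>projecting the continuous approximants to the disc of radius \<open>B\<close> makes them uniformly bounded\<close>
  let ?cp = "closest_point (cball (0::complex) B)"
  have cp: "continuous_on UNIV ?cp" "\<And>x. cmod (?cp x) \<le> B"
    using B(1) closest_point_in_set[of "cball (0::complex) B"]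
    by (auto intro!: continuous_on_closest_point)
  have "\<exists>T. trig_poly e UNIV T \<and> (\<forall>z. cmod (T z) \<le> B + 1) \<and>
      (\<forall>z\<in>K n. cmod (?cp (g n z) - T z) < 1 / real (Suc n))" for n
  proof -
    define f where "f y = ?cp (g n (inv_into (K n) E y))" for y
    have "continuous_on (E ` K n) (inv_into (K n) E)"
      using K(1,2)[of n] E(1) by (intro continuous_on_inv continuous_on_subset[OF E(1)]) auto
    then have "continuous_on (E ` K n) f"
      unfolding f_def
      by (intro continuous_on_compose2[OF cp(1)] continuous_on_compose2[OF g]) auto
    moreover have "closedin (top_of_set UNIV) (E ` K n)"
      using compact_imp_closed[OF compact_continuous_image[OF continuous_on_subset[OF E(1)] K(1)]] by auto
    ultimately obtain f' where f': "continuous_on UNIV f'" "\<And>y. y \<in> E ` K n \<Longrightarrow> f' y = f y"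
        "\<And>y. cmod (f' y) \<le> B"
    proof (rule Tietze[OF _ _ B(1)])
      show "cmod (f y) \<le> B" for y unfolding f_def by (rule cp(2))
    qed auto
    have "compact (closure (range E))" using E(2) by (simp add: compact_closure)
    then obtain q where "polynomial_function q"
        and close: "\<And>y. y \<in> closure (range E) \<Longrightarrow> cmod (f' y - q y) < 1 / real (Suc n)"
      using Stone_Weierstrass_polynomial_function[of "closure (range E)" f' "1 / real (Suc n)"]
        continuous_on_subset[OF f'(1)] by auto
    have q: "polynomial_function q" "\<And>z. cmod (f' (E z) - q (E z)) < 1 / real (Suc n)"
      using \<open>polynomial_function q\<close> close closure_subset[of "range E"] by auto
    have "cmod (q (E z)) \<le> B + 1" for z
    proof -
      have "cmod (q (E z)) \<le> cmod (f' (E z)) + cmod (f' (E z) - q (E z))"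
        by (metis norm_minus_commute norm_triangle_sub)
      moreover have "1 / real (Suc n) \<le> 1" by simp
      ultimately show ?thesis using f'(3)[of "E z"] q(2)[of z] by linarith
    qed
    moreover have "cmod (?cp (g n z) - q (E z)) < 1 / real (Suc n)" if "z \<in> K n" for z
      using q(2)[of z] f'(2)[of "E z"] that K(2)[of n] by (simp add: f_def)
    moreover have "trig_poly e UNIV (\<lambda>z. q (E z))"
      by (rule polynomial_imp_trig_poly[where E = E, OF add zero comp q(1)])
    ultimately show ?thesis by (intro exI[of _ "\<lambda>z. q (E z)"]) blast
  qed
  then obtain T where T: "\<And>n. trig_poly e UNIV (T n)" "\<And>n z. cmod (T n z) \<le> B + 1"
      "\<And>n z. z \<in> K n \<Longrightarrow> cmod (?cp (g n z) - T n z) < 1 / real (Suc n)"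
    by metis
  have "AE z in lebesgue. z \<notin> N"
    using N by (intro AE_not_in) (simp add: negligible_iff_null_sets)
  then have "AE z in lebesgue_on S. z \<notin> N \<and> z \<in> S"
    using S by (subst AE_restrict_space_iff) auto
  then have "AE z in lebesgue_on S. (\<lambda>n. T n z) \<longlonglongrightarrow> h z"
    using K(3)
  proof eventually_elim
    case (elim z)
    have "(\<lambda>n. ?cp (g n z)) \<longlonglongrightarrow> ?cp (h z)"
      using lim[of z] elim by (intro continuous_on_tendsto_compose[OF cp(1)]) auto
    also have "?cp (h z) = h z" using B(2) by (intro closest_point_self) auto
    finally have 1: "(\<lambda>n. ?cp (g n z)) \<longlonglongrightarrow> h z" .
    have "\<forall>\<^sub>F n in sequentially. norm (?cp (g n z) - T n z) \<le> 1 / real (Suc n)"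
      using elim(2) by eventually_elim (rule less_imp_le[OF T(3)])
    then have "(\<lambda>n. ?cp (g n z) - T n z) \<longlonglongrightarrow> 0"
      using LIMSEQ_inverse_real_of_nat[unfolded inverse_eq_divide] by (rule Lim_null_comparison)
    from tendsto_diff[OF 1 this] show ?case by simp
  qed
  with T show ?thesis by blast
qed

section \<open>Slices of functions on the torus\<close>

lemma space_circle [simp]: "space circle = {0..<2*pi}"
  by (simp add: circle_def)

lemma space_torus [simp]: "space torus = {0..<2*pi} \<times> {0..<2*pi}"
  by (simp add: torus_def)

lemma AE_circle_iff: "(AE x in circle. P x) \<longleftrightarrow> (AE x in lborel. x \<in> {0..<2*pi} \<longrightarrow> P x)"
  unfolding circle_def by (subst AE_restrict_space_iff) (auto simp: AE_completion_iff)

lemma square_sets_lborel: "{0..<2*pi} \<times> {0..<2*pi} \<in> sets (lborel :: (real \<times> real) measure)"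
  by (simp add: borel_Times)

lemma square_sets_lebesgue: "{0..<2*pi} \<times> {0..<2*pi} \<in> sets (lebesgue :: (real \<times> real) measure)"
  using square_sets_lborel by simp

lemma AE_torus_iff:
  "(AE z in torus. P z) \<longleftrightarrow> (AE z in lborel. z \<in> {0..<2*pi} \<times> {0..<2*pi} \<longrightarrow> P z)"
  unfolding torus_def using square_sets_lebesgue
  by (subst AE_restrict_space_iff) (simp_all only: AE_completion_iff space_completion space_lborel space_borel Int_UNIV_right)

lemma nn_integral_circle: "(\<integral>\<^sup>+ x. f x \<partial>circle) = (\<integral>\<^sup>+ x. f x * indicator {0..<2*pi} x \<partial>lborel)"
  unfolding circle_def by (subst nn_integral_restrict_space) (auto simp: nn_integral_completion)

lemma nn_integral_torus:
  "(\<integral>\<^sup>+ z. f z \<partial>torus) = (\<integral>\<^sup>+ z. f z * indicator ({0..<2*pi} \<times> {0..<2*pi}) z \<partial>lborel)"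
  unfolding torus_def using square_sets_lebesgue
  by (subst nn_integral_restrict_space) (simp_all only: nn_integral_completion space_completion space_lborel space_borel Int_UNIV_right)

lemma measurable_circle: "f \<in> borel_measurable borel \<Longrightarrow> f \<in> borel_measurable circle"
  unfolding circle_def by (intro measurable_restrict_space1 measurable_completion) auto

lemma measurable_torus: "f \<in> borel_measurable borel \<Longrightarrow> f \<in> borel_measurable torus"
  unfolding torus_def by (intro measurable_restrict_space1 measurable_completion) auto

lemma nn_integral_torus_iterated:
  assumes "f \<in> borel_measurable borel"
  shows "(\<integral>\<^sup>+ z. f z \<partial>torus) = (\<integral>\<^sup>+ x. \<integral>\<^sup>+ y. f (x, y) \<partial>circle \<partial>circle)"
proof -
  let ?I = "{0..<2*pi}"
  have "(\<lambda>z. f z * indicator (?I \<times> ?I) z) \<in> borel_measurable (lborel \<Otimes>\<^sub>M lborel)"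
    using assms square_sets_lborel by (simp add: lborel_prod)
  from lborel.nn_integral_fst[OF this]
  have "(\<integral>\<^sup>+ z. f z \<partial>torus) = (\<integral>\<^sup>+ x. \<integral>\<^sup>+ y. f (x, y) * indicator (?I \<times> ?I) (x, y) \<partial>lborel \<partial>lborel)"
    by (simp add: lborel_prod nn_integral_torus)
  also have "\<dots> = (\<integral>\<^sup>+ x. (\<integral>\<^sup>+ y. f (x, y) * indicator ?I y \<partial>lborel) * indicator ?I x \<partial>lborel)"
    by (intro nn_integral_cong) (auto simp: indicator_def)
  finally show ?thesis by (simp add: nn_integral_circle)
qed

lemma measurable_nn_integral_slice:
  fixes f :: "real \<times> real \<Rightarrow> ennreal"
  assumes "f \<in> borel_measurable borel"
  shows "(\<lambda>x. \<integral>\<^sup>+ y. f (x, y) \<partial>circle) \<in> borel_measurable borel"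
proof -
  have [measurable]: "f \<in> borel_measurable (borel \<Otimes>\<^sub>M borel)"
    using assms by (simp add: borel_prod)
  show ?thesis
    unfolding nn_integral_circle
    by (subst measurable_cong_sets[of borel lborel borel borel], simp, simp) measurable
qed

lemma AE_torus_slices:
  assumes "AE z in torus. P z"
  shows "AE x in circle. AE y in circle. P (x, y)"
proof -
  let ?I = "{0..<2*pi}"
  have "AE z in lborel \<Otimes>\<^sub>M lborel. z \<in> ?I \<times> ?I \<longrightarrow> P z"
    unfolding lborel_prod using assms unfolding AE_torus_iff .
  from lborel_pair.AE_pair[OF this] have "AE x in lborel. AE y in lborel. (x, y) \<in> ?I \<times> ?I \<longrightarrow> P (x, y)" .
  then show ?thesis unfolding AE_circle_iff by eventually_elim auto
qed

text \<open>
  Only Borel sets are allowed here: a set can have only null slices without being measurable.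
\<close>

lemma AE_torus_slices_iff:
  fixes P :: "real \<times> real \<Rightarrow> bool"
  assumes "{z. P z} \<in> sets borel"
  shows "(AE z in torus. P z) \<longleftrightarrow> (AE x in circle. AE y in circle. P (x, y))"
proof
  let ?I = "{0..<2*pi}"
  assume "AE x in circle. AE y in circle. P (x, y)"
  then have *: "AE x in lborel. AE y in lborel. (x, y) \<in> ?I \<times> ?I \<longrightarrow> P (x, y)"
    unfolding AE_circle_iff by eventually_elim auto
  have "{z. z \<in> ?I \<times> ?I \<longrightarrow> P z} = (UNIV - ?I \<times> ?I) \<union> {z. P z}" by auto
  also have "\<dots> \<in> sets lborel" using assms square_sets_lborel by auto
  finally have "AE z in lborel \<Otimes>\<^sub>M lborel. z \<in> ?I \<times> ?I \<longrightarrow> P z"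
    using * by (intro lborel_pair.AE_pair_measure) (simp_all only: lborel_prod space_lborel space_borel UNIV_I simp_thms)
  then show "AE z in torus. P z" unfolding lborel_prod AE_torus_iff .
qed (rule AE_torus_slices)

lemma lebesgue_on_measurable_AE:
  fixes f g :: "'a::euclidean_space \<Rightarrow> 'b::euclidean_space"
  assumes S: "S \<in> sets lebesgue" and f: "f \<in> borel_measurable (lebesgue_on S)"
    and ae: "AE x in lebesgue_on S. f x = g x"
  shows "g \<in> borel_measurable (lebesgue_on S)"
proof -
  let ?r = "\<lambda>f x. if x \<in> S then f x else (0 :: 'b)"
  have "?r f \<in> borel_measurable lebesgue" using f S by (rule borel_measurable_if_I)
  moreover have "AE x in lebesgue. x \<in> S \<longrightarrow> f x = g x"
    using ae S by (subst (asm) AE_restrict_space_iff) auto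
  then have "AE x in lebesgue. ?r f x = ?r g x" by eventually_elim auto
  ultimately have "?r g \<in> borel_measurable lebesgue" by (rule borel_measurable_AE)
  then show ?thesis by (rule borel_measurable_if_D)
qed

lemma circle_measurable_AE:
  fixes f g :: "real \<Rightarrow> 'b::euclidean_space"
  assumes "f \<in> borel_measurable circle" "AE x in circle. f x = g x"
  shows "g \<in> borel_measurable circle"
  unfolding circle_def
  by (rule lebesgue_on_measurable_AE[OF _ assms[unfolded circle_def]]) simp

lemma torus_measurable_AE:
  fixes f g :: "real \<times> real \<Rightarrow> 'b::euclidean_space"
  assumes "f \<in> borel_measurable torus" "AE z in torus. f z = g z"
  shows "g \<in> borel_measurable torus"
  unfolding torus_def
  by (rule lebesgue_on_measurable_AE[OF square_sets_lebesgue assms[unfolded torus_def]])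

lemma finite_measure_circle: "finite_measure circle"
  unfolding circle_def by (rule finite_measure_lebesgue_on) (auto intro!: bounded_set_imp_lmeasurable)

lemma emeasure_circle: "emeasure circle {0..<2*pi} = ennreal (2 * pi)"
  unfolding circle_def by (subst emeasure_restrict_space) auto

lemma finite_measure_torus: "finite_measure torus"
  unfolding torus_def using square_sets_lebesgue
  by (intro finite_measure_lebesgue_on bounded_set_imp_lmeasurable bounded_Times) auto

lemma AE_circle_not_False: "\<not> (AE x in circle. False)"
  using emeasure_circle by (subst AE_iff_measurable[of "{0..<2*pi}"])
    (auto simp: circle_def sets_restrict_space_iff)

text \<open>
  For \<open>q = \<infinity>\<close>, the slices on which \<open>F \<le> c\<close> almost everywhere are those on which the indicator of
  \<open>{F > c}\<close> has integral zero, which reduces the claim to Tonelli's theorem.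
\<close>

lemma ext_norm_slice_measurable:
  fixes F :: "real \<times> real \<Rightarrow> ennreal"
  assumes F: "F \<in> borel_measurable borel" and q: "q \<noteq> 0"
  shows "(\<lambda>x. ext_norm q circle (\<lambda>y. F (x, y))) \<in> borel_measurable borel"
proof (cases q)
  case (real r)
  then have r: "0 < r" using q by (cases "r = 0") auto
  show ?thesis
    unfolding real ext_norm_real[OF r]
    using F by (intro borel_measurable_ennreal_powr
        measurable_nn_integral_slice[of "\<lambda>z. ennreal_powr (F z) r"])
next
  case top
  have slice: "(\<lambda>y. F (x, y)) \<in> borel_measurable borel" for x
    by (rule measurable_compose[OF _ F]) (auto intro!: borel_measurable_continuous_onI continuous_intros)
  have "(\<lambda>x. esssup circle (\<lambda>y. F (x, y))) \<in> borel_measurable borel"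
  proof (rule borel_measurableI_le)
    fix c :: ennreal
    let ?k = "\<lambda>z. indicator {z. c < F z} z :: ennreal"
    have set: "{z. c < F z} \<in> sets borel" using F by measurable
    have "esssup circle (\<lambda>y. F (x, y)) \<le> c \<longleftrightarrow> (\<integral>\<^sup>+ y. ?k (x, y) \<partial>circle) = 0" for x
    proof -
      have "(\<lambda>y. ?k (x, y)) \<in> borel_measurable borel"
        using slice[of x] by (auto simp: indicator_def intro!: measurable_If borel_measurable_less)
      then show ?thesis
        using slice[of x]
        by (subst esssup_le_iff) (auto simp: nn_integral_0_iff_AE measurable_circle indicator_def not_less)
    qed
    moreover have "(\<lambda>x. \<integral>\<^sup>+ y. ?k (x, y) \<partial>circle) \<in> borel_measurable borel"
      using set by (intro measurable_nn_integral_slice) simp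
    ultimately show "{x \<in> space borel. esssup circle (\<lambda>y. F (x, y)) \<le> c} \<in> sets borel"
      by simp
  qed
  then show ?thesis by (simp add: top ext_norm_def)
qed

lemma ext_norm_torus_iterated:
  assumes F: "F \<in> borel_measurable borel" and q: "q \<noteq> 0"
  shows "ext_norm q torus F = ext_norm q circle (\<lambda>x. ext_norm q circle (\<lambda>y. F (x, y)))"
proof (cases q)
  case (real r)
  then have r: "0 < r" using q by (cases "r = 0") auto
  have "(\<integral>\<^sup>+ z. ennreal_powr (F z) r \<partial>torus) = (\<integral>\<^sup>+ x. \<integral>\<^sup>+ y. ennreal_powr (F (x, y)) r \<partial>circle \<partial>circle)"
    by (rule nn_integral_torus_iterated) (use F in measurable)
  then show ?thesis using r by (simp add: real ext_norm_real ennreal_powr_powr)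
next
  case top
  have slice: "(\<lambda>y. F (x, y)) \<in> borel_measurable borel" for x
    by (rule measurable_compose[OF _ F]) (auto intro!: borel_measurable_continuous_onI continuous_intros)
  have *: "(\<lambda>x. esssup circle (\<lambda>y. F (x, y))) \<in> borel_measurable borel"
    using ext_norm_slice_measurable[OF F, of top] by (simp add: ext_norm_def)
  have "esssup torus F \<le> c \<longleftrightarrow> esssup circle (\<lambda>x. esssup circle (\<lambda>y. F (x, y))) \<le> c" for c
  proof -
    have "{z. F z \<le> c} \<in> sets borel" using F by measurable
    then show ?thesis
      using F * slice
      by (simp add: esssup_le_iff measurable_circle measurable_torus AE_torus_slices_iff)
  qed
  then have "esssup torus F = esssup circle (\<lambda>x. esssup circle (\<lambda>y. F (x, y)))"
    by (meson antisym order_refl)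
  then show ?thesis by (simp add: top ext_norm_def)
qed

text \<open>
  A slice of a Lebesgue measurable function may fail to be measurable. Passing to a Borel
  representative confines this to a null set of slices.
\<close>

lemma torus_borel_representative:
  fixes m :: "real \<times> real \<Rightarrow> real"
  assumes "m \<in> borel_measurable torus"
  obtains m' where "m' \<in> borel_measurable borel" "AE z in torus. m z = m' z"
    "AE x in circle. (\<lambda>y. m (x, y)) \<in> borel_measurable circle \<and> (AE y in circle. m (x, y) = m' (x, y))"
proof -
  let ?I = "{0..<2*pi}"
  have "(\<lambda>z. if z \<in> ?I \<times> ?I then m z else 0) \<in> borel_measurable lebesgue"
    using assms square_sets_lebesgue unfolding torus_def by (rule borel_measurable_if_I)
  from completion_ex_borel_measurable_real[OF this]
  obtain m' where m': "m' \<in> borel_measurable borel"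
      "AE z in lborel. (if z \<in> ?I \<times> ?I then m z else 0) = m' z"
    by auto
  from m'(2) have ae: "AE z in torus. m z = m' z"
    unfolding AE_torus_iff by eventually_elim (auto split: if_splits)
  from AE_torus_slices[OF this]
  have "AE x in circle. (\<lambda>y. m (x, y)) \<in> borel_measurable circle \<and> (AE y in circle. m (x, y) = m' (x, y))"
  proof eventually_elim
    case (elim x)
    have m'x: "(\<lambda>y. m' (x, y)) \<in> borel_measurable borel"
      by (rule measurable_compose[OF _ m'(1)]) (auto intro!: borel_measurable_continuous_onI continuous_intros)
    have "(\<lambda>y. m (x, y)) \<in> borel_measurable circle"
      by (rule circle_measurable_AE[OF measurable_circle[OF m'x]]) (use elim in \<open>auto elim: AE_mp\<close>)
    with elim show ?case by simp
  qed
  with m' ae show thesis using that by blast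
qed

section \<open>The characters of the circle and of the torus\<close>

definition circle_char :: "int \<Rightarrow> real \<Rightarrow> complex"
  where "circle_char n t = exp (\<i> * of_int n * of_real t)"

definition torus_char :: "int \<times> int \<Rightarrow> real \<times> real \<Rightarrow> complex"
  where "torus_char = (\<lambda>(k, m) (x, y). circle_char k x * circle_char m y)"

lemma circle_char_add: "circle_char (k + m) t = circle_char k t * circle_char m t"
  by (simp add: circle_char_def exp_add[symmetric] algebra_simps)

lemma circle_char_0 [simp]: "circle_char 0 t = 1"
  by (simp add: circle_char_def)

lemma cmod_circle_char [simp]: "cmod (circle_char n t) = 1"
  using norm_exp_i_times[of "of_int n * t"] by (simp add: circle_char_def mult.assoc)

lemma continuous_on_circle_char: "continuous_on A (circle_char n)"
  unfolding circle_char_def by (intro continuous_intros)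

lemma borel_measurable_circle_char: "circle_char n \<in> borel_measurable borel"
  by (intro borel_measurable_continuous_onI continuous_on_circle_char)

lemma torus_char_add: "torus_char (i + j) z = torus_char i z * torus_char j z"
  by (cases i; cases j; cases z) (simp add: torus_char_def circle_char_add)

lemma torus_char_0: "torus_char 0 z = 1"
  by (cases z) (simp add: torus_char_def zero_prod_def)

lemma torus_char_eq: "torus_char (k, m) z = circle_char k (fst z) * circle_char m (snd z)"
  by (cases z) (simp add: torus_char_def)

lemma cmod_torus_char: "cmod (torus_char i z) = 1"
  by (cases i; cases z) (simp add: torus_char_def norm_mult)

lemma continuous_on_torus_char: "continuous_on A (torus_char i)"
  by (cases i) (auto simp: torus_char_def circle_char_def case_prod_unfold intro!: continuous_intros)

lemma borel_measurable_torus_char: "torus_char i \<in> borel_measurable borel"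
  by (intro borel_measurable_continuous_onI continuous_on_torus_char)

text \<open>
  Two solutions of \<open>e\<^sub>n(t) = c\<close> differ by a multiple of \<open>2\<pi>/n\<close>, so there are only countably many.
\<close>

lemma circle_char_AE_neq:
  assumes n: "n \<noteq> 0"
  shows "AE t in circle. circle_char n t \<noteq> c"
proof -
  have "countable {t. circle_char n t = c}"
  proof (cases "\<exists>s. circle_char n s = c")
    case True
    then obtain s where s: "circle_char n s = c" by blast
    have "{t. circle_char n t = c} \<subseteq> range (\<lambda>k::int. s + 2 * of_int k * pi / of_int n)"
    proof
      fix t assume "t \<in> {t. circle_char n t = c}"
      then have "exp (\<i> * of_int n * of_real t) = exp (\<i> * of_int n * of_real s)"
        using s by (simp add: circle_char_def)
      then obtain k :: int where "\<i> * of_int n * of_real t = \<i> * of_int n * of_real s + (of_int (2 * k) * pi) * \<i>"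
        unfolding exp_eq by blast
      from arg_cong[OF this, of Im] have "of_int n * t = of_int n * s + 2 * of_int k * pi" by simp
      then have "t = s + 2 * of_int k * pi / of_int n" using n by (simp add: field_simps)
      then show "t \<in> range (\<lambda>k::int. s + 2 * of_int k * pi / of_int n)" by blast
    qed
    then show ?thesis by (rule countable_subset) auto
  qed auto
  then have "AE t in lborel. t \<notin> {t. circle_char n t = c}"
    by (intro AE_not_in countable_imp_null_set_lborel)
  then show ?thesis unfolding AE_circle_iff by eventually_elim auto
qed

lemma AE_torus_fst:
  assumes "AE x in circle. P x" "{x. P x} \<in> sets borel"
  shows "AE z in torus. P (fst z)"
proof -
  have "{z :: real \<times> real. P (fst z)} = fst -` {x. P x}" by auto
  also have "\<dots> \<in> sets borel"
    by (intro measurable_sets_borel[OF borel_measurable_continuous_onI assms(2)] continuous_intros)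
  finally show ?thesis using assms by (subst AE_torus_slices_iff) auto
qed

lemma AE_torus_snd:
  assumes "AE x in circle. P x" "{x. P x} \<in> sets borel"
  shows "AE z in torus. P (snd z)"
proof -
  have "{z :: real \<times> real. P (snd z)} = snd -` {x. P x}" by auto
  also have "\<dots> \<in> sets borel"
    by (intro measurable_sets_borel[OF borel_measurable_continuous_onI assms(2)] continuous_intros)
  finally show ?thesis using assms by (subst AE_torus_slices_iff) auto
qed

lemma integral_circle_char:
  assumes n: "n \<noteq> 0"
  shows "(\<integral>t. circle_char n t \<partial>circle) = 0"
proof -
  define F where "F t = exp (\<i> * of_int n * of_real t) / (\<i> * of_int n)" for t :: real
  have "(F has_vector_derivative circle_char n t) (at t within {0..2*pi})" for t
  proof -
    have "((\<lambda>z. exp (\<i> * of_int n * z) / (\<i> * of_int n)) has_field_derivative circle_char n t) (at (of_real t))"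
      using n by (auto intro!: derivative_eq_intros simp: circle_char_def)
    from has_vector_derivative_real_field[OF this] show ?thesis
      unfolding F_def by (rule has_vector_derivative_at_within)
  qed
  then have "(circle_char n has_integral (F (2*pi) - F 0)) {0..2*pi}"
    by (intro fundamental_theorem_of_calculus) auto
  moreover have "F (2*pi) = F 0"
  proof -
    have "exp (\<i> * of_int n * of_real (2 * pi)) = exp (\<i> * of_int n * of_real 0)"
      unfolding exp_eq by (rule exI[of _ n]) simp
    then show ?thesis unfolding F_def by simp
  qed
  ultimately have "(circle_char n has_integral 0) {0..2*pi}" by simp
  moreover have "(circle_char n has_integral 0) {0..<2*pi} \<longleftrightarrow> (circle_char n has_integral 0) {0..2*pi}"
    by (rule has_integral_spike_set_eq; rule negligible_subset[OF negligible_sing[of "2*pi"]]; auto)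
  ultimately have "(circle_char n has_integral 0) {0..<2*pi}" by simp
  moreover have "integrable (lebesgue_on {0..<2*pi}) (circle_char n)"
    unfolding circle_def [symmetric]
    by (intro finite_measure.integrable_const_bound[OF finite_measure_circle, of _ 1]
        measurable_circle borel_measurable_circle_char) simp
  ultimately show ?thesis
    unfolding circle_def by (subst lebesgue_integral_eq_integral) (auto intro: integral_unique)
qed

lemma measure_circle: "measure circle (space circle) = 2 * pi"
  using emeasure_circle by (simp add: measure_def)

lemma integral_circle:
  fixes f :: "real \<Rightarrow> complex"
  assumes "f \<in> borel_measurable borel"
  shows "(\<integral>x. f x \<partial>circle) = (\<integral>x. indicator {0..<2*pi} x *\<^sub>R f x \<partial>lborel)"
  unfolding circle_def using assms
  by (subst integral_restrict_space) (auto intro!: integral_completion)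

lemma integral_torus_product:
  fixes f g :: "real \<Rightarrow> complex"
  assumes f: "f \<in> borel_measurable borel" "\<And>x. cmod (f x) \<le> 1"
    and g: "g \<in> borel_measurable borel" "\<And>x. cmod (g x) \<le> 1"
  shows "(\<integral>z. f (fst z) * g (snd z) \<partial>torus) = (\<integral>x. f x \<partial>circle) * (\<integral>y. g y \<partial>circle)"
proof -
  let ?I = "{0..<2*pi}"
  let ?k = "\<lambda>z. indicator (?I \<times> ?I) z *\<^sub>R (f (fst z) * g (snd z))"
  have fg: "(\<lambda>z. f (fst z) * g (snd z)) \<in> borel_measurable (borel :: (real \<times> real) measure)"
    using f(1) g(1)
    by (intro borel_measurable_times measurable_compose[OF _ f(1)] measurable_compose[OF _ g(1)])
       (auto intro!: borel_measurable_continuous_onI continuous_intros)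
  have "integrable torus (\<lambda>z. f (fst z) * g (snd z))"
    using f(2) g(2)
    by (intro finite_measure.integrable_const_bound[OF finite_measure_torus, of _ 1] measurable_torus[OF fg])
       (auto simp: norm_mult intro!: mult_le_one)
  then have "integrable lebesgue ?k"
    unfolding torus_def using square_sets_lebesgue by (subst (asm) integrable_restrict_space) auto
  then have "integrable lborel ?k"
    using fg square_sets_lborel by (subst (asm) integrable_completion) auto
  then have int: "integrable (lborel \<Otimes>\<^sub>M lborel) ?k" unfolding lborel_prod .
  have "(\<integral>z. f (fst z) * g (snd z) \<partial>torus) = (\<integral>z. ?k z \<partial>lebesgue)"
    unfolding torus_def using square_sets_lebesgue by (subst integral_restrict_space) auto
  also have "\<dots> = (\<integral>z. ?k z \<partial>lborel)"
    using fg square_sets_lborel by (subst integral_completion) auto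
  also have "\<dots> = (\<integral>x. \<integral>y. ?k (x, y) \<partial>lborel \<partial>lborel)"
    using lborel_pair.integral_fst'[OF int] unfolding lborel_prod by simp
  also have "\<dots> = (\<integral>x. (indicator ?I x *\<^sub>R f x) * (\<integral>y. indicator ?I y *\<^sub>R g y \<partial>lborel) \<partial>lborel)"
  proof (intro Bochner_Integration.integral_cong refl)
    fix x
    have eq: "?k (x, y) = (indicator ?I x *\<^sub>R f x) * (indicator ?I y *\<^sub>R g y)" for y
      by (simp add: indicator_times)
    then show "(\<integral>y. ?k (x, y) \<partial>lborel)
        = (indicator ?I x *\<^sub>R f x) * (\<integral>y. indicator ?I y *\<^sub>R g y \<partial>lborel)"
      by (subst Bochner_Integration.integral_cong[OF refl eq]) (rule integral_mult_right_zero)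
  qed
  also have "\<dots> = (\<integral>x. indicator ?I x *\<^sub>R f x \<partial>lborel) * (\<integral>y. indicator ?I y *\<^sub>R g y \<partial>lborel)"
    by (rule integral_mult_left_zero)
  finally show ?thesis using f(1) g(1) by (simp only: integral_circle)
qed

lemma trig_poly_circle_component:
  assumes "b \<in> Basis"
  shows "trig_poly circle_char UNIV (\<lambda>t. complex_of_real (cis t \<bullet> b))"
proof -
  have "circle_char 1 t = cis t" "circle_char (- 1) t = cis (- t)" for t
    by (simp_all add: circle_char_def cis_conv_exp)
  then have "complex_of_real (cis t \<bullet> 1) = 1 / 2 * circle_char 1 t + 1 / 2 * circle_char (- 1) t"
      "complex_of_real (cis t \<bullet> \<i>) = - \<i> / 2 * circle_char 1 t + \<i> / 2 * circle_char (- 1) t" for t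
    by (simp_all add: complex_eq_iff inner_complex_def)
  moreover have "b = 1 \<or> b = \<i>" using assms by (auto simp: Basis_complex_def)
  ultimately show ?thesis by (elim disjE; simp only:) (intro trig_poly_add trig_poly_basis UNIV_I)+
qed

lemma trig_poly_lift:
  assumes "trig_poly circle_char UNIV T"
  shows "trig_poly torus_char UNIV (\<lambda>z. T (fst z))" "trig_poly torus_char UNIV (\<lambda>z. T (snd z))"
proof -
  obtain F c where F: "finite F" "T = (\<lambda>t. \<Sum>j\<in>F. c j * circle_char j t)"
    using assms by (auto simp: trig_poly_def)
  have "circle_char k (fst z) = torus_char (k, 0) z" "circle_char k (snd z) = torus_char (0, k) z" for k z
    by (simp_all add: torus_char_eq)
  then show "trig_poly torus_char UNIV (\<lambda>z. T (fst z))" "trig_poly torus_char UNIV (\<lambda>z. T (snd z))"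
    unfolding F(2) by (simp_all only:) (intro trig_poly_sum F(1) trig_poly_basis UNIV_I)+
qed

lemma trig_poly_torus_component:
  assumes "b \<in> Basis"
  shows "trig_poly torus_char UNIV (\<lambda>z. complex_of_real ((cis (fst z), cis (snd z)) \<bullet> b))"
proof -
  consider c where "c \<in> Basis" "b = (c, 0)" | c where "c \<in> Basis" "b = (0, c)"
    using assms by (auto simp: Basis_prod_def)
  then show ?thesis
  proof cases
    case 1
    then show ?thesis using trig_poly_lift(1)[OF trig_poly_circle_component[OF 1(1)]] by simp
  next
    case 2
    then show ?thesis using trig_poly_lift(2)[OF trig_poly_circle_component[OF 2(1)]] by simp
  qed
qed

text \<open>
  These intervals exhaust the interior of the fundamental domain and avoid its endpoints, which \<^const>\<open>cis\<close>
  identifies.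
\<close>

definition arc :: "nat \<Rightarrow> real set"
  where "arc n = {1 / real (Suc n)..2 * pi - 1 / real (Suc n)}"

lemma compact_arc: "compact (arc n)"
  by (simp add: arc_def)

lemma inj_on_cis_arc: "inj_on cis (arc n)"
proof (rule inj_onI)
  fix s t assume st: "s \<in> arc n" "t \<in> arc n" "cis s = cis t"
  then have "exp (\<i> * of_real s) = exp (\<i> * of_real t)" by (simp add: cis_conv_exp)
  then obtain k :: int where "\<i> * of_real s = \<i> * of_real t + (of_int (2 * k) * pi) * \<i>"
    unfolding exp_eq by blast
  from arg_cong[OF this, of Im] have *: "s - t = 2 * pi * of_int k" by simp
  have "0 < 1 / real (Suc n)" by simp
  then have "0 < s" "s < 2 * pi" "0 < t" "t < 2 * pi" using st unfolding arc_def atLeastAtMost_iff by linarith+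
  then have "\<bar>2 * pi * of_int k\<bar> < 2 * pi * 1" using * by linarith
  then have "\<bar>of_int k :: real\<bar> < 1" by (simp add: abs_mult)
  then have "k = 0" by linarith
  then show "s = t" using * by simp
qed

lemma eventually_arc:
  assumes "0 < t" "t < 2 * pi"
  shows "\<forall>\<^sub>F n in sequentially. t \<in> arc n"
proof -
  have "\<forall>\<^sub>F n in sequentially. 1 / real (Suc n) < min t (2 * pi - t)"
    using assms by (intro order_tendstoD(2)[OF LIMSEQ_inverse_real_of_nat[unfolded inverse_eq_divide]]) auto
  then show ?thesis by eventually_elim (auto simp: arc_def)
qed

lemma AE_circle_interior: "AE t in circle. 0 < t \<and> t < 2 * pi"
  unfolding AE_circle_iff using AE_lborel_singleton[of "0::real"] by eventually_elim auto

lemma character_system_circle: "character_system circle circle_char"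
proof (rule character_system.intro[OF finite_measure_circle], unfold_locales)
  show "0 < measure circle (space circle)" by (simp only: measure_circle) simp
  show "\<exists>i. i \<noteq> 0 \<and> (\<forall>c. AE z in circle. circle_char i z \<noteq> c)"
    using circle_char_AE_neq[of 1] by (intro exI[of _ 1]) auto
  show "circle_char i \<in> borel_measurable circle" for i
    by (intro measurable_circle borel_measurable_circle_char)
  show "cmod (circle_char i z) = 1" for i z by (rule cmod_circle_char)
  show "circle_char (i + j) z = circle_char i z * circle_char j z" for i j z by (rule circle_char_add)
  show "(\<integral>z. circle_char i z \<partial>circle) = 0" if "i \<noteq> 0" for i using that by (rule integral_circle_char)
  fix h assume h: "bdd_meas circle h"
  show "\<exists>T B. (\<forall>n. trig_poly circle_char UNIV (T n)) \<and> (\<forall>n z. cmod (T n z) \<le> B) \<and>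
      (AE z in circle. (\<lambda>n. T n z) \<longlonglongrightarrow> h z)"
    unfolding circle_def
  proof (rule bounded_trig_approximation[where E = cis and K = arc])
    show "AE z in lebesgue_on {0..<2*pi}. \<forall>\<^sub>F n in sequentially. z \<in> arc n"
      using AE_circle_interior unfolding circle_def by eventually_elim (auto intro: eventually_arc)
    show "bounded (range cis)" by (intro boundedI[of _ 1]) auto
    show "{0..<2*pi} \<in> sets lebesgue" by simp
    show "continuous_on UNIV cis" by (intro continuous_intros)
    show "bdd_meas (lebesgue_on {0..<2*pi}) h" using h unfolding circle_def .
    show "compact (arc n)" "inj_on cis (arc n)" for n by (rule compact_arc inj_on_cis_arc)+
    show "circle_char (i + j) z = circle_char i z * circle_char j z" for i j z by (rule circle_char_add)
    show "circle_char 0 z = 1" for z by (rule circle_char_0)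
    show "trig_poly circle_char UNIV (\<lambda>z. complex_of_real (cis z \<bullet> b))" if "b \<in> Basis" for b
      using that by (rule trig_poly_circle_component)
  qed
qed

lemma character_system_torus: "character_system torus torus_char"
proof (rule character_system.intro[OF finite_measure_torus], unfold_locales)
  have prod: "(\<integral>z. torus_char (k, m) z \<partial>torus) = (\<integral>x. circle_char k x \<partial>circle) * (\<integral>y. circle_char m y \<partial>circle)" for k m
    unfolding torus_char_eq by (intro integral_torus_product borel_measurable_circle_char) simp_all
  show "(\<integral>z. torus_char i z \<partial>torus) = 0" if "i \<noteq> 0" for i
  proof (cases i)
    case (Pair k m)
    then have "k \<noteq> 0 \<or> m \<noteq> 0" using that by (auto simp: zero_prod_def)
    then show ?thesis unfolding Pair prod using integral_circle_char by auto
  qed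
  have "torus_char (0, 0) = (\<lambda>z. 1)" by (auto simp: torus_char_def)
  then have "(\<integral>z. 1 \<partial>torus) = (complex_of_real (2 * pi))\<^sup>2"
    using prod[of 0 0] measure_circle
    by (simp add: circle_char_def[abs_def] scaleR_conv_of_real power2_eq_square)
  then have "measure torus (space torus) \<noteq> 0" by (auto simp: scaleR_conv_of_real)
  then show "0 < measure torus (space torus)" using measure_nonneg[of torus "space torus"] by linarith
  have meas: "{x. circle_char 1 x \<noteq> c} \<in> sets borel" for c
    using borel_measurable_circle_char[of 1] by measurable
  have "AE z in torus. torus_char (1, 0) z \<noteq> c" for c
    using AE_torus_fst[OF circle_char_AE_neq[of 1 c] meas[of c]]
    by (simp add: torus_char_def case_prod_unfold)
  then show "\<exists>i. i \<noteq> 0 \<and> (\<forall>c. AE z in torus. torus_char i z \<noteq> c)"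
    by (intro exI[of _ "(1, 0)"]) (auto simp: zero_prod_def)
  show "torus_char i \<in> borel_measurable torus" for i
    by (intro measurable_torus borel_measurable_torus_char)
  show "cmod (torus_char i z) = 1" for i z by (rule cmod_torus_char)
  show "torus_char (i + j) z = torus_char i z * torus_char j z" for i j z by (rule torus_char_add)
  fix h assume h: "bdd_meas torus h"
  show "\<exists>T B. (\<forall>n. trig_poly torus_char UNIV (T n)) \<and> (\<forall>n z. cmod (T n z) \<le> B) \<and>
      (AE z in torus. (\<lambda>n. T n z) \<longlonglongrightarrow> h z)"
    unfolding torus_def
  proof (rule bounded_trig_approximation[where E = "\<lambda>z. (cis (fst z), cis (snd z))" and K = "\<lambda>n. arc n \<times> arc n"])
    have "AE z in torus. 0 < fst z \<and> fst z < 2 * pi" "AE z in torus. 0 < snd z \<and> snd z < 2 * pi"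
      by (rule AE_torus_fst[OF AE_circle_interior] AE_torus_snd[OF AE_circle_interior], measurable)+
    then have "AE z in torus. \<forall>\<^sub>F n in sequentially. z \<in> arc n \<times> arc n"
    proof eventually_elim
      case (elim z)
      then have "\<forall>\<^sub>F n in sequentially. fst z \<in> arc n \<and> snd z \<in> arc n"
        by (intro eventually_conj eventually_arc) auto
      then show ?case by eventually_elim (auto simp: mem_Times_iff)
    qed
    then show "AE z in lebesgue_on ({0..<2*pi} \<times> {0..<2*pi}). \<forall>\<^sub>F n in sequentially. z \<in> arc n \<times> arc n"
      unfolding torus_def .
    have cis: "bounded (range cis)" by (intro boundedI[of _ 1]) auto
    show "bounded (range (\<lambda>z. (cis (fst z), cis (snd z))))"
      by (rule bounded_subset[OF bounded_Times[OF cis cis]]) auto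
    show "inj_on (\<lambda>z. (cis (fst z), cis (snd z))) (arc n \<times> arc n)" for n
      using inj_on_cis_arc[of n] by (auto simp: inj_on_def)
    show "{0..<2*pi} \<times> {0..<2*pi} \<in> sets (lebesgue :: (real \<times> real) measure)"
      by (rule square_sets_lebesgue)
    show "continuous_on UNIV (\<lambda>z. (cis (fst z), cis (snd z)))" by (intro continuous_intros)
    show "bdd_meas (lebesgue_on ({0..<2*pi} \<times> {0..<2*pi})) h" using h unfolding torus_def .
    show "compact (arc n \<times> arc n)" for n by (intro compact_Times compact_arc)
    show "torus_char (i + j) z = torus_char i z * torus_char j z" for i j z by (rule torus_char_add)
    show "torus_char 0 z = 1" for z by (rule torus_char_0)
    show "trig_poly torus_char UNIV (\<lambda>z. complex_of_real ((cis (fst z), cis (snd z)) \<bullet> b))"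
      if "b \<in> Basis" for b
      using that by (rule trig_poly_torus_component)
  qed
qed

section \<open>From the torus to the first coordinate\<close>

lemma ennreal_one_div_one_div: "1 / (1 / (a :: ennreal)) = a"
proof (cases a)
  case (real c)
  then show ?thesis
  proof (cases "c = 0")
    case False
    then have c: "0 < c" using real by simp
    then have "1 / ennreal c = ennreal (1 / c)" using divide_ennreal[of 1 c] by simp
    moreover have "1 / ennreal (1 / c) = ennreal c" using divide_ennreal[of 1 "1 / c"] c by simp
    ultimately show ?thesis using real by simp
  qed (simp add: divide_ennreal_def)
qed (simp add: divide_ennreal_def)

lemma conjugate_exponent_nonzero:
  assumes "1 / ennreal p + 1 / q = (1::ennreal)"
  shows "q \<noteq> 0"
  using assms by (auto simp: divide_ennreal_def)

lemma ext_norm_recip_nonzero: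
  fixes f :: "real \<Rightarrow> real"
  assumes f: "f \<in> borel_measurable circle" and q: "q \<noteq> 0"
  shows "ext_norm q circle (\<lambda>y. 1 / ennreal (f y)) \<noteq> 0"
proof
  note [measurable] = f
  have pos: "1 / ennreal (f y) \<noteq> 0" for y by (simp add: divide_ennreal_def)
  assume z: "ext_norm q circle (\<lambda>y. 1 / ennreal (f y)) = 0"
  have "AE y in circle. 1 / ennreal (f y) = 0"
  proof (cases q)
    case (real r)
    then have r: "0 < r" using q by (cases "r = 0") auto
    have *: "ennreal_powr a s = 0 \<longleftrightarrow> a = 0" for a s
      by (cases a) (auto simp: ennreal_powr_ennreal)
    have "(\<integral>\<^sup>+ y. ennreal_powr (1 / ennreal (f y)) r \<partial>circle) = 0"
      using z unfolding real ext_norm_real[OF r] * .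
    then show ?thesis by (subst (asm) nn_integral_0_iff_AE) (auto simp: *)
  next
    case top
    then have "esssup circle (\<lambda>y. 1 / ennreal (f y)) \<le> 0" using z by (simp add: ext_norm_def)
    then show ?thesis by (subst (asm) esssup_le_iff) auto
  qed
  then have "AE y in circle. False" by eventually_elim (simp add: pos)
  then show False using AE_circle_not_False by blast
qed

text \<open>
  By Hoelder's inequality \<open>\<mu>(X) \<le> \<parallel>f\<parallel>\<^sub>p \<parallel>1/f\<parallel>\<^sub>q\<close>, the reciprocal \<open>w\<close> of \<open>\<parallel>1/f\<parallel>\<^sub>q\<close> is at most a multiple of \<open>\<parallel>f\<parallel>\<^sub>p\<close>.
  If the space has measure at least two, the multiple can be taken to be one.
\<close>

lemma weight_powr_le:
  fixes f :: "'a \<Rightarrow> real"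
  assumes p: "1 \<le> p" and q: "1 / ennreal p + 1 / q = 1"
    and f [measurable]: "f \<in> borel_measurable \<mu>" and f0: "\<And>z. 0 \<le> f z"
    and two: "2 \<le> emeasure \<mu> (space \<mu>)"
  defines "w \<equiv> enn2real (1 / ext_norm q \<mu> (\<lambda>z. 1 / ennreal (f z)))"
  shows "ennreal (w powr p) \<le> (\<integral>\<^sup>+ z. ennreal (f z powr p) \<partial>\<mu>)"
proof (cases "w = 0")
  case False
  define N where "N = ext_norm q \<mu> (\<lambda>z. 1 / ennreal (f z))"
  have w: "0 < w" using False by (simp add: w_def order_less_le)
  have "1 / N \<noteq> top" using False by (auto simp: w_def N_def)
  then have "1 / N = ennreal w" by (simp add: w_def N_def less_top[symmetric])
  then have N: "N = ennreal (1 / w)"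
    using ennreal_one_div_one_div[of N] divide_ennreal[of 1 w] w by simp
  have recip: "1 / ennreal (f z) = (if f z = 0 then top else ennreal (1 / f z))" for z
    using divide_ennreal[of 1 "f z"] f0[of z] by (auto simp: divide_ennreal_def)
  from p q show ?thesis
  proof (cases rule: conjugate_exponent_cases)
    case 1
    have "AE z in \<mu>. 1 / ennreal (f z) \<le> N"
      using esssup_AE[of "\<lambda>z. 1 / ennreal (f z)" \<mu>] by (simp add: N_def 1 ext_norm_def)
    then have "AE z in \<mu>. ennreal w \<le> ennreal (f z powr p)"
    proof eventually_elim
      case (elim z)
      then have "f z \<noteq> 0" "1 / f z \<le> 1 / w"
        using w f0[of z] by (auto simp: recip N top_unique split: if_splits)
      then show ?case using w f0[of z] by (intro ennreal_leI) (auto simp: 1 field_simps)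
    qed
    then have "(\<integral>\<^sup>+ z. ennreal w \<partial>\<mu>) \<le> (\<integral>\<^sup>+ z. ennreal (f z powr p) \<partial>\<mu>)"
      by (rule nn_integral_mono_AE)
    moreover have "ennreal w * 1 \<le> ennreal w * emeasure \<mu> (space \<mu>)"
      using two by (intro mult_left_mono) (auto intro: order_trans[of 1 2])
    ultimately show ?thesis using w by (simp add: 1)
  next
    case (2 r)
    have r: "0 < r" using 2 by simp
    let ?A = "\<integral>\<^sup>+ z. ennreal_powr (1 / ennreal (f z)) r \<partial>\<mu>"
    let ?B = "\<integral>\<^sup>+ z. ennreal (f z powr p) \<partial>\<mu>"
    have "ennreal_powr ?A (1 / r) = ennreal (1 / w)"
      using N r 2 by (simp add: N_def ext_norm_real)
    then have "ennreal_powr (ennreal_powr ?A (1 / r)) r = ennreal ((1 / w) powr r)"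
      using w by (simp add: ennreal_powr_ennreal)
    then have A: "?A = ennreal ((1 / w) powr r)" using r by (simp add: ennreal_powr_powr)
    \<comment> \<open>one of \<open>w / f\<close> and \<open>f / w\<close> is at least one, and the powers of \<open>w / f\<close> integrate to one\<close>
    have "emeasure \<mu> (space \<mu>) = (\<integral>\<^sup>+ z. 1 \<partial>\<mu>)" by simp
    also have "\<dots> \<le> (\<integral>\<^sup>+ z. ennreal (w powr r) * ennreal_powr (1 / ennreal (f z)) r
        + ennreal (w powr - p) * ennreal (f z powr p) \<partial>\<mu>)"
    proof (rule nn_integral_mono)
      fix z
      show "1 \<le> ennreal (w powr r) * ennreal_powr (1 / ennreal (f z)) r
        + ennreal (w powr - p) * ennreal (f z powr p)"
      proof (cases "f z \<le> w")
        case True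
        have "1 \<le> ennreal (w powr r) * ennreal_powr (1 / ennreal (f z)) r"
        proof (cases "f z = 0")
          case True
          then show ?thesis using w by (simp add: recip ennreal_mult_top)
        next
          case False
          then have f: "0 < f z" using f0[of z] by simp
          have "1 \<le> (w / f z) powr r" using True f r by (intro ge_one_powr_ge_zero) auto
          also have "\<dots> = w powr r * (1 / f z) powr r" using w f by (simp add: powr_divide)
          finally show ?thesis
            using f by (simp add: recip ennreal_powr_ennreal flip: ennreal_mult)
        qed
        then show ?thesis by (simp add: add_increasing2)
      next
        case False
        have "1 \<le> (f z / w) powr p" using False w p by (intro ge_one_powr_ge_zero) auto
        also have "\<dots> = w powr - p * f z powr p"
          using w f0 by (simp add: powr_divide powr_minus_divide)
        finally have "1 \<le> ennreal (w powr - p) * ennreal (f z powr p)"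
          by (simp flip: ennreal_mult)
        then show ?thesis by (simp add: add_increasing)
      qed
    qed
    also have "\<dots> = ennreal (w powr r) * ?A + ennreal (w powr - p) * ?B"
      by (simp add: nn_integral_add nn_integral_cmult)
    also have "ennreal (w powr r) * ?A = 1"
      unfolding A using w by (simp add: powr_divide flip: ennreal_mult)
    finally have "1 + 1 \<le> 1 + ennreal (w powr - p) * ?B" using two by (simp add: order_trans)
    then have "1 \<le> ennreal (w powr - p) * ?B"
      by (subst (asm) ennreal_add_left_cancel_le) auto
    then have "ennreal (w powr p) * 1 \<le> ennreal (w powr p) * (ennreal (w powr - p) * ?B)"
      by (intro mult_left_mono) auto
    also have "\<dots> = (ennreal (w powr p) * ennreal (w powr - p)) * ?B" by (simp add: mult.assoc)
    also have "ennreal (w powr p) * ennreal (w powr - p) = 1"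
      using w by (simp flip: ennreal_mult powr_add)
    finally show ?thesis by simp
  qed
qed simp

lemma slice_measurable:
  fixes f :: "real \<times> real \<Rightarrow> 'b::topological_space"
  assumes "f \<in> borel_measurable borel"
  shows "(\<lambda>y. f (x, y)) \<in> borel_measurable borel"
  by (rule measurable_compose[OF _ assms]) (auto intro!: borel_measurable_continuous_onI continuous_intros)

lemma fst_measurable:
  fixes g :: "real \<Rightarrow> 'b::topological_space"
  assumes "g \<in> borel_measurable borel"
  shows "(\<lambda>z :: real \<times> real. g (fst z)) \<in> borel_measurable borel"
  by (rule measurable_compose[OF _ assms]) (auto intro!: borel_measurable_continuous_onI continuous_intros)

text \<open>
  For \<open>g\<close> depending on \<open>x\<close> only, the norm of \<open>g / M\<close> over the torus is the norm over \<open>x\<close> of \<open>|g(x)|\<close> times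
  the norm of \<open>1 / M(x, \<cdot>)\<close>, and the latter factor is \<open>1 / u(x)\<close>. Hence \<open>g / M\<close> and \<open>g / u\<close> have the same
  norm, and by duality the functionals are bounded simultaneously.
\<close>

proposition weight_transfer:
  fixes M :: "real \<times> real \<Rightarrow> complex" and u :: "real \<Rightarrow> ennreal"
  assumes p: "1 \<le> p" and q: "1 / ennreal p + 1 / q = 1" and M: "M \<in> Lp_space torus p"
    and u: "\<And>x. x \<in> space circle \<Longrightarrow> 1 / u x = recip_norm q circle (\<lambda>y. M (x, y))"
  defines "W \<equiv> \<lambda>x. complex_of_real (enn2real (u x))"
  shows "W \<in> Lp_space circle p"
    and "\<And>g. g \<in> borel_measurable borel \<Longrightarrow> bdd_meas circle g \<Longrightarrow> AE x in circle. g x \<noteq> 0 \<Longrightarrow>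
      bounded_functional torus p M (\<lambda>z. g (fst z)) \<longleftrightarrow> bounded_functional circle p W g"
proof -
  have q0: "q \<noteq> 0" by (rule conjugate_exponent_nonzero[OF q])
  note [measurable] = Lp_spaceD(1)[OF M]
  obtain m0 where m0: "m0 \<in> borel_measurable borel" "AE z in torus. cmod (M z) = m0 z"
      "AE x in circle. (\<lambda>y. cmod (M (x, y))) \<in> borel_measurable circle \<and>
        (AE y in circle. cmod (M (x, y)) = m0 (x, y))"
    by (rule torus_borel_representative[of "\<lambda>z. cmod (M z)"]) measurable
  define m where "m z = \<bar>m0 z\<bar>" for z
  have m [measurable]: "m \<in> borel_measurable borel" unfolding m_def using m0(1) by measurable
  have m_nonneg: "0 \<le> m z" for z by (simp add: m_def)
  have aeM: "AE z in torus. cmod (M z) = m z"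
    using m0(2) by eventually_elim (metis m_def abs_norm_cancel)
  define N where "N x = ext_norm q circle (\<lambda>y. 1 / ennreal (m (x, y)))" for x
  have recip_m: "(\<lambda>z. 1 / ennreal (m z)) \<in> borel_measurable borel" by measurable
  have N [measurable]: "N \<in> borel_measurable borel"
    unfolding N_def by (rule ext_norm_slice_measurable[OF recip_m q0])
  have N0: "N x \<noteq> 0" for x
    unfolding N_def by (intro ext_norm_recip_nonzero measurable_circle slice_measurable m q0)
  have "AE x in circle. x \<in> space circle" by (rule AE_space)
  then have "AE x in circle. 1 / u x = N x"
    using m0(3)
  proof eventually_elim
    case (elim x)
    then have "(\<lambda>y. cmod (M (x, y))) \<in> borel_measurable circle" by blast
    then have recip_M: "(\<lambda>y. 1 / ennreal (cmod (M (x, y)))) \<in> borel_measurable circle"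
      by (rule measurable_compose[where g = "\<lambda>r. 1 / ennreal r"]) measurable
    have "AE y in circle. cmod (M (x, y)) = m0 (x, y)" using elim by blast
    then have "AE y in circle. 1 / ennreal (cmod (M (x, y))) = 1 / ennreal (m (x, y))"
      by eventually_elim (metis m_def abs_norm_cancel)
    then have "recip_norm q circle (\<lambda>y. M (x, y)) = N x"
      unfolding recip_norm_eq_ext_norm N_def
      by (intro ext_norm_cong_AE recip_M measurable_circle slice_measurable[OF recip_m])
    then show ?case using u elim by simp
  qed
  then have aeu: "AE x in circle. u x = 1 / N x"
    by eventually_elim (metis ennreal_one_div_one_div)
  have N_fin: "1 / N x \<noteq> top" for x
    using N0[of x] by (auto simp: divide_ennreal_def ennreal_inverse_eq_top_iff)
  have "(\<lambda>x. enn2real (1 / N x)) \<in> borel_measurable circle"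
    by (rule measurable_circle) measurable
  then have Wm: "(\<lambda>x. enn2real (u x)) \<in> borel_measurable circle"
    by (rule circle_measurable_AE) (use aeu in \<open>eventually_elim, simp\<close>)
  have "(\<integral>\<^sup>+ x. ennreal (enn2real (u x) powr p) \<partial>circle) =
      (\<integral>\<^sup>+ x. ennreal (enn2real (1 / N x) powr p) \<partial>circle)"
    using aeu by (intro nn_integral_cong_AE) auto
  also have "\<dots> \<le> (\<integral>\<^sup>+ x. \<integral>\<^sup>+ y. ennreal (m (x, y) powr p) \<partial>circle \<partial>circle)"
  proof (intro nn_integral_mono)
    fix x
    have "2 \<le> emeasure circle (space circle)"
      using pi_ge_two by (simp add: emeasure_circle) 
    then show "ennreal (enn2real (1 / N x) powr p) \<le> (\<integral>\<^sup>+ y. ennreal (m (x, y) powr p) \<partial>circle)"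
      unfolding N_def
      by (intro weight_powr_le[OF p q] measurable_circle slice_measurable m m_nonneg)
  qed
  also have "\<dots> = (\<integral>\<^sup>+ z. ennreal (m z powr p) \<partial>torus)"
    by (rule nn_integral_torus_iterated[symmetric]) measurable
  also have "\<dots> = (\<integral>\<^sup>+ z. ennreal (cmod (M z) powr p) \<partial>torus)"
    using aeM by (intro nn_integral_cong_AE) auto
  also have "\<dots> < top"
    using Lp_spaceD(2)[OF M] by (subst nn_integral_eq_integral) auto
  finally have "integrable circle (\<lambda>x. enn2real (u x) powr p)"
    using Wm by (intro integrableI_nonneg) auto
  then show W: "W \<in> Lp_space circle p"
    using Wm by (simp add: Lp_space_def W_def)
  fix g :: "real \<Rightarrow> complex"
  assume g: "g \<in> borel_measurable borel" "bdd_meas circle g" "AE x in circle. g x \<noteq> 0"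
  note [measurable] = g(1) fst_measurable[OF g(1)] measurable_torus[OF fst_measurable[OF g(1)]]
    measurable_circle[OF g(1)] Lp_spaceD(1)[OF W] measurable_circle[OF N] measurable_torus[OF m]
  obtain B where B: "\<And>x. cmod (g x) \<le> B" using bdd_measE[OF g(2)] by blast
  have g': "bdd_meas torus (\<lambda>z. g (fst z))"
    by (rule bdd_measI[of _ _ B]) (use B in auto)
  have "{x. g x \<noteq> 0} \<in> sets borel" by measurable
  then have nz: "AE z in torus. g (fst z) \<noteq> 0" by (rule AE_torus_fst[OF g(3)])
  let ?F = "\<lambda>z. ennreal (cmod (g (fst z))) * (1 / ennreal (m z))"
  have "ext_norm q torus (abs_ratio (\<lambda>z. g (fst z)) M) = ext_norm q torus ?F"
    using aeM by (intro ext_norm_cong_AE borel_measurable_abs_ratio) (auto simp: abs_ratio_def elim: AE_mp)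
  also have "\<dots> = ext_norm q circle (\<lambda>x. ext_norm q circle (\<lambda>y. ?F (x, y)))"
    by (rule ext_norm_torus_iterated[OF _ q0]) measurable
  also have "\<dots> = ext_norm q circle (\<lambda>x. ennreal (cmod (g x)) * N x)"
    unfolding N_def fst_conv
    by (subst ext_norm_cmult[OF measurable_circle[OF slice_measurable[OF recip_m]] _ q0]) simp_all
  also have "\<dots> = ext_norm q circle (abs_ratio g W)"
  proof (rule ext_norm_cong_AE)
    show "AE x in circle. ennreal (cmod (g x)) * N x = abs_ratio g W x"
      using aeu
    proof eventually_elim
      case (elim x)
      have "ennreal (cmod (W x)) = 1 / N x"
        using N_fin[of x] by (simp add: W_def elim less_top)
      then show ?case by (simp add: abs_ratio_def ennreal_one_div_one_div)
    qed
  qed measurable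
  finally have eq: "ext_norm q torus (abs_ratio (\<lambda>z. g (fst z)) M) = ext_norm q circle (abs_ratio g W)" .
  interpret t: finite_measure torus by (rule finite_measure_torus)
  interpret c: finite_measure circle by (rule finite_measure_circle)
  have "bounded_functional torus p M (\<lambda>z. g (fst z)) \<longleftrightarrow> ext_norm q torus (abs_ratio (\<lambda>z. g (fst z)) M) < top"
    using t.ext_norm_finite_imp_bounded_functional[OF M g' nz p q]
      t.bounded_functional_imp_ext_norm_finite[OF M g' nz p q] by blast
  also have "\<dots> \<longleftrightarrow> bounded_functional circle p W g"
    unfolding eq using c.ext_norm_finite_imp_bounded_functional[OF W g(2,3) p q]
      c.bounded_functional_imp_ext_norm_finite[OF W g(2,3) p q] by blast
  finally show "bounded_functional torus p M (\<lambda>z. g (fst z)) \<longleftrightarrow> bounded_functional circle p W g" .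
qed


section \<open>Exchanging the coordinates\<close>

lemma AE_torus_swap:
  assumes "AE z in torus. P z"
  shows "AE z in torus. P (prod.swap z)"
proof -
  let ?S = "{0..<2*pi} \<times> {0..<2*pi}"
  have "AE z in lborel \<Otimes>\<^sub>M lborel. z \<in> ?S \<longrightarrow> P z"
    using assms unfolding AE_torus_iff lborel_prod .
  then have "AE z in distr (lborel \<Otimes>\<^sub>M lborel) (lborel \<Otimes>\<^sub>M lborel) (\<lambda>(x, y). (y, x)). z \<in> ?S \<longrightarrow> P z"
    unfolding lborel_pair.distr_pair_swap[symmetric] .
  then have "AE z in lborel \<Otimes>\<^sub>M lborel. (case z of (x, y) \<Rightarrow> (y, x)) \<in> ?S \<longrightarrow> P (case z of (x, y) \<Rightarrow> (y, x))"
    by (rule AE_distrD[rotated]) measurable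
  then show ?thesis
    unfolding AE_torus_iff lborel_prod by eventually_elim (auto simp: prod.swap_def)
qed

lemma swap_measurable_borel: "prod.swap \<in> borel_measurable (borel :: (real \<times> real) measure)"
  unfolding prod.swap_def by (intro borel_measurable_continuous_onI continuous_intros)

lemma nn_integral_torus_swap:
  fixes f :: "real \<times> real \<Rightarrow> ennreal"
  assumes f: "f \<in> borel_measurable borel"
  shows "(\<integral>\<^sup>+ z. f (prod.swap z) \<partial>torus) = (\<integral>\<^sup>+ z. f z \<partial>torus)"
proof -
  let ?S = "{0..<2*pi} \<times> {0..<2*pi}"
  let ?h = "\<lambda>z. f z * indicator ?S z"
  have h: "?h \<in> borel_measurable (lborel \<Otimes>\<^sub>M lborel)"
    using f square_sets_lborel by (simp add: lborel_prod)
  have "(\<integral>\<^sup>+ z. ?h z \<partial>(lborel \<Otimes>\<^sub>M lborel)) =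
      (\<integral>\<^sup>+ z. ?h z \<partial>distr (lborel \<Otimes>\<^sub>M lborel) (lborel \<Otimes>\<^sub>M lborel) (\<lambda>(x, y). (y, x)))"
    by (subst lborel_pair.distr_pair_swap) (rule refl)
  also have "\<dots> = (\<integral>\<^sup>+ z. ?h (case z of (x, y) \<Rightarrow> (y, x)) \<partial>(lborel \<Otimes>\<^sub>M lborel))"
    by (rule nn_integral_distr) (use h in measurable)
  also have "\<dots> = (\<integral>\<^sup>+ z. f (prod.swap z) * indicator ?S z \<partial>(lborel \<Otimes>\<^sub>M lborel))"
    by (intro nn_integral_cong) (auto simp: indicator_def)
  finally show ?thesis unfolding nn_integral_torus lborel_prod by simp
qed

text \<open>
  For Borel sets this is the symmetry of the product measure; Borel representatives of indicator
  functions carry it over to Lebesgue measurable sets.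
\<close>

lemma measurable_torus_swap: "prod.swap \<in> measurable torus torus"
  and distr_torus_swap: "distr torus torus prod.swap = torus"
proof -
  have rep: "prod.swap -` A \<inter> space torus \<in> sets torus \<and>
      emeasure torus (prod.swap -` A \<inter> space torus) = emeasure torus A" if A: "A \<in> sets torus" for A
  proof -
    have "indicator A \<in> borel_measurable torus" using A by simp
    then obtain m :: "real \<times> real \<Rightarrow> real" where m: "m \<in> borel_measurable borel"
        "AE z in torus. indicator A z = m z"
      by (rule torus_borel_representative)
    note m_swap = AE_torus_swap[OF m(2)]
    have eq: "indicator (prod.swap -` A) z = (indicator A (prod.swap z) :: real)" for z by (simp add: indicator_def)
    have "(\<lambda>z. m (prod.swap z)) \<in> borel_measurable torus"
      by (intro measurable_torus measurable_compose[OF swap_measurable_borel m(1)])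
    then have "(\<lambda>z. indicator A (prod.swap z) :: real) \<in> borel_measurable torus"
      by (rule torus_measurable_AE) (use m_swap in \<open>eventually_elim, simp\<close>)
    then have "(indicator (prod.swap -` A) :: _ \<Rightarrow> real) \<in> borel_measurable torus"
      by (simp add: eq[symmetric])
    then have meas: "prod.swap -` A \<inter> space torus \<in> sets torus"
      by (simp add: borel_measurable_indicator_iff)
    have "emeasure torus (prod.swap -` A \<inter> space torus) = (\<integral>\<^sup>+ z. indicator (prod.swap -` A \<inter> space torus) z \<partial>torus)"
      using meas by simp
    also have "\<dots> = (\<integral>\<^sup>+ z. ennreal (m (prod.swap z)) \<partial>torus)"
      using m_swap AE_space[of torus]
      by (intro nn_integral_cong_AE, eventually_elim) (auto simp: indicator_def split: if_splits)
    also have "\<dots> = (\<integral>\<^sup>+ z. ennreal (m z) \<partial>torus)"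
      using m(1) by (intro nn_integral_torus_swap[of "\<lambda>z. ennreal (m z)"]) simp
    also have "\<dots> = (\<integral>\<^sup>+ z. indicator A z \<partial>torus)"
      using m(2) by (intro nn_integral_cong_AE, eventually_elim) (auto simp: indicator_def split: if_splits)
    also have "\<dots> = emeasure torus A" using A by simp
    finally show ?thesis using meas by simp
  qed
  show swap: "prod.swap \<in> measurable torus torus"
  proof (rule measurableI)
    show "prod.swap z \<in> space torus" if "z \<in> space torus" for z
      using that by (cases z) simp
  qed (use rep in blast)
  show "distr torus torus prod.swap = torus"
  proof (rule measure_eqI)
    show "emeasure (distr torus torus prod.swap) A = emeasure torus A"
      if "A \<in> sets (distr torus torus prod.swap)" for A
      using that rep[of A] by (simp only: emeasure_distr[OF swap] sets_distr)
  qed simp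
qed

lemma integral_torus_swap:
  fixes f :: "real \<times> real \<Rightarrow> 'b::{banach, second_countable_topology}"
  assumes "f \<in> borel_measurable torus"
  shows "(\<integral>z. f (prod.swap z) \<partial>torus) = (\<integral>z. f z \<partial>torus)"
  using integral_distr[OF measurable_torus_swap assms] by (simp add: distr_torus_swap)

lemma Lp_space_torus_swap:
  assumes "f \<in> Lp_space torus p"
  shows "(\<lambda>z. f (prod.swap z)) \<in> Lp_space torus p"
proof -
  note f = Lp_spaceD[OF assms]
  have "integrable (distr torus torus prod.swap) (\<lambda>z. cmod (f z) powr p)"
    using f by (simp add: distr_torus_swap)
  then have "integrable torus (\<lambda>z. cmod (f (prod.swap z)) powr p)"
    using f by (subst (asm) integrable_distr_eq) (auto intro: measurable_torus_swap)
  then show ?thesis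
    using measurable_compose[OF measurable_torus_swap f(1)] by (simp add: Lp_space_def)
qed

lemma bounded_functional_torus_swap:
  assumes M: "M \<in> Lp_space torus p" and g: "g \<in> borel_measurable torus"
    and b: "bounded_functional torus p M g"
  shows "bounded_functional torus p (\<lambda>z. M (prod.swap z)) (\<lambda>z. g (prod.swap z))"
proof -
  obtain C where C: "0 \<le> C" "\<And>h. bdd_meas torus h \<Longrightarrow>
      cmod (\<integral>z. h z * g z \<partial>torus) \<le> C * Lp_norm torus p (\<lambda>z. M z * h z)"
    using b by (auto simp: bounded_functional_def)
  have "cmod (\<integral>z. h z * g (prod.swap z) \<partial>torus) \<le> C * Lp_norm torus p (\<lambda>z. M (prod.swap z) * h z)"
    if h: "bdd_meas torus h" for h
  proof -
    define k where "k z = h (prod.swap z)" for z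
    obtain B where "\<And>z. cmod (h z) \<le> B" using bdd_measE[OF h] by blast
    then have k: "bdd_meas torus k"
      unfolding k_def
      by (intro bdd_measI[of _ _ B] measurable_compose[OF measurable_torus_swap bdd_meas_measurable[OF h]])
    note [measurable] = bdd_meas_measurable[OF k] g Lp_spaceD(1)[OF M]
    have "(\<integral>z. k (prod.swap z) * g (prod.swap z) \<partial>torus) = (\<integral>z. k z * g z \<partial>torus)"
      by (rule integral_torus_swap) measurable
    moreover have "(\<integral>z. cmod (M (prod.swap z) * k (prod.swap z)) powr p \<partial>torus)
        = (\<integral>z. cmod (M z * k z) powr p \<partial>torus)"
      by (rule integral_torus_swap) measurable
    ultimately show ?thesis using C(2)[OF k] by (simp add: k_def Lp_norm_def)
  qed
  then show ?thesis unfolding bounded_functional_def using C(1) by blast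
qed

lemma weight_transfer_snd:
  fixes M :: "real \<times> real \<Rightarrow> complex" and v :: "real \<Rightarrow> ennreal"
  assumes p: "1 \<le> p" and q: "1 / ennreal p + 1 / q = 1" and M: "M \<in> Lp_space torus p"
    and v: "\<And>y. y \<in> space circle \<Longrightarrow> 1 / v y = recip_norm q circle (\<lambda>x. M (x, y))"
  defines "W \<equiv> \<lambda>y. complex_of_real (enn2real (v y))"
  shows "W \<in> Lp_space circle p"
    and "\<And>g. g \<in> borel_measurable borel \<Longrightarrow> bdd_meas circle g \<Longrightarrow> AE y in circle. g y \<noteq> 0 \<Longrightarrow>
      bounded_functional torus p M (\<lambda>z. g (snd z)) \<longleftrightarrow> bounded_functional circle p W g"
proof -
  define M' where "M' = (\<lambda>z. M (prod.swap z))"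
  have M_eq: "M = (\<lambda>z. M' (prod.swap z))" by (simp add: M'_def)
  have M': "M' \<in> Lp_space torus p" unfolding M'_def by (rule Lp_space_torus_swap[OF M])
  have v': "1 / v y = recip_norm q circle (\<lambda>x. M' (y, x))" if "y \<in> space circle" for y
    using v[OF that] by (simp add: M'_def)
  show "W \<in> Lp_space circle p"
    unfolding W_def by (rule weight_transfer(1)[OF p q M']) (rule v')
  fix g :: "real \<Rightarrow> complex"
  assume g: "g \<in> borel_measurable borel" "bdd_meas circle g" "AE y in circle. g y \<noteq> 0"
  have fst: "(\<lambda>z. g (fst z)) \<in> borel_measurable torus"
    by (intro measurable_torus fst_measurable g)
  have snd: "(\<lambda>z. g (snd z)) \<in> borel_measurable torus"
    using measurable_compose[OF measurable_torus_swap fst] by simp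
  have "bounded_functional torus p M (\<lambda>z. g (snd z)) \<longleftrightarrow> bounded_functional torus p M' (\<lambda>z. g (fst z))"
    using bounded_functional_torus_swap[OF M snd] bounded_functional_torus_swap[OF M' fst]
    by (simp only: M'_def[symmetric] M_eq[symmetric] fst_swap snd_swap) blast
  also have "\<dots> \<longleftrightarrow> bounded_functional circle p W g"
    unfolding W_def by (rule weight_transfer(2)[OF p q M' _ g]) (rule v')
  finally show "bounded_functional torus p M (\<lambda>z. g (snd z)) \<longleftrightarrow> bounded_functional circle p W g" .
qed

section \<open>Completeness and minimality on the torus\<close>

lemma weighted_exp_eq: "weighted_exp w = (\<lambda>n t. complex_of_real (enn2real (w t)) * circle_char n t)"
  by (simp add: weighted_exp_def circle_char_def fun_eq_iff)

lemma weighted_exp2_eq: "weighted_exp2 M = (\<lambda>i z. M z * torus_char i z)"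
  by (simp add: weighted_exp2_def torus_char_def circle_char_def fun_eq_iff mult.assoc)

theorem theorem3:
  fixes p :: real and p' :: ennreal
    and M :: "real \<times> real \<Rightarrow> complex"
    and u v :: "real \<Rightarrow> ennreal"
  assumes "1 \<le> p"
    and "1 / ennreal p + 1 / p' = 1"
    and "M \<in> Lp_space torus p"
    and "\<And>x. x \<in> space circle \<Longrightarrow> 1 / u x = recip_norm p' circle (\<lambda>y. M (x, y))"
    and "\<And>y. y \<in> space circle \<Longrightarrow> 1 / v y = recip_norm p' circle (\<lambda>x. M (x, y))"
  shows "(complete_in_Lp torus p (weighted_exp2 M) (UNIV - {(0, 0)}) \<and>
          minimal_in_Lp torus p (weighted_exp2 M) (UNIV - {(0, 0)})) \<longleftrightarrow>
         ((complete_in_Lp circle p (weighted_exp u) (UNIV - {0}) \<and>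
           minimal_in_Lp circle p (weighted_exp u) (UNIV - {0})) \<and>
          (complete_in_Lp circle p (weighted_exp v) (UNIV - {0}) \<and>
           minimal_in_Lp circle p (weighted_exp v) (UNIV - {0})))"
proof -
  interpret t: finite_measure torus by (rule finite_measure_torus)
  let ?T = "bounded_functional torus p M"
  define U where "U = (\<lambda>x. complex_of_real (enn2real (u x)))"
  define V where "V = (\<lambda>y. complex_of_real (enn2real (v y)))"
  have U: "U \<in> Lp_space circle p"
    unfolding U_def by (rule weight_transfer(1)[OF assms(1-3)]) (rule assms(4))
  have V: "V \<in> Lp_space circle p"
    unfolding V_def by (rule weight_transfer_snd(1)[OF assms(1-3)]) (rule assms(5))
  have transfer_u: "?T (\<lambda>z. g (fst z)) \<longleftrightarrow> bounded_functional circle p U g"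
    if "g \<in> borel_measurable borel" "bdd_meas circle g" "AE x in circle. g x \<noteq> 0" for g
    unfolding U_def by (rule weight_transfer(2)[OF assms(1-3) _ that]) (rule assms(4))
  have transfer_v: "?T (\<lambda>z. g (snd z)) \<longleftrightarrow> bounded_functional circle p V g"
    if "g \<in> borel_measurable borel" "bdd_meas circle g" "AE x in circle. g x \<noteq> 0" for g
    unfolding V_def by (rule weight_transfer_snd(2)[OF assms(1-3) _ that]) (rule assms(5))
  have char: "(\<lambda>t. circle_char n t - c) \<in> borel_measurable borel" "bdd_meas circle (\<lambda>t. circle_char n t - c)"
    for n c
  proof -
    show "(\<lambda>t. circle_char n t - c) \<in> borel_measurable borel"
      using borel_measurable_circle_char[of n] by measurable
    then show "bdd_meas circle (\<lambda>t. circle_char n t - c)"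
      by (intro bdd_measI[of _ _ "1 + cmod c"] measurable_circle order_trans[OF norm_triangle_ineq4]) auto
  qed
  have nz: "AE t in circle. circle_char n t - c \<noteq> 0" if "n \<noteq> 0" for n c
    using circle_char_AE_neq[OF that, of c] by eventually_elim simp
  have one: "(\<lambda>t. 1 :: complex) \<in> borel_measurable borel" "bdd_meas circle (\<lambda>t. 1)"
      "AE t in circle. (1 :: complex) \<noteq> 0"
    by (auto intro: bdd_meas_const)
  have one_u: "?T (\<lambda>z. 1) \<longleftrightarrow> bounded_functional circle p U (\<lambda>t. 1)"
    by (rule transfer_u[OF one])
  have one_v: "?T (\<lambda>z. 1) \<longleftrightarrow> bounded_functional circle p V (\<lambda>t. 1)"
    by (rule transfer_v[OF one])
  have char_u: "?T (\<lambda>z. circle_char n (fst z) - c) \<longleftrightarrow> bounded_functional circle p U (\<lambda>t. circle_char n t - c)"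
    if "n \<noteq> 0" for n c
    by (rule transfer_u[OF char nz[OF that]])
  have char_v: "?T (\<lambda>z. circle_char n (snd z) - c) \<longleftrightarrow> bounded_functional circle p V (\<lambda>t. circle_char n t - c)"
    if "n \<noteq> 0" for n c
    by (rule transfer_v[OF char nz[OF that]])
  have "(\<forall>i. i \<noteq> 0 \<longrightarrow> (\<exists>c. ?T (\<lambda>z. torus_char i z - c))) \<longleftrightarrow>
      (\<forall>n. n \<noteq> 0 \<longrightarrow> (\<exists>c. ?T (\<lambda>z. circle_char n (fst z) - c))) \<and>
      (\<forall>n. n \<noteq> 0 \<longrightarrow> (\<exists>c. ?T (\<lambda>z. circle_char n (snd z) - c)))" (is "?L \<longleftrightarrow> ?X \<and> ?Y")
  proof
    assume L: ?L
    have "\<exists>c. ?T (\<lambda>z. circle_char n (fst z) - c)" if "n \<noteq> 0" for n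
      using L[rule_format, of "(n, 0)"] that by (simp add: torus_char_eq zero_prod_def)
    moreover have "\<exists>c. ?T (\<lambda>z. circle_char n (snd z) - c)" if "n \<noteq> 0" for n
      using L[rule_format, of "(0, n)"] that by (simp add: torus_char_eq zero_prod_def)
    ultimately show "?X \<and> ?Y" by blast
  next
    assume XY: "?X \<and> ?Y"
    \<comment> \<open>for the trivial character the constant \<open>c = 1\<close> gives the zero functional\<close>
    have zero: "?T (\<lambda>z. 0)"
      unfolding bounded_functional_def by (intro exI[of _ 0]) simp
    have X: "\<exists>c. ?T (\<lambda>z. circle_char n (fst z) - c)" for n
      using XY zero by (cases "n = 0") (auto intro: exI[of _ 1])
    have Y: "\<exists>c. ?T (\<lambda>z. circle_char n (snd z) - c)" for n
      using XY zero by (cases "n = 0") (auto intro: exI[of _ 1])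
    have bdd: "bdd_meas torus (\<lambda>z. circle_char n (fst z))" "bdd_meas torus (\<lambda>z. circle_char n (snd z))" for n
      using character_system.bdd_meas_e[OF character_system_torus, of "(n, 0)"]
        character_system.bdd_meas_e[OF character_system_torus, of "(0, n)"]
      by (simp_all add: torus_char_eq[abs_def])
    have "\<exists>c. ?T (\<lambda>z. torus_char (k, m) z - c)" for k m
    proof -
      obtain a b where a: "?T (\<lambda>z. circle_char k (fst z) - a)" and b: "?T (\<lambda>z. circle_char m (snd z) - b)"
        using X Y by blast
      \<comment> \<open>\<open>e\<^sub>k(x) e\<^sub>m(y) - a b = e\<^sub>m(y) (e\<^sub>k(x) - a) + a (e\<^sub>m(y) - b)\<close>\<close>
      have "?T (\<lambda>z. circle_char m (snd z) * (circle_char k (fst z) - a) + a * (circle_char m (snd z) - b))"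
        using assms(1)
        by (intro t.bounded_functional_add bounded_functional_mult a b assms(3) bdd bdd_meas_const
            bdd_meas_mult bdd_meas_diff) auto
      moreover have "circle_char m (snd z) * (circle_char k (fst z) - a) + a * (circle_char m (snd z) - b)
          = torus_char (k, m) z - a * b" for z
        by (simp add: torus_char_eq algebra_simps)
      ultimately show ?thesis by auto
    qed
    then show ?L by (metis surj_pair)
  qed
  then show ?thesis
    unfolding weighted_exp_eq weighted_exp2_eq fun_cong[OF U_def, symmetric] fun_cong[OF V_def, symmetric]
      zero_prod_def[symmetric]
      character_system.complete_minimal_iff[OF character_system_circle U assms(1)]
      character_system.complete_minimal_iff[OF character_system_circle V assms(1)]
      character_system.complete_minimal_iff[OF character_system_torus assms(3,1)]
    using one_u one_v char_u char_v by auto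
qed

end
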